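(* Let $(\Delta,\mathcal A)$ be a thick masure such that $(V,W^v)$ has no irreducible factor of affine type (i.e. no indecomposable component of the generalized Cartan matrix $(\alpha_j(\alpha_i^\vee))_{i,j\in I}$ is of affine type). Let $G$ be a vectorially Weyl subgroup of $\mathrm{Aut}(\Delta)$ that acts transitively on $\mathcal A$ and satisfies condition (LST). Then $G$ contains a strongly regular hyperbolic element.
   Context: \emph{Model apartment.} Let $V$ be a finite-dimensional real vector space, $I$ a nonempty finite set, $(\alpha_i)_{i\in I}$ a linearly independent family in $V^*$, $(\alpha_i^\vee)_{i\in I}$ a family in $V$ such that $(\alpha_j(\alpha_i^\vee))_{i,j}$ is a (possibly decomposable) generalized Cartan matrix. Put $r_i(v)=v-\alpha_i(v)\alpha_i^\vee$, $S=\{r_i\}_{i\in I}$, $W^v=\langle S\rangle\subset GL(V)$ (a Coxeter group), $\Phi=\{w\alpha_i\}$ (real roots; for $\alpha=w\alpha_i$, $\alpha^\vee=w\alpha_i^\vee$, $r_\alpha=wr_iw^{-1}$), $\Phi_{im}$ = imaginary roots of the associated Kac--Moody algebra. For $J\subset I$ (identified with a subset of $S$): $W^v(J)=\langle r_i: i\in J\rangle$ and $F^v(J)=\{v:\alpha_i(v)=0\ (i\in J),\ \alpha_i(v)>0\ (i\notin J)\}$; $C^v_f=F^v(\emptyset)$. Vectorial faces of sign $\pm$ and type $J$ are the $\pm wF^v(J)$, $w\in W^v$; chambers: $J=\emptyset$; panels: $|J|=1$; $J$ and the face are spherical if $W^v(J)$ is finite. $\mathcal T$ (resp. $\mathcal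 T^\circ$) is the union of positive (resp. positive spherical) faces. The model apartment $\mathbb A$ is $V$ as an affine space with walls $M(\alpha,k)=\{v:\alpha(v)+k=0\}$, $\alpha\in\Phi$, $k\in\Lambda_\alpha$, where $0\in\Lambda_\alpha\subset\mathbb R$ is infinite; put $\Lambda_\alpha=\mathbb R$ for $\alpha\in\Phi_{im}$. $D(\alpha,k)=\{v:\alpha(v)+k\ge0\}$. $W^a$ is generated by the affine reflections in the walls $M(\alpha,k)$ with linear part $r_\alpha$, and is assumed to permute the walls. $\mathrm{Aut}(\mathbb A)$: affine bijections permuting the pairs ($M(\alpha,k)$ a wall, $\alpha^\vee$). $x\le y$ iff $y-x\in\mathcal T$; $x\overset{\circ}{<}y$ iff $y-x\in\mathcal T^\circ$. \emph{Filters.} Subsets are identified with the filter of their supersets; a set contains a filter if it is a member of it. The enclosure $cl_{\mathbb A}(F)$ of a filter $F$ consists of the sets containing some member of $F$ of the form $\bigcap_{\alpha\in\Phi\cup\Phi_{im}}D(\alpha,k_\alpha)$, $k_\alpha\in\Lambda_\alpha\cup\{\infty\}$. The support of $F$ is the smallest affine subspace containing it. Local face: $F^\ell(x,F^v)=\mathrm{germ}_x(x+F^v)$ (local chamber, local panel if $F^v$ is a chamber, panel); closed face: enclosure of a local face. Sector-face: $x+F^v$ (base point $x$, direction $F^v$); its shortenings are $x+\xi+F^v$, $\xi\in F^v$; its germ is the filter of sets containing a shortening; sector: $F^v$ a chamber. Chimney: $\mathfrak r(F,F^v)=cl_{\mathbb A}(F+F^v)$, $F$ a local face; splayed if $F^v$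 is spherical, solid if the direction of its support has finite pointwise stabilizer in $W^v$; its germ is the filter of sets containing some $\mathfrak r(F+\xi,F^v)$, $\xi\in F^v$. A ray or segment from $x$ through $y\ne x$ is preordered if $x\le y$ or $y\le x$, generic if $x\overset{\circ}{<}y$ or $y\overset{\circ}{<}x$. \emph{Masures.} An apartment is a set $A$ with a set $Isom^w(\mathbb A,A)$ of bijections of the form $\{f_0\circ w: w\in W^a\}$. A bijection $\varphi:A\to A'$ of apartments is an isomorphism (resp. Weyl, resp. vectorially Weyl) if $f'^{-1}\varphi f$ lies in $\mathrm{Aut}(\mathbb A)$ (resp. $W^a$, resp. $(W^v\ltimes V)\cap\mathrm{Aut}(\mathbb A)$) for $f\in Isom^w(\mathbb A,A)$, $f'\in Isom^w(\mathbb A,A')$. All notions transfer from $\mathbb A$ to apartments. A masure $(\Delta,\mathcal A)$ is a set $\Delta$ covered by a family $\mathcal A$ of subsets (apartments) with: (MA1) each $A\in\mathcal A$ has a structure of apartment; (MA2) if $F$ is a point, germ of preordered interval, generic ray or solid chimney in $A$ and $A'$ is another apartment containing $F$, then $A\cap A'\supset cl_A(F)$ and some Weyl-isomorphism $A\to A'$ fixes $cl_A(F)$ pointwise; (MA3) if $\mathfrak R$ is the germ of a splayed chimney and $F$ a closed face or germ of a solid chimney, some apartment contains $\mathfrak R$ and $F$; (MA4) if $A,A'$ both contain $\mathfrak R,F$ as in (MA3), then $A\cap A'\supset cl_A(\mathfrak R\cup F)$ and some Weyl-isomorphism $A\to A'$ fixes $cl_A(\mathfrak R\cup F)$ pointwise;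 (MAO) if $x,y\in A\cap A'$ and $x\le_A y$, then $[x,y]_A=[x,y]_{A'}$. $\Delta$ is thick if each local panel is contained in (the closure of) at least three local chambers. $\mathrm{Aut}(\Delta)$: bijections $\varphi$ of $\Delta$ permuting $\mathcal A$ such that each $\varphi|_A:A\to\varphi(A)$ is an isomorphism; $\varphi$ is vectorially Weyl if all $\varphi|_A$ are; a vectorially Weyl subgroup consists of vectorially Weyl automorphisms. \emph{Boundary.} Spherical sector-faces are parallel if, after shortening, they lie in a common apartment and are translates of each other there. Parallel classes of spherical sector-faces are the ideal faces (ideal chambers, ideal panels, according to the direction). $\partial A$ is the set of ideal faces represented in $A\in\mathcal A$; two ideal faces are opposite if they lie in a common $\partial A$ with opposite directions. For $x\in\Delta$ and an ideal face $\phi$, $Q_{x,\phi}$ is the unique sector-face of base point $x$ in the class $\phi$. \emph{Condition (LST).} Suppose $|I|\ge2$ ($\Delta$ is not a tree or extended tree). For opposite ideal panels $\sigma,\sigma'$, let $\Delta(\sigma,\sigma')$ be the union of all $A\in\mathcal A$ with $\sigma,\sigma'\in\partial A$. The panel tree $T(\sigma,\sigma')$ is the set of germs of the $Q_{x,\sigma}$, $x\in\Delta(\sigma,\sigma')$; it is an $\mathbb R$-tree whose apartments are the images of such $A$ under $x\mapsto\mathrm{germ}(Q_{x,\sigma})$, each a real line (the quotient of $A$ by the span of the direction of $\sigma$) with vertices the images of the walls of $A$ having $\sigma,\sigma'$ at infinity. $G$ satisfies (LST) if for every such pair the stabilizer $G_{\sigma,\sigma'}$ of $\sigma$ and $\sigma'$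 in $G$ acts strongly transitively on $T(\sigma,\sigma')$: transitively on its apartments, and the stabilizer of an apartment induces on it a group containing its affine Weyl group (generated by the reflections of the line in its vertices). If $|I|=1$, so that $\Delta$ is a tree or an extended tree (product of a tree and a real vector space), (LST) means that $G$ acts strongly transitively, in the same sense, on the associated (quotient) tree. \emph{Strongly regular hyperbolic.} $\gamma\in\mathrm{Aut}(\Delta)$ is hyperbolic if there is an apartment $A$ and a line in $A$ (a translation axis) along which $\gamma$ acts as a (nontrivial) translation; it is strongly regular if moreover the axis can be chosen with direction in $\mathcal T^\circ\cup-\mathcal T^\circ$ and in no wall direction $\ker\alpha$, $\alpha\in\Phi$. *)

theory Defs
  imports "HOL-Analysis.Analysis"
begin

section \<open>Groups of bijections and filters\<close>

inductive_set generated_by :: "('a \<Rightarrow> 'a) set \<Rightarrow> ('a \<Rightarrow> 'a) set"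
  for S :: "('a \<Rightarrow> 'a) set" where
  gen_id: "id \<in> generated_by S"
| gen_base: "s \<in> S \<Longrightarrow> s \<in> generated_by S"
| gen_comp: "f \<in> generated_by S \<Longrightarrow> g \<in> generated_by S \<Longrightarrow> f \<circ> g \<in> generated_by S"
| gen_inv: "f \<in> generated_by S \<Longrightarrow> inv f \<in> generated_by S"

definition bij_subgroup :: "('a \<Rightarrow> 'a) set \<Rightarrow> bool" where
  "bij_subgroup G \<longleftrightarrow>
     id \<in> G \<and> (\<forall>g\<in>G. bij g \<and> inv g \<in> G) \<and> (\<forall>g\<in>G. \<forall>h\<in>G. g \<circ> h \<in> G)"

text \<open>
  Filters are filters of the library: the sets belonging to \<open>F\<close> are the \<open>S\<close> with
  \<open>eventually (\<lambda>x. x \<in> S) F\<close>, a subset is identified with its \<^const>\<open>principal\<close> filter, and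
  the relation "the set \<open>S\<close> contains the filter \<open>F\<close>" is \<open>F \<le> principal S\<close>.  The library orders
  filters so that finer filters are smaller; hence the filter of all sets containing some member
  of a family of sets directed downwards is an \<^const>\<open>Inf\<close> of principal filters, and the
  filter of the sets that contain both \<open>F\<close> and \<open>F'\<close> is \<open>sup F F'\<close>.
\<close>

definition in_filter :: "'a set \<Rightarrow> 'a filter \<Rightarrow> bool" where
  "in_filter S F \<longleftrightarrow> F \<le> principal S"

definition closure_filter :: "'a::topological_space filter \<Rightarrow> 'a filter" where
  "closure_filter F = (INF S\<in>{S. in_filter S F}. principal (closure S))"

definition support :: "'v::real_vector filter \<Rightarrow> 'v set" where
  "support F = \<Inter>{B. affine B \<and> in_filter B F}"

definition direction :: "'v::real_vector set \<Rightarrow> 'v set" where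
  "direction B = {x - y | x y. x \<in> B \<and> y \<in> B}"

definition filter_plus :: "'v::plus filter \<Rightarrow> 'v set \<Rightarrow> 'v filter" where
  "filter_plus F B = filtermap (\<lambda>(u, v). u + v) (F \<times>\<^sub>F principal B)"

definition local_face :: "'v::real_normed_vector \<Rightarrow> 'v set \<Rightarrow> 'v filter" where
  "local_face x F = inf (nhds x) (principal ((+) x ` F))"

text \<open>
  Germs at \<open>x\<close> of an interval of end points \<open>x \<noteq> y\<close>; \<open>x\<close> may belong to the interval or not.
\<close>
definition interval_germs :: "'v::real_normed_vector \<Rightarrow> 'v \<Rightarrow> 'v filter set" where
  "interval_germs x y =
     {inf (nhds x) (principal (closed_segment x y)),
      inf (nhds x) (principal (closed_segment x y - {x}))}"

definition ray :: "'v::real_vector \<Rightarrow> 'v \<Rightarrow> 'v set" where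
  "ray x y = {x + t *\<^sub>R (y - x) | t. 0 \<le> t}"

section \<open>Root data\<close>

text \<open>
  Terms denoting elements of the complex Kac--Moody algebra: \<open>GenH v\<close> is the element \<open>v\<close> of the
  Cartan subalgebra \<open>V \<otimes> \<complex>\<close>, and \<open>GenE\<close>, \<open>GenF\<close> are the Chevalley generators.
\<close>
datatype ('i, 'v) lie_term =
    LZero
  | LAdd "('i, 'v) lie_term" "('i, 'v) lie_term"
  | LScale complex "('i, 'v) lie_term"
  | LBr "('i, 'v) lie_term" "('i, 'v) lie_term"
  | GenH 'v
  | GenE 'i
  | GenF 'i

locale root_datum =
  fixes alpha :: "'i::finite \<Rightarrow> 'v::euclidean_space \<Rightarrow> real"
    and coalpha :: "'i \<Rightarrow> 'v"
  assumes alpha_linear: "linear (alpha i)"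
    and alpha_independent:
      "(\<forall>v. (\<Sum>i\<in>UNIV. c i * alpha i v) = 0) \<Longrightarrow> c i = 0"
    and cartan_diag: "alpha i (coalpha i) = 2"
    and cartan_offdiag: "i \<noteq> j \<Longrightarrow> alpha j (coalpha i) \<in> \<int> \<and> alpha j (coalpha i) \<le> 0"
    and cartan_zero: "alpha j (coalpha i) = 0 \<longleftrightarrow> alpha i (coalpha j) = 0"
begin

definition cartan :: "'i \<Rightarrow> 'i \<Rightarrow> real" where
  "cartan i j = alpha j (coalpha i)"

definition indecomposable_component :: "'i set \<Rightarrow> bool" where
  "indecomposable_component J \<longleftrightarrow>
     J \<noteq> {} \<and> (\<forall>i\<in>J. \<forall>j\<in>- J. cartan i j = 0) \<and>
     (\<forall>K. K \<noteq> {} \<and> K \<subset> J \<longrightarrow> (\<exists>i\<in>K. \<exists>j\<in>J - K. cartan i j \<noteq> 0))"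

text \<open>
  Kac's definition of affine type for the matrix \<open>A = (cartan i j)\<close>, \<open>i, j \<in> J\<close>: the corank of \<open>A\<close>
  is 1, there is \<open>u > 0\<close> with \<open>A u = 0\<close>, and \<open>A u \<ge> 0\<close> implies \<open>A u = 0\<close>.
\<close>
definition affine_type :: "'i set \<Rightarrow> bool" where
  "affine_type J \<longleftrightarrow>
     dim {u :: real^'i. (\<forall>i\<in>J. (\<Sum>j\<in>J. cartan i j * u $ j) = 0) \<and> (\<forall>i\<in>- J. u $ i = 0)} = 1 \<and>
     (\<exists>u :: real^'i. (\<forall>j\<in>J. u $ j > 0) \<and> (\<forall>i\<in>J. (\<Sum>j\<in>J. cartan i j * u $ j) = 0)) \<and>
     (\<forall>u :: real^'i. (\<forall>i\<in>J. (\<Sum>j\<in>J. cartan i j * u $ j) \<ge> 0) \<longrightarrow>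
        (\<forall>i\<in>J. (\<Sum>j\<in>J. cartan i j * u $ j) = 0))"

definition no_affine_component :: bool where
  "no_affine_component \<longleftrightarrow> (\<forall>J. indecomposable_component J \<longrightarrow> \<not> affine_type J)"

definition refl :: "'i \<Rightarrow> 'v \<Rightarrow> 'v" where
  "refl i v = v - alpha i v *\<^sub>R coalpha i"

definition W_par :: "'i set \<Rightarrow> ('v \<Rightarrow> 'v) set" where
  "W_par J = generated_by (refl ` J)"

definition W :: "('v \<Rightarrow> 'v) set" where
  "W = W_par UNIV"

text \<open>The pairs of a real root \<open>\<alpha>\<close> and its coroot: \<open>w \<alpha>\<^sub>i = \<alpha>\<^sub>i \<circ> w\<^sup>-\<^sup>1\<close> with \<open>w \<alpha>\<^sub>i\<^sup>\<or>\<close>.\<close>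
definition root_pairs :: "(('v \<Rightarrow> real) \<times> 'v) set" where
  "root_pairs = {(alpha i \<circ> inv w, w (coalpha i)) | i w. w \<in> W}"

definition real_roots :: "('v \<Rightarrow> real) set" where
  "real_roots = fst ` root_pairs"

text \<open>
  The complex Kac--Moody algebra with Cartan subalgebra \<open>V \<otimes> \<complex>\<close>, given by the usual generators and
  relations (including the Serre relations): \<open>lie_eq s t\<close> holds iff \<open>s\<close> and \<open>t\<close> denote the same
  element of it.
\<close>
inductive lie_eq :: "('i, 'v) lie_term \<Rightarrow> ('i, 'v) lie_term \<Rightarrow> bool" where
  eq_refl: "lie_eq x x"
| eq_sym: "lie_eq x y \<Longrightarrow> lie_eq y x"
| eq_trans: "lie_eq x y \<Longrightarrow> lie_eq y z \<Longrightarrow> lie_eq x z"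
| cong_add: "lie_eq x x' \<Longrightarrow> lie_eq y y' \<Longrightarrow> lie_eq (LAdd x y) (LAdd x' y')"
| cong_scale: "lie_eq x x' \<Longrightarrow> lie_eq (LScale a x) (LScale a x')"
| cong_br: "lie_eq x x' \<Longrightarrow> lie_eq y y' \<Longrightarrow> lie_eq (LBr x y) (LBr x' y')"
| add_assoc: "lie_eq (LAdd (LAdd x y) z) (LAdd x (LAdd y z))"
| add_comm: "lie_eq (LAdd x y) (LAdd y x)"
| add_zero: "lie_eq (LAdd LZero x) x"
| add_neg: "lie_eq (LAdd x (LScale (-1) x)) LZero"
| scale_add_right: "lie_eq (LScale a (LAdd x y)) (LAdd (LScale a x) (LScale a y))"
| scale_add_left: "lie_eq (LScale (a + b) x) (LAdd (LScale a x) (LScale b x))"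
| scale_scale: "lie_eq (LScale a (LScale b x)) (LScale (a * b) x)"
| scale_one: "lie_eq (LScale 1 x) x"
| br_add_left: "lie_eq (LBr (LAdd x y) z) (LAdd (LBr x z) (LBr y z))"
| br_add_right: "lie_eq (LBr x (LAdd y z)) (LAdd (LBr x y) (LBr x z))"
| br_scale_left: "lie_eq (LBr (LScale a x) y) (LScale a (LBr x y))"
| br_scale_right: "lie_eq (LBr x (LScale a y)) (LScale a (LBr x y))"
| br_alt: "lie_eq (LBr x x) LZero"
| jacobi: "lie_eq (LAdd (LBr x (LBr y z)) (LAdd (LBr y (LBr z x)) (LBr z (LBr x y)))) LZero"
| h_add: "lie_eq (GenH (u + v)) (LAdd (GenH u) (GenH v))"
| h_scale: "lie_eq (GenH (c *\<^sub>R v)) (LScale (complex_of_real c) (GenH v))"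
| h_h: "lie_eq (LBr (GenH u) (GenH v)) LZero"
| e_f_same: "lie_eq (LBr (GenE i) (GenF i)) (GenH (coalpha i))"
| e_f_diff: "i \<noteq> j \<Longrightarrow> lie_eq (LBr (GenE i) (GenF j)) LZero"
| h_e: "lie_eq (LBr (GenH v) (GenE i)) (LScale (complex_of_real (alpha i v)) (GenE i))"
| h_f: "lie_eq (LBr (GenH v) (GenF i)) (LScale (- complex_of_real (alpha i v)) (GenF i))"
| serre_e: "i \<noteq> j \<Longrightarrow> lie_eq ((LBr (GenE i) ^^ nat (1 - \<lfloor>cartan i j\<rfloor>)) (GenE j)) LZero"
| serre_f: "i \<noteq> j \<Longrightarrow> lie_eq ((LBr (GenF i) ^^ nat (1 - \<lfloor>cartan i j\<rfloor>)) (GenF j)) LZero"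

definition lie_roots :: "('v \<Rightarrow> real) set" where
  "lie_roots = {b. linear b \<and> b \<noteq> (\<lambda>v. 0) \<and>
     (\<exists>x. \<not> lie_eq x LZero \<and>
          (\<forall>h. lie_eq (LBr (GenH h) x) (LScale (complex_of_real (b h)) x)))}"

definition imaginary_roots :: "('v \<Rightarrow> real) set" where
  "imaginary_roots = lie_roots - real_roots"

definition Fv :: "'i set \<Rightarrow> 'v set" where
  "Fv J = {v. (\<forall>i\<in>J. alpha i v = 0) \<and> (\<forall>i\<in>- J. alpha i v > 0)}"

definition vec_face :: "real \<Rightarrow> ('v \<Rightarrow> 'v) \<Rightarrow> 'i set \<Rightarrow> 'v set" where
  "vec_face s w J = (\<lambda>v. s *\<^sub>R w v) ` Fv J"

definition vec_faces :: "'v set set" where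
  "vec_faces = {vec_face s w J | s w J. s \<in> {1, -1} \<and> w \<in> W}"

definition spherical_faces :: "'v set set" where
  "spherical_faces = {vec_face s w J | s w J. s \<in> {1, -1} \<and> w \<in> W \<and> finite (W_par J)}"

definition vec_chambers :: "'v set set" where
  "vec_chambers = {vec_face s w {} | s w. s \<in> {1, -1} \<and> w \<in> W}"

definition vec_panels :: "'v set set" where
  "vec_panels = {vec_face s w J | s w J. s \<in> {1, -1} \<and> w \<in> W \<and> card J = 1}"

definition tits_cone :: "'v set" where
  "tits_cone = \<Union>{vec_face 1 w J | w J. w \<in> W}"

definition tits_cone_sph :: "'v set" where
  "tits_cone_sph = \<Union>{vec_face 1 w J | w J. w \<in> W \<and> finite (W_par J)}"

definition le :: "'v \<Rightarrow> 'v \<Rightarrow> bool" where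
  "le x y \<longleftrightarrow> y - x \<in> tits_cone"

definition lt_sph :: "'v \<Rightarrow> 'v \<Rightarrow> bool" where
  "lt_sph x y \<longleftrightarrow> y - x \<in> tits_cone_sph"

end

section \<open>The model apartment\<close>

definition wall :: "('v \<Rightarrow> real) \<Rightarrow> real \<Rightarrow> 'v set" where
  "wall b k = {v. b v + k = 0}"

text \<open>\<open>D(\<alpha>, k)\<close>, with \<open>D(\<alpha>, \<infinity>)\<close> the whole space.\<close>
definition half_apt :: "('v \<Rightarrow> real) \<Rightarrow> ereal \<Rightarrow> 'v set" where
  "half_apt b k = {v. ereal (b v) + k \<ge> 0}"

locale pre_model_apartment = root_datum alpha coalpha
  for alpha :: "'i::finite \<Rightarrow> 'v::euclidean_space \<Rightarrow> real" and coalpha :: "'i \<Rightarrow> 'v" +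
  fixes Lam :: "('v \<Rightarrow> real) \<Rightarrow> real set"
begin

definition walls :: "'v set set" where
  "walls = {wall b k | b k. b \<in> real_roots \<and> k \<in> Lam b}"

definition Wa :: "('v \<Rightarrow> 'v) set" where
  "Wa = generated_by {\<lambda>v. v - (b v + k) *\<^sub>R c | b c k. (b, c) \<in> root_pairs \<and> k \<in> Lam b}"

text \<open>Affine bijections \<open>v \<mapsto> l v + t\<close>; the coroot of a wall is moved by the linear part.\<close>
definition AutA :: "('v \<Rightarrow> 'v) set" where
  "AutA = {u. bij u \<and> (\<exists>l t. linear l \<and> u = (\<lambda>v. l v + t) \<and>
     (\<lambda>(M, c). (u ` M, l c)) ` {(wall b k, c) | b c k. (b, c) \<in> root_pairs \<and> k \<in> Lam b}
       = {(wall b k, c) | b c k. (b, c) \<in> root_pairs \<and> k \<in> Lam b})}"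

definition WV :: "('v \<Rightarrow> 'v) set" where
  "WV = {\<lambda>v. w v + t | w t. w \<in> W}"

definition Lam_ext :: "('v \<Rightarrow> real) \<Rightarrow> real set" where
  "Lam_ext b = (if b \<in> imaginary_roots then UNIV else Lam b)"

definition enclosed_sets :: "'v set set" where
  "enclosed_sets = {\<Inter>b\<in>real_roots \<union> imaginary_roots. half_apt b (k b) | k.
     \<forall>b\<in>real_roots \<union> imaginary_roots. k b \<in> ereal ` Lam_ext b \<union> {\<infinity>}}"

definition encl :: "'v filter \<Rightarrow> 'v filter" where
  "encl F = (INF S\<in>{S \<in> enclosed_sets. in_filter S F}. principal S)"

definition local_faces :: "'v filter set" where
  "local_faces = {local_face x F | x F. F \<in> vec_faces}"

definition closed_faces :: "'v filter set" where
  "closed_faces = encl ` local_faces"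

definition chimney :: "'v filter \<Rightarrow> 'v set \<Rightarrow> 'v filter" where
  "chimney L F = encl (filter_plus L F)"

definition solid :: "'v filter \<Rightarrow> bool" where
  "solid R \<longleftrightarrow> finite {w \<in> W. \<forall>d\<in>direction (support R). w d = d}"

definition chimney_germ :: "'v filter \<Rightarrow> 'v set \<Rightarrow> 'v filter" where
  "chimney_germ L F = (INF \<xi>\<in>F. chimney (filtermap ((+) \<xi>) L) F)"

definition solid_chimneys :: "'v filter set" where
  "solid_chimneys =
     {chimney L F | L F. L \<in> local_faces \<and> F \<in> vec_faces \<and> solid (chimney L F)}"

definition solid_chimney_germs :: "'v filter set" where
  "solid_chimney_germs =
     {chimney_germ L F | L F. L \<in> local_faces \<and> F \<in> vec_faces \<and> solid (chimney L F)}"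

definition splayed_chimney_germs :: "'v filter set" where
  "splayed_chimney_germs =
     {chimney_germ L F | L F. L \<in> local_faces \<and> F \<in> spherical_faces}"

definition preordered_interval_germs :: "'v filter set" where
  "preordered_interval_germs = \<Union>{interval_germs x y | x y. x \<noteq> y \<and> (le x y \<or> le y x)}"

definition generic_rays :: "'v set set" where
  "generic_rays = {ray x y | x y. x \<noteq> y \<and> (lt_sph x y \<or> lt_sph y x)}"

definition MA2_filters :: "'v filter set" where
  "MA2_filters = {principal {x} | x. True} \<union> preordered_interval_germs
     \<union> principal ` generic_rays \<union> solid_chimneys"

end

text \<open>
  \<open>Lam b\<close> is the set of all \<open>k\<close> such that \<open>M(b, k)\<close> is a wall (\<open>Lam_wall\<close>).  As
  \<open>M(-b, -k) = M(b, k)\<close>, this is the convention \<open>\<Lambda>\<^bsub>-\<alpha>\<^esub> = - \<Lambda>\<^bsub>\<alpha>\<^esub>\<close>, needed for enclosures to be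
  invariant under the affine Weyl group.
\<close>
locale model_apartment = pre_model_apartment alpha coalpha Lam
  for alpha :: "'i::finite \<Rightarrow> 'v::euclidean_space \<Rightarrow> real" and coalpha :: "'i \<Rightarrow> 'v"
    and Lam :: "('v \<Rightarrow> real) \<Rightarrow> real set" +
  assumes Lam_zero: "b \<in> real_roots \<Longrightarrow> 0 \<in> Lam b"
    and Lam_infinite: "b \<in> real_roots \<Longrightarrow> infinite (Lam b)"
    and Lam_wall: "b \<in> real_roots \<Longrightarrow> wall b k \<in> walls \<Longrightarrow> k \<in> Lam b"
    and Wa_walls: "w \<in> Wa \<Longrightarrow> (`) w ` walls = walls"

section \<open>Masures\<close>

text \<open>
  The set \<open>\<Delta>\<close> is the type \<open>'p\<close>.  A chart \<open>f \<in> Isom A\<close> is a map \<open>V \<Rightarrow> 'p\<close> that is a bijection onto \<open>A\<close>.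
  A filter in the apartment \<open>A\<close> is the image \<open>filtermap f F\<close> of a filter \<open>F\<close> of the model
  apartment; as a filter on \<open>'p\<close> it does not depend on the apartment it is seen in.
\<close>
locale pre_masure = model_apartment alpha coalpha Lam
  for alpha :: "'i::finite \<Rightarrow> 'v::euclidean_space \<Rightarrow> real" and coalpha :: "'i \<Rightarrow> 'v"
    and Lam :: "('v \<Rightarrow> real) \<Rightarrow> real set" +
  fixes Apts :: "'p set set"
    and Isom :: "'p set \<Rightarrow> ('v \<Rightarrow> 'p) set"
begin

definition apartment :: "'p set \<Rightarrow> bool" where
  "apartment A \<longleftrightarrow> Isom A \<noteq> {} \<and>
     (\<forall>f\<in>Isom A. bij_betw f UNIV A \<and> Isom A = {f \<circ> w | w. w \<in> Wa})"

text \<open>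
  Isomorphisms, Weyl isomorphisms and vectorially Weyl isomorphisms of apartments are obtained for
  \<open>K\<close> equal to \<open>AutA\<close>, \<open>Wa\<close> and \<open>WV \<inter> AutA\<close>.
\<close>
definition apt_iso :: "('v \<Rightarrow> 'v) set \<Rightarrow> 'p set \<Rightarrow> 'p set \<Rightarrow> ('p \<Rightarrow> 'p) \<Rightarrow> bool" where
  "apt_iso K A A' \<phi> \<longleftrightarrow>
     bij_betw \<phi> A A' \<and> (\<forall>f\<in>Isom A. \<forall>f'\<in>Isom A'. inv f' \<circ> \<phi> \<circ> f \<in> K)"

text \<open>The images in \<open>\<Delta>\<close> of the filters of the class \<open>\<F>\<close>.\<close>
definition transfer :: "'v filter set \<Rightarrow> 'p filter set" where
  "transfer \<F> = {filtermap f F | A f F. A \<in> Apts \<and> f \<in> Isom A \<and> F \<in> \<F>}"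

text \<open>Enclosure, computed in the chart \<open>f\<close> of \<open>A\<close>, of a filter in \<open>A\<close>.\<close>
definition encl_chart :: "('v \<Rightarrow> 'p) \<Rightarrow> 'p filter \<Rightarrow> 'p filter" where
  "encl_chart f F = filtermap f (encl (filtercomap f F))"

text \<open>
  The common conclusion of (MA2) and (MA4): \<open>A \<inter> A'\<close> contains \<open>cl\<^sub>A(F)\<close> and some Weyl isomorphism
  fixes \<open>cl\<^sub>A(F)\<close> (that is, one of its members) pointwise.
\<close>
definition encl_agree :: "'p set \<Rightarrow> 'p set \<Rightarrow> 'p filter \<Rightarrow> bool" where
  "encl_agree A A' F \<longleftrightarrow>
     (\<forall>f\<in>Isom A. in_filter (A \<inter> A') (encl_chart f F) \<and>
        (\<exists>\<phi>. apt_iso Wa A A' \<phi> \<and> eventually (\<lambda>x. \<phi> x = x) (encl_chart f F)))"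

definition MA1 :: bool where
  "MA1 \<longleftrightarrow> (\<forall>A\<in>Apts. apartment A)"

definition MA2 :: bool where
  "MA2 \<longleftrightarrow> (\<forall>A\<in>Apts. \<forall>A'\<in>Apts. \<forall>f\<in>Isom A. \<forall>F\<in>MA2_filters.
     in_filter A' (filtermap f F) \<longrightarrow> encl_agree A A' (filtermap f F))"

definition MA3 :: bool where
  "MA3 \<longleftrightarrow> (\<forall>R\<in>transfer splayed_chimney_germs.
     \<forall>F\<in>transfer (closed_faces \<union> solid_chimney_germs).
       \<exists>A\<in>Apts. in_filter A R \<and> in_filter A F)"

definition MA4 :: bool where
  "MA4 \<longleftrightarrow> (\<forall>R\<in>transfer splayed_chimney_germs.
     \<forall>F\<in>transfer (closed_faces \<union> solid_chimney_germs). \<forall>A\<in>Apts. \<forall>A'\<in>Apts.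
       in_filter A R \<and> in_filter A F \<and> in_filter A' R \<and> in_filter A' F \<longrightarrow>
         encl_agree A A' (sup R F))"

definition MAO :: bool where
  "MAO \<longleftrightarrow> (\<forall>A\<in>Apts. \<forall>A'\<in>Apts. \<forall>f\<in>Isom A. \<forall>f'\<in>Isom A'. \<forall>u v u' v'.
     f u = f' u' \<and> f v = f' v' \<and> le u v \<longrightarrow>
       f ` closed_segment u v = f' ` closed_segment u' v')"

definition covers :: "'p filter \<Rightarrow> 'p filter \<Rightarrow> bool" where
  "covers C P \<longleftrightarrow> (\<exists>A\<in>Apts. \<exists>f\<in>Isom A. \<exists>x. \<exists>F\<in>vec_chambers.
     C = filtermap f (local_face x F) \<and>
     P \<le> filtermap f (closure_filter (local_face x F)))"

definition thick :: bool where
  "thick \<longleftrightarrow> (\<forall>P\<in>transfer {local_face x F | x F. F \<in> vec_panels}.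
     \<exists>\<C>. card \<C> = 3 \<and> (\<forall>C\<in>\<C>. covers C P))"

definition Aut :: "('p \<Rightarrow> 'p) set" where
  "Aut = {\<phi>. bij \<phi> \<and> (`) \<phi> ` Apts = Apts \<and> (\<forall>A\<in>Apts. apt_iso AutA A (\<phi> ` A) \<phi>)}"

definition vectorially_Weyl :: "('p \<Rightarrow> 'p) \<Rightarrow> bool" where
  "vectorially_Weyl \<phi> \<longleftrightarrow> (\<forall>A\<in>Apts. apt_iso (WV \<inter> AutA) A (\<phi> ` A) \<phi>)"

definition vectorially_Weyl_subgroup :: "('p \<Rightarrow> 'p) set \<Rightarrow> bool" where
  "vectorially_Weyl_subgroup G \<longleftrightarrow> bij_subgroup G \<and> G \<subseteq> Aut \<and> (\<forall>g\<in>G. vectorially_Weyl g)"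

definition transitive_on_apartments :: "('p \<Rightarrow> 'p) set \<Rightarrow> bool" where
  "transitive_on_apartments G \<longleftrightarrow> (\<forall>A\<in>Apts. \<forall>A'\<in>Apts. \<exists>g\<in>G. g ` A = A')"

subsection \<open>Boundary\<close>

definition shortening :: "'p set \<Rightarrow> 'p set \<Rightarrow> bool" where
  "shortening S T \<longleftrightarrow> (\<exists>A\<in>Apts. \<exists>f\<in>Isom A. \<exists>x. \<exists>F\<in>spherical_faces. \<exists>\<xi>\<in>F.
     S = f ` (+) x ` F \<and> T = f ` (+) (x + \<xi>) ` F)"

definition parallel :: "'p set \<Rightarrow> 'p set \<Rightarrow> bool" where
  "parallel S S' \<longleftrightarrow> (\<exists>A\<in>Apts. \<exists>f\<in>Isom A. \<exists>x y. \<exists>F\<in>spherical_faces.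
     shortening S (f ` (+) x ` F) \<and> shortening S' (f ` (+) y ` F))"

definition ideal_class :: "'p set \<Rightarrow> 'p set set" where
  "ideal_class S = {T. parallel S T}"

definition boundary :: "'p set \<Rightarrow> 'p set set set" where
  "boundary A = {ideal_class (f ` (+) x ` F) | f x F. f \<in> Isom A \<and> F \<in> spherical_faces}"

definition ideal_panels :: "'p set set set" where
  "ideal_panels =
     {ideal_class (f ` (+) x ` F) | A f x F. A \<in> Apts \<and> f \<in> Isom A \<and> F \<in> vec_panels}"

definition opposite :: "'p set set \<Rightarrow> 'p set set \<Rightarrow> bool" where
  "opposite \<sigma> \<sigma>' \<longleftrightarrow> (\<exists>A\<in>Apts. \<exists>f\<in>Isom A. \<exists>x y. \<exists>F\<in>spherical_faces.
     \<sigma> = ideal_class (f ` (+) x ` F) \<and> \<sigma>' = ideal_class (f ` (+) y ` uminus ` F))"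

definition based_at :: "'p \<Rightarrow> 'p set \<Rightarrow> bool" where
  "based_at p S \<longleftrightarrow> (\<exists>A\<in>Apts. \<exists>f\<in>Isom A. \<exists>x. \<exists>F\<in>spherical_faces.
     p = f x \<and> S = f ` (+) x ` F)"

definition Q :: "'p \<Rightarrow> 'p set set \<Rightarrow> 'p set" where
  "Q p \<phi> = (THE S. S \<in> \<phi> \<and> based_at p S)"

definition sector_germ :: "'p set \<Rightarrow> 'p filter" where
  "sector_germ S = (INF T\<in>{T. shortening S T}. principal T)"

definition stabilizer2 ::
  "('p \<Rightarrow> 'p) set \<Rightarrow> 'p set set \<Rightarrow> 'p set set \<Rightarrow> ('p \<Rightarrow> 'p) set" where
  "stabilizer2 G \<sigma> \<sigma>' = {g \<in> G. (`) g ` \<sigma> = \<sigma> \<and> (`) g ` \<sigma>' = \<sigma>'}"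

end

subsection \<open>Condition (LST)\<close>

text \<open>
  A tree is described by its set of apartments, each given with a parametrization \<open>l\<close> by the real
  line and the set \<open>C\<close> of the parameters of its vertices; \<open>act g\<close> is the action of \<open>g\<close> on the tree.
  The reflection of the line in the vertex of parameter \<open>c\<close> is \<open>t \<mapsto> 2 * c - t\<close>.
\<close>
definition strongly_transitive ::
  "('g \<Rightarrow> 't \<Rightarrow> 't) \<Rightarrow> 'g set \<Rightarrow> ((real \<Rightarrow> 't) \<times> real set) set \<Rightarrow> bool" where
  "strongly_transitive act H X \<longleftrightarrow>
     (\<forall>(l, C)\<in>X. \<forall>(l', C')\<in>X. \<exists>g\<in>H. act g ` range l = range l') \<and>
     (\<forall>(l, C)\<in>X. \<forall>\<gamma>\<in>generated_by {\<lambda>t. 2 * c - t | c. c \<in> C}.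
        \<exists>g\<in>H. act g ` range l = range l \<and> (\<forall>t. act g (l t) = l (\<gamma> t)))"

context pre_masure
begin

text \<open>
  Let \<open>F\<close> be the direction of \<open>\<sigma>\<close> in \<open>A\<close> and \<open>b\<close> a real root vanishing on \<open>F\<close>, so that \<open>ker b\<close> is the
  span of \<open>F\<close>.  Then \<open>b\<close> identifies the quotient of \<open>A\<close> by this span with the real line, and \<open>c\<close> is
  the image of a wall of \<open>A\<close> having \<open>\<sigma>\<close>, \<open>\<sigma>'\<close> at infinity iff \<open>M(b, -c) = {v. b v = c}\<close> is a wall.
\<close>
definition panel_tree_lines ::
  "'p set set \<Rightarrow> 'p set set \<Rightarrow> ((real \<Rightarrow> 'p filter) \<times> real set) set" where
  "panel_tree_lines \<sigma> \<sigma>' = {(l, C). \<exists>A\<in>Apts. \<exists>f\<in>Isom A. \<exists>x. \<exists>F\<in>vec_panels. \<exists>b\<in>real_roots.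
     \<sigma> \<in> boundary A \<and> \<sigma>' \<in> boundary A \<and> \<sigma> = ideal_class (f ` (+) x ` F) \<and>
     (\<forall>v\<in>F. b v = 0) \<and> (\<forall>v. l (b v) = sector_germ (Q (f v) \<sigma>)) \<and>
     C = {c. wall b (- c) \<in> walls}}"

text \<open>For \<open>|I| = 1\<close>, the fibre through \<open>p\<close> of the projection of \<open>\<Delta>\<close> onto its quotient tree.\<close>
definition tree_class :: "'p \<Rightarrow> 'p set" where
  "tree_class p = {q. \<exists>A\<in>Apts. \<exists>f\<in>Isom A. \<exists>u v.
     p = f u \<and> q = f v \<and> (\<forall>i. alpha i u = alpha i v)}"

definition quotient_tree_lines :: "((real \<Rightarrow> 'p set) \<times> real set) set" where
  "quotient_tree_lines = {(l, C). \<exists>A\<in>Apts. \<exists>f\<in>Isom A. \<exists>i.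
     (\<forall>v. l (alpha i v) = tree_class (f v)) \<and> C = {c. wall (alpha i) (- c) \<in> walls}}"

definition LST :: "('p \<Rightarrow> 'p) set \<Rightarrow> bool" where
  "LST G \<longleftrightarrow>
     (if CARD('i) \<ge> 2 then
        \<forall>\<sigma>\<in>ideal_panels. \<forall>\<sigma>'\<in>ideal_panels. opposite \<sigma> \<sigma>' \<longrightarrow>
          strongly_transitive filtermap (stabilizer2 G \<sigma> \<sigma>') (panel_tree_lines \<sigma> \<sigma>')
      else strongly_transitive (`) G quotient_tree_lines)"

subsection \<open>Strongly regular hyperbolic automorphisms\<close>

text \<open>\<open>d\<close> directs, in the chart \<open>f\<close>, a line along which \<open>\<gamma>\<close> is a nontrivial translation.\<close>
definition translation_axis :: "('p \<Rightarrow> 'p) \<Rightarrow> ('v \<Rightarrow> 'p) \<Rightarrow> 'v \<Rightarrow> 'v \<Rightarrow> bool" where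
  "translation_axis \<gamma> f x d \<longleftrightarrow>
     d \<noteq> 0 \<and> (\<exists>c. c \<noteq> 0 \<and> (\<forall>t. \<gamma> (f (x + t *\<^sub>R d)) = f (x + (t + c) *\<^sub>R d)))"

definition hyperbolic :: "('p \<Rightarrow> 'p) \<Rightarrow> bool" where
  "hyperbolic \<gamma> \<longleftrightarrow> \<gamma> \<in> Aut \<and> (\<exists>A\<in>Apts. \<exists>f\<in>Isom A. \<exists>x d. translation_axis \<gamma> f x d)"

definition strongly_regular_hyperbolic :: "('p \<Rightarrow> 'p) \<Rightarrow> bool" where
  "strongly_regular_hyperbolic \<gamma> \<longleftrightarrow>
     hyperbolic \<gamma> \<and>
     (\<exists>A\<in>Apts. \<exists>f\<in>Isom A. \<exists>x d. translation_axis \<gamma> f x d \<and>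
        d \<in> tits_cone_sph \<union> uminus ` tits_cone_sph \<and> (\<forall>b\<in>real_roots. b d \<noteq> 0))"

end

locale masure = pre_masure alpha coalpha Lam Apts Isom
  for alpha :: "'i::finite \<Rightarrow> 'v::euclidean_space \<Rightarrow> real" and coalpha :: "'i \<Rightarrow> 'v"
    and Lam :: "('v \<Rightarrow> real) \<Rightarrow> real set"
    and Apts :: "'p set set" and Isom :: "'p set \<Rightarrow> ('v \<Rightarrow> 'p) set" +
  assumes apts_cover: "\<Union>Apts = UNIV"
    and ma1: "MA1" and ma2: "MA2" and ma3: "MA3" and ma4: "MA4" and mao: "MAO"

end

theory Submission
  imports Defs
begin

text \<open>
  Fix an apartment \<open>A\<close> with a chart \<open>f\<close>, and let \<open>T\<close> be the group of the vectors \<open>d\<close> such that some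
  element of \<open>G\<close> stabilizes \<open>A\<close> and acts on it as the translation by \<open>d\<close>.  It suffices to find
  an element of \<open>T\<close> in the open fundamental chamber: no real root vanishes there, because every real
  root is, up to sign, a nonnegative combination of simple roots (\<open>real_root_on_chamber\<close>).

  Condition (LST) provides, for every simple root \<open>\<alpha>\<^sub>i\<close> and every wall of direction \<open>ker \<alpha>\<^sub>i\<close>, an
  element of \<open>G\<close> that stabilizes \<open>A\<close>, has linear part \<open>r\<^sub>i\<close> there and preserves this wall
  (\<open>affine_reflection_in_group\<close>).  It need not be the reflection: it may translate along the wall.
  The product of two of these elements, for two parallel walls, is a translation by a vector \<open>d\<close>
  with \<open>\<alpha>\<^sub>i(d) \<noteq> 0\<close>; conjugation by one of them shows that \<open>r\<^sub>i d\<close> lies in \<open>T\<close>, so that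
  \<open>d - r\<^sub>i d = \<alpha>\<^sub>i(d) \<alpha>\<^sub>i\<^sup>\<or>\<close> does.  Hence \<open>T\<close> contains a nonzero multiple of each simple coroot
  (\<open>coroot_translation\<close>).  The group generated by these multiples meets the open chamber as soon as
  the real span of the coroots does (\<open>lattice_meets_chamber\<close>); and if this span did not, Gordan's
  alternative would give a nonnegative vector killed by the Cartan matrix, whose support contains a
  component of affine type.

  The main work is to read the action on \<open>A\<close> off the action on a panel tree.  Let \<open>\<sigma>\<close>, \<open>\<sigma>'\<close> be the
  opposite ideal panels of directions \<open>F\<close>, \<open>-F\<close> in \<open>A\<close>, where \<open>F\<close> spans \<open>ker \<alpha>\<^sub>i\<close>, and let \<open>g\<close> fix
  \<open>\<sigma>\<close>, \<open>\<sigma>'\<close> and reflect the line of the panel tree that is the image of \<open>A\<close>.  Then for every point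
  \<open>p\<close> of \<open>A\<close> the apartment \<open>gA\<close> contains a shortening of the sector-face of \<open>A\<close> of base point \<open>p\<close> and
  direction \<open>F\<close>.  From a point \<open>q\<close> of this shortening one returns to \<open>p\<close> along the sector-face based at
  \<open>q\<close> in the class \<open>\<sigma>'\<close>; this sector-face is the same in \<open>A\<close> and in \<open>gA\<close>, so \<open>p\<close> lies in \<open>gA\<close>
  (\<open>germ_reflection_covers\<close>).  Therefore \<open>gA = A\<close>, and the action on the tree together with the
  shape of \<open>F\<close> determines the linear part (\<open>reflection_from_germs\<close>).

  This rests on the uniqueness of the sector-face based at a point \<open>p\<close> in a class of ideal panels
  (\<open>panel_unique\<close>).  An apartment containing \<open>p\<close> and the germ of the sector-face \<open>z + F\<close> yields a
  sector-face at \<open>p\<close>, which depends only on this germ by (MA4) (\<open>sector_face_determined\<close>).  Replacing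
  the germ of \<open>z + F\<close> by the germ of a chimney that contains all \<open>z + t d + F\<close> with small \<open>t \<ge> 0\<close>, for \<open>d\<close> in
  a vectorial face, shows that the result is locally constant along the line directed by \<open>d\<close>.  For
  panels any two points become joined by such a line after a shortening (\<open>panel_absorbs\<close>).

  Enclosures involve all roots, so their computation needs that real and imaginary roots have
  constant sign on vectorial faces.  For real roots this is Tits' argument on lengths in \<open>W\<^sup>v\<close>; for
  imaginary roots it is the triangular decomposition of the Kac--Moody algebra.
\<close>

section \<open>Signs of the real roots\<close>

context root_datum
begin

lemma alpha_simps [simp]:
  "alpha i (u + v) = alpha i u + alpha i v"
  "alpha i (u - v) = alpha i u - alpha i v"
  "alpha i (c *\<^sub>R v) = c * alpha i v"
  "alpha i (- v) = - alpha i v"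
  "alpha i 0 = 0"
  using alpha_linear[of i] by (auto simp: linear_add linear_diff linear_scale linear_neg linear_0)

lemma linear_refl: "linear (refl i)"
  by (rule linearI) (auto simp: refl_def algebra_simps)

lemma alpha_refl: "alpha j (refl i v) = alpha j v - alpha i v * alpha j (coalpha i)"
  by (simp add: refl_def)

lemma alpha_refl_same [simp]: "alpha i (refl i v) = - alpha i v"
  by (simp add: refl_def cartan_diag)

lemma refl_refl [simp]: "refl i (refl i v) = v"
  by (simp add: refl_def cartan_diag algebra_simps)

lemma refl_comp_refl [simp]: "refl i \<circ> refl i = id" "refl i \<circ> (refl i \<circ> u) = u"
  by (auto simp: fun_eq_iff)

primrec word :: "'i list \<Rightarrow> 'v \<Rightarrow> 'v" where
  "word [] = id"
| "word (i # is) = refl i \<circ> word is"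

lemma word_append: "word (is @ js) = word is \<circ> word js"
  by (induction "is") auto

lemma word_rev: "word is \<circ> word (rev is) = id"
proof (induction "is")
  case (Cons i "is")
  have "word (i # is) \<circ> word (rev (i # is)) = refl i \<circ> (word is \<circ> word (rev is)) \<circ> refl i"
    by (auto simp: word_append)
  then show ?case using Cons by (simp add: comp_assoc del: word.simps)
qed auto

lemma word_rev': "word (rev is) \<circ> word is = id"
  using word_rev[of "rev is"] by simp

lemma bij_word: "bij (word is)"
  using o_bij[OF word_rev' word_rev] .

lemma inv_word: "inv (word is) = word (rev is)"
proof
  fix v show "inv (word is) v = word (rev is) v"
    using bij_word[of "is"] word_rev[of "is"]
    by (metis bij_is_inj comp_apply id_apply inv_f_eq)
qed

lemma W_eq_words: "W = range word"
proof
  have "u \<in> range word" if "u \<in> generated_by (range refl)" for u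
    using that
  proof induction
    case gen_id
    show ?case by (rule range_eqI[of _ _ "[]"]) simp
  next
    case (gen_base s)
    then obtain i where "s = word [i]" by auto
    then show ?case by blast
  next
    case (gen_comp f g)
    then obtain js ks where "f = word js" "g = word ks" by blast
    then show ?case by (intro range_eqI[of _ _ "js @ ks"]) (simp add: word_append)
  next
    case (gen_inv f)
    then obtain js where "f = word js" by blast
    then show ?case by (intro range_eqI[of _ _ "rev js"]) (simp add: inv_word)
  qed
  then show "W \<subseteq> range word" by (auto simp: W_def W_par_def)
  have "word is \<in> W" for "is"
    unfolding W_def W_par_def
    by (induction "is") (simp_all only: word.simps gen_id gen_comp gen_base rangeI)
  then show "range word \<subseteq> W" by auto
qed

lemma W_id [simp]: "id \<in> W" by (simp add: W_def W_par_def gen_id)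
lemma W_comp: "u \<in> W \<Longrightarrow> w \<in> W \<Longrightarrow> u \<circ> w \<in> W" by (simp add: W_def W_par_def gen_comp)
lemma W_inv: "u \<in> W \<Longrightarrow> inv u \<in> W" by (simp add: W_def W_par_def gen_inv)
lemma W_refl [simp]: "refl i \<in> W" by (simp add: W_def W_par_def gen_base)
lemma W_bij: "u \<in> W \<Longrightarrow> bij u" by (auto simp: W_eq_words bij_word)

lemma W_linear: "u \<in> W \<Longrightarrow> linear u"
proof -
  have "linear (word is)" for "is"
    by (induction "is") (simp_all only: word.simps linear_id linear_compose linear_refl)
  then show "u \<in> W \<Longrightarrow> linear u" by (auto simp: W_eq_words)
qed

lemma W_fixes_common_kernel:
  assumes "u \<in> W" "\<forall>i. alpha i v = 0" shows "u v = v"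
proof -
  have "word is v = v" for "is" by (induction "is") (auto simp: refl_def assms)
  then show ?thesis using assms by (auto simp: W_eq_words)
qed

text \<open>
The length in the Coxeter group, for the generators \<open>refl i\<close>.
\<close>
definition len :: "('v \<Rightarrow> 'v) \<Rightarrow> nat" where
  "len u = (LEAST n. \<exists>is. length is = n \<and> word is = u)"

lemma len_le: "len (word is) \<le> length is"
  unfolding len_def by (rule Least_le) auto

lemma reduced_word:
  assumes "u \<in> W" obtains "is" where "word is = u" "length is = len u"
proof -
  have "\<exists>n is. length is = n \<and> word is = u" using assms by (auto simp: W_eq_words)
  then have "\<exists>is. length is = len u \<and> word is = u" unfolding len_def by (rule LeastI_ex)
  then show ?thesis using that by auto
qed

lemma len_refl_le: assumes "u \<in> W" shows "len (refl i \<circ> u) \<le> Suc (len u)"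
proof -
  obtain "is" where "word is = u" "length is = len u" using reduced_word assms .
  then show ?thesis using len_le[of "i # is"] by simp
qed

definition nonneg :: "('v \<Rightarrow> real) \<Rightarrow> bool" where
  "nonneg b \<longleftrightarrow> (\<exists>c. (\<forall>i. 0 \<le> c i) \<and> (\<forall>v. b v = (\<Sum>i\<in>UNIV. c i * alpha i v)))"

lemma nonneg_alpha: "nonneg (alpha i)"
  unfolding nonneg_def
proof (intro exI conjI allI)
  fix v show "alpha i v = (\<Sum>j\<in>UNIV. (if j = i then 1 else 0) * alpha j v)"
    by (simp add: if_distrib[of "\<lambda>x. x * _"] cong: if_cong)
qed auto

lemma nonneg_comb:
  assumes "nonneg a" "nonneg b" "0 \<le> x" "0 \<le> y"
  shows "nonneg (\<lambda>v. x * a v + y * b v)"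
proof -
  obtain c d where c: "\<forall>i. 0 \<le> c i" "\<forall>v. a v = (\<Sum>i\<in>UNIV. c i * alpha i v)"
    and d: "\<forall>i. 0 \<le> d i" "\<forall>v. b v = (\<Sum>i\<in>UNIV. d i * alpha i v)"
    using assms by (auto simp: nonneg_def)
  show ?thesis unfolding nonneg_def
    by (rule exI[of _ "\<lambda>i. x * c i + y * d i"])
       (use c d assms in \<open>auto simp: sum_distrib_left sum.distrib algebra_simps\<close>)
qed

text \<open>
  The product of \<open>k\<close> alternating factors \<open>refl p\<close>, \<open>refl q\<close>, the outermost one being \<open>refl p\<close>.
\<close>
primrec alt :: "nat \<Rightarrow> 'i \<Rightarrow> 'i \<Rightarrow> 'v \<Rightarrow> 'v" where
  "alt 0 p q = id"
| "alt (Suc k) p q = refl p \<circ> alt k q p"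

lemma alt_Suc_right: "alt (Suc k) p q = alt k p q \<circ> refl (if even k then p else q)"
  by (induction k arbitrary: p q) (auto simp: fun_eq_iff)

lemma alt_add: "alt (m + n) p q = alt m p q \<circ> (if even m then alt n p q else alt n q p)"
  by (induction m arbitrary: p q) (auto simp: fun_eq_iff)

lemma alt_W: "alt k p q \<in> W"
  by (induction k arbitrary: p q) (auto intro: W_comp)

lemma len_alt_le: assumes "u \<in> W" shows "len (alt k p q \<circ> u) \<le> k + len u"
proof (induction k arbitrary: p q)
  case (Suc k)
  have "len (alt (Suc k) p q \<circ> u) = len (refl p \<circ> (alt k q p \<circ> u))" by (simp add: comp_assoc)
  also have "\<dots> \<le> Suc (len (alt k q p \<circ> u))" by (intro len_refl_le W_comp alt_W assms)
  also have "\<dots> \<le> Suc (k + len u)" using Suc[of q p] by (simp only: Suc_le_mono)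
  finally show ?case by (simp only: add_Suc)
qed auto

text \<open>
  In the dihedral group of two simple reflections the images of the two simple roots satisfy a
  recursion of order two, which makes the rank two case a computation with two integers.
\<close>
lemma alpha_alt_rec:
  "alpha s (alt (Suc (Suc k)) t s v)
     = - alpha s (coalpha t) * alpha t (alt (Suc k) s t v) - alpha s (alt k t s v)"
  by (simp add: alpha_refl)

definition nonneg_alt :: "nat \<Rightarrow> 'i \<Rightarrow> 'i \<Rightarrow> bool" where
  "nonneg_alt k s t \<longleftrightarrow>
     (\<exists>x\<ge>0. \<exists>y\<ge>0. \<forall>v. alpha s (alt k t s v) = x * alpha s v + y * alpha t v)"

lemma nonneg_altI:
  "(\<And>v. alpha s (alt k t s v) = x * alpha s v + y * alpha t v) \<Longrightarrow> 0 \<le> x \<Longrightarrow> 0 \<le> y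
    \<Longrightarrow> nonneg_alt k s t"
  by (auto simp: nonneg_alt_def)

text \<open>
  For a product of Cartan integers at least 4 the dihedral group is infinite and all alternating
  words are reduced; the coefficients grow.
\<close>
lemma nonneg_alt_infinite:
  fixes s t :: 'i
  assumes "s \<noteq> t" and ab: "alpha s (coalpha t) * alpha t (coalpha s) \<ge> 4"
  shows "nonneg_alt k s t"
proof -
  have st: "alpha s (coalpha t) \<le> 0" "alpha t (coalpha s) \<le> 0"
    using cartan_offdiag assms by metis+
  \<comment> \<open>Positivity alone is not inductive.  The invariant is that twice the root of step \<open>k + 1\<close>
    dominates \<open>- alpha s (coalpha t)\<close> times the root of step \<open>k\<close>; it is preserved because the
    product of the two Cartan integers is at least 4.\<close>
  define R where "R k s t \<longleftrightarrow> (\<exists>x y x' y'. 0 \<le> x \<and> 0 \<le> y \<and>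
     (\<forall>v. alpha t (alt k s t v) = x * alpha s v + y * alpha t v) \<and>
     (\<forall>v. alpha s (alt (Suc k) t s v) = x' * alpha s v + y' * alpha t v) \<and>
     2 * x' \<ge> - alpha s (coalpha t) * x \<and> 2 * y' \<ge> - alpha s (coalpha t) * y)" for k s t
  have step: "R (Suc k) p q" if R: "R k q p" and pq: "alpha p (coalpha q) \<le> 0" "alpha q (coalpha p) \<le> 0"
    "alpha p (coalpha q) * alpha q (coalpha p) \<ge> 4" for k p q
  proof -
    obtain x y x' y' where *: "0 \<le> x" "0 \<le> y"
      "\<forall>v. alpha p (alt k q p v) = x * alpha q v + y * alpha p v"
      "\<forall>v. alpha q (alt (Suc k) p q v) = x' * alpha q v + y' * alpha p v"
      "2 * x' \<ge> - alpha q (coalpha p) * x" "2 * y' \<ge> - alpha q (coalpha p) * y"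
      using R unfolding R_def by blast
    define b where "b = - alpha p (coalpha q)"
    define a where "a = - alpha q (coalpha p)"
    have ab: "a \<ge> 0" "b \<ge> 0" "a * b \<ge> 4" using pq by (auto simp: a_def b_def mult.commute)
    have "a * x \<le> 2 * x'" "a * y \<le> 2 * y'" using * by (auto simp: a_def)
    then have "b * (a * x) \<le> b * (2 * x')" "b * (a * y) \<le> b * (2 * y')"
      using ab by (auto intro: mult_left_mono)
    moreover have "4 * x \<le> a * b * x" "4 * y \<le> a * b * y" using ab * by (auto intro: mult_right_mono)
    ultimately have "2 * x \<le> b * x'" "2 * y \<le> b * y'" by (auto simp: algebra_simps)
    moreover have "0 \<le> a * x" "0 \<le> a * y" using ab * by auto
    then have "0 \<le> x'" "0 \<le> y'" using \<open>a * x \<le> 2 * x'\<close> \<open>a * y \<le> 2 * y'\<close> by linarith+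
    moreover have "alpha p (alt (Suc (Suc k)) q p v) = (b * y' - y) * alpha p v + (b * x' - x) * alpha q v" for v
      using *(3,4) by (subst alpha_alt_rec) (simp add: b_def algebra_simps del: alt.simps)
    ultimately show ?thesis unfolding R_def
      apply -
      apply (rule exI[of _ y'], rule exI[of _ x'], rule exI[of _ "b * y' - y"], rule exI[of _ "b * x' - x"])
      using *(4) by (simp del: alt.simps add: b_def[symmetric])
  qed
  have "R k s t \<and> R k t s" for k
  proof (induction k)
    case 0
    have "R 0 p q" if "alpha p (coalpha q) \<le> 0" for p q
      unfolding R_def
      apply (rule exI[of _ 0], rule exI[of _ 1], rule exI[of _ 1], rule exI[of _ "- alpha p (coalpha q)"])
      using that by (auto simp: alpha_refl)
    then show ?case using st by blast
  next
    case (Suc k)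
    then show ?case using step[of k s t] step[of k t s] st ab by (auto simp: mult.commute)
  qed
  then obtain x y where "0 \<le> x" "0 \<le> y" "\<forall>v. alpha s (alt k t s v) = x * alpha t v + y * alpha s v"
    unfolding R_def by blast
  then show ?thesis by (intro nonneg_altI[of s k t y x]) auto
qed

text \<open>
  If the product of the two Cartan integers is 0, 1, 2 or 3, the two reflections satisfy a braid
  relation of length 2, 3, 4 or 6, and the images of a simple root under shorter alternating words
  are listed.  Otherwise the group is infinite.
\<close>
lemma dihedral:
  assumes "s \<noteq> t"
  shows "(\<forall>k. nonneg_alt k s t) \<or> (\<exists>m\<ge>1. alt m s t = alt m t s \<and> (\<forall>k<m. nonneg_alt k s t))"
proof (cases "alpha s (coalpha t) * alpha t (coalpha s) \<ge> 4")
  case True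
  then show ?thesis using nonneg_alt_infinite assms by auto
next
  case False
  define b where "b = - alpha s (coalpha t)"
  define a where "a = - alpha t (coalpha s)"
  have ab: "alpha s (coalpha t) = - b" "alpha t (coalpha s) = - a" by (auto simp: a_def b_def)
  have f0: "alpha s (alt 0 t s v) = alpha s v" "alpha t (alt 0 s t v) = alpha t v" for v by auto
  have f1: "alpha s (alt (Suc 0) t s v) = alpha s v + b * alpha t v"
    "alpha t (alt (Suc 0) s t v) = alpha t v + a * alpha s v" for v
    by (auto simp: alpha_refl ab)
  note rec = alpha_alt_rec[of s _ t] alpha_alt_rec[of t _ s]
  have f2: "alpha s (alt (Suc (Suc 0)) t s v) = (a * b - 1) * alpha s v + b * alpha t v"
    "alpha t (alt (Suc (Suc 0)) s t v) = (a * b - 1) * alpha t v + a * alpha s v" for v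
    by (subst rec, simp only: f0 f1 ab, simp add: algebra_simps)+
  have f3: "alpha s (alt (Suc (Suc (Suc 0))) t s v) = (a * b - 1) * alpha s v + b * (a * b - 2) * alpha t v"
    "alpha t (alt (Suc (Suc (Suc 0))) s t v) = (a * b - 1) * alpha t v + a * (a * b - 2) * alpha s v" for v
    by (subst rec, simp only: f1 f2 ab, simp add: algebra_simps)+
  have f4: "alpha s (alt (Suc (Suc (Suc (Suc 0)))) t s v)
       = (a * b * (a * b - 2) - (a * b - 1)) * alpha s v + b * (a * b - 2) * alpha t v"
    "alpha t (alt (Suc (Suc (Suc (Suc 0)))) s t v)
       = (a * b * (a * b - 2) - (a * b - 1)) * alpha t v + a * (a * b - 2) * alpha s v" for v
    by (subst rec, simp only: f2 f3 ab, simp add: algebra_simps)+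
  have f5: "alpha s (alt (Suc (Suc (Suc (Suc (Suc 0))))) t s v)
       = (a * b * (a * b - 2) - (a * b - 1)) * alpha s v
         + b * (a * b * (a * b - 2) - (a * b - 1) - (a * b - 2)) * alpha t v" for v
    by (subst rec, simp only: f3 f4 ab, simp add: algebra_simps)
  have int: "a \<in> \<int>" "b \<in> \<int>" "0 \<le> a" "0 \<le> b" "a = 0 \<longleftrightarrow> b = 0"
    using cartan_offdiag[OF assms] cartan_offdiag[OF assms[symmetric]] cartan_zero[of s t]
    by (auto simp: a_def b_def)
  obtain m where m: "a = real_of_int m" using int(1) by (rule Ints_cases)
  obtain n where n: "b = real_of_int n" using int(2) by (rule Ints_cases)
  note mn = m n
  have lt: "m * n < 4" "m \<ge> 0" "n \<ge> 0" "m = 0 \<longleftrightarrow> n = 0"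
  proof -
    have "b * a < 4" using False unfolding ab by simp
    then have "real_of_int (m * n) < 4" by (simp only: of_int_mult m n mult.commute)
    then show "m * n < 4" by linarith
    show "m \<ge> 0" "n \<ge> 0" "m = 0 \<longleftrightarrow> n = 0" using int(3,4,5) unfolding m n by simp_all
  qed
  \<comment> \<open>Normal form of the action of the dihedral group on \<open>v\<close>, in which the braid relations are compared.\<close>
  define N where "N x y v = v - x *\<^sub>R coalpha s - y *\<^sub>R coalpha t" for x y v
  have N0: "N 0 0 v = v" for v by (simp add: N_def)
  have Ns: "refl s (N x y v) = N (alpha s v - x + b * y) y v" for x y v
  proof -
    have "refl s (N x y v) = N (x + alpha s (N x y v)) y v"
      by (simp add: N_def refl_def scaleR_left_distrib del: alpha_simps)
    also have "x + alpha s (N x y v) = alpha s v - x + b * y"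
      by (simp add: N_def ab cartan_diag)
    finally show ?thesis .
  qed
  have Nt: "refl t (N x y v) = N x (alpha t v - y + a * x) v" for x y v
  proof -
    have "refl t (N x y v) = N x (y + alpha t (N x y v)) v"
      by (simp add: N_def refl_def scaleR_left_distrib del: alpha_simps)
    also have "y + alpha t (N x y v) = alpha t v - y + a * x"
      by (simp add: N_def ab cartan_diag)
    finally show ?thesis .
  qed
  have nn0: "nonneg_alt 0 s t" by (rule nonneg_altI[of _ _ _ 1 0]) auto
  have nn1: "nonneg_alt (Suc 0) s t" by (rule nonneg_altI[of _ _ _ 1 b]) (use f1 int in auto)
  consider "m = 0" "n = 0" | "m * n = 1" | "m * n = 2" | "m * n = 3"
  proof -
    have "m * n \<ge> 0" using lt by simp
    then have "m * n = 0 \<or> m * n = 1 \<or> m * n = 2 \<or> m * n = 3" using lt by linarith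
    then show ?thesis using that lt by auto
  qed
  then show ?thesis
  proof cases
    case 1
    then have "a = 0" "b = 0" using mn by auto
    have "alt (Suc (Suc 0)) s t (N 0 0 v) = alt (Suc (Suc 0)) t s (N 0 0 v)" for v
      unfolding alt.simps comp_apply id_apply Ns Nt
      by (rule arg_cong2[of _ _ _ _ "\<lambda>x y. N x y v"]) (simp_all add: \<open>a = 0\<close> \<open>b = 0\<close>)
    then have "alt 2 s t v = alt 2 t s v" for v
      by (simp only: N0 eval_nat_numeral BitM.simps One_nat_def)
    moreover have "nonneg_alt k s t" if "k < 2" for k
      using that nn0 nn1 by (auto simp: less_2_cases_iff)
    ultimately show ?thesis by (intro disjI2 exI[of _ 2]) auto
  next
    case 2
    then have "a * b = 1" using mn by (metis of_int_1 of_int_mult)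
    have [simp]: "a = 1" "b = 1" using 2 lt mn by (auto simp: pos_zmult_eq_1_iff zmult_eq_1_iff)
    have "alt (Suc (Suc (Suc 0))) s t (N 0 0 v) = alt (Suc (Suc (Suc 0))) t s (N 0 0 v)" for v
      unfolding alt.simps comp_apply id_apply Ns Nt
      by (rule arg_cong2[of _ _ _ _ "\<lambda>x y. N x y v"]) (simp_all add: algebra_simps)
    then have "alt 3 s t v = alt 3 t s v" for v
      by (simp only: N0 eval_nat_numeral BitM.simps One_nat_def)
    moreover have "nonneg_alt (Suc (Suc 0)) s t" by (rule nonneg_altI[OF f2(1)]) auto
    then have "nonneg_alt k s t" if "k < 3" for k
      using that nn0 nn1 by (auto simp: numeral_eq_Suc less_Suc_eq)
    ultimately show ?thesis by (intro disjI2 exI[of _ 3]) auto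
  next
    case 3
    have p: "a * b = 2" using mn 3 by (metis of_int_numeral of_int_mult)
    then have p': "a * (b * x) = 2 * x" "b * (a * x) = 2 * x" for x
      by (metis mult.assoc mult.commute)+
    have "alt (Suc (Suc (Suc (Suc 0)))) s t (N 0 0 v) = alt (Suc (Suc (Suc (Suc 0)))) t s (N 0 0 v)" for v
      unfolding alt.simps comp_apply id_apply Ns Nt
      by (rule arg_cong2[of _ _ _ _ "\<lambda>x y. N x y v"]) (simp_all add: algebra_simps p p')
    then have "alt 4 s t v = alt 4 t s v" for v
      by (simp only: N0 eval_nat_numeral BitM.simps One_nat_def)
    moreover have "nonneg_alt (Suc (Suc 0)) s t" "nonneg_alt (Suc (Suc (Suc 0))) s t"
      using nonneg_altI[OF f2(1)] nonneg_altI[OF f3(1)] int p by auto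
    then have "nonneg_alt k s t" if "k < 4" for k
      using that nn0 nn1 by (auto simp: numeral_eq_Suc less_Suc_eq)
    ultimately show ?thesis by (intro disjI2 exI[of _ 4]) auto
  next
    case 4
    have p: "a * b = 3" using mn 4 by (metis of_int_numeral of_int_mult)
    then have p': "a * (b * x) = 3 * x" "b * (a * x) = 3 * x" for x
      by (metis mult.assoc mult.commute)+
    have "alt (Suc (Suc (Suc (Suc (Suc (Suc 0)))))) s t (N 0 0 v) = alt (Suc (Suc (Suc (Suc (Suc (Suc 0)))))) t s (N 0 0 v)" for v
      unfolding alt.simps comp_apply id_apply Ns Nt
      by (rule arg_cong2[of _ _ _ _ "\<lambda>x y. N x y v"]) (simp_all add: algebra_simps p p')
    then have "alt 6 s t v = alt 6 t s v" for v
      by (simp only: N0 eval_nat_numeral BitM.simps One_nat_def)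
    moreover have "nonneg_alt (Suc (Suc 0)) s t" "nonneg_alt (Suc (Suc (Suc 0))) s t"
       "nonneg_alt (Suc (Suc (Suc (Suc 0)))) s t"  "nonneg_alt (Suc (Suc (Suc (Suc (Suc 0))))) s t"
      using nonneg_altI[OF f2(1)] nonneg_altI[OF f3(1)] nonneg_altI[OF f4(1)] nonneg_altI[OF f5] int p by auto
    then have "nonneg_alt k s t" if "k < 6" for k
      using that nn0 nn1 by (auto simp: numeral_eq_Suc less_Suc_eq)
    ultimately show ?thesis by (intro disjI2 exI[of _ 6]) auto
  qed
qed

text \<open>
  Tits' argument: strip from \<open>u\<close> the longest possible alternatingernating word in \<open>s\<close> and another letter
  \<open>t\<close>.  What remains is not shortened by either of the two letters, so induction applies to it for
  both simple roots, and the stripped word is handled in the dihedral group.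
\<close>
lemma nonneg_if_not_shorter:
  assumes "u \<in> W" "len u \<le> len (refl s \<circ> u)"
  shows "nonneg (alpha s \<circ> u)"
  using assms
proof (induction "len u" arbitrary: u s rule: less_induct)
  case less
  obtain w where w: "word w = u" "length w = len u" using reduced_word less.prems(1) .
  show ?case
  proof (cases w)
    case Nil
    then show ?thesis using w nonneg_alpha by auto
  next
    case (Cons t w')
    have u: "u = refl t \<circ> word w'" using w Cons by simp
    have lw: "len (word w') \<le> length w'" "Suc (length w') = len u" using len_le w Cons by auto
    have "t \<noteq> s" using less.prems(2) lw u by auto
    define P where "P k \<longleftrightarrow> (\<exists>u'\<in>W. u = alt k t s \<circ> u' \<and> len u' + k \<le> len u)" for k
    have "P 1" unfolding P_def using lw u by (intro bexI[of _ "word w'"]) (auto simp: W_eq_words)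
    have bd: "\<forall>k. P k \<longrightarrow> k \<le> len u" by (auto simp: P_def)
    define K where "K = (GREATEST k. P k)"
    have "P K" unfolding K_def by (rule GreatestI_nat[of P 1 "len u"]) (use \<open>P 1\<close> bd in auto)
    have "1 \<le> K" unfolding K_def by (rule Greatest_le_nat[of P 1 "len u"]) (use \<open>P 1\<close> bd in auto)
    have nP: "\<not> P (Suc K)"
    proof
      assume "P (Suc K)"
      then have "Suc K \<le> K" unfolding K_def by (rule Greatest_le_nat[of P _ "len u"]) (use bd in auto)
      then show False by simp
    qed
    obtain u' where u': "u' \<in> W" "u = alt K t s \<circ> u'" "len u' + K \<le> len u"
      using \<open>P K\<close> by (auto simp: P_def)
    define x where "x = (if even K then t else s)"
    define y where "y = (if even K then s else t)"
    \<comment> \<open>The letter \<open>x\<close> would continue the stripped word, and \<open>y\<close> is its last letter.\<close>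
    have "len u' \<le> len (refl x \<circ> u')"
    proof (rule ccontr)
      assume "\<not> ?thesis"
      moreover have "u = alt (Suc K) t s \<circ> (refl x \<circ> u')"
        unfolding alt_Suc_right using u'(2) by (auto simp: x_def fun_eq_iff)
      ultimately have "P (Suc K)" unfolding P_def
        using u' by (intro bexI[of _ "refl x \<circ> u'"]) (auto intro: W_comp)
      then show False using nP by simp
    qed
    moreover have "len u' \<le> len (refl y \<circ> u')"
    proof (rule ccontr)
      assume a: "\<not> ?thesis"
      obtain k where k: "K = Suc k" using \<open>1 \<le> K\<close> by (cases K) auto
      have "u = alt k t s \<circ> (refl y \<circ> u')"
        unfolding u'(2) k alt_Suc_right by (auto simp: y_def k fun_eq_iff)
      then have "len u \<le> k + len (refl y \<circ> u')" 
        using len_alt_le[OF W_comp[OF W_refl u'(1)], of k t s y] by simp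
      then show False using a u'(3) k by simp
    qed
    ultimately have st: "len u' \<le> len (refl s \<circ> u')" "len u' \<le> len (refl t \<circ> u')"
      by (auto simp: x_def y_def split: if_splits)
    have "len u' < len u" using u'(3) \<open>1 \<le> K\<close> by simp
    then have nn: "nonneg (alpha s \<circ> u')" "nonneg (alpha t \<circ> u')"
      using less.hyps u'(1) st by blast+
    \<comment> \<open>A stripped word as long as a braid relation could be rewritten to start with \<open>s\<close>.\<close>
    have "nonneg_alt K s t"
    proof (rule ccontr)
      assume "\<not> ?thesis"
      then obtain m where m: "m \<ge> 1" "alt m s t = alt m t s" "\<not> K < m"
        using dihedral[of s t] \<open>t \<noteq> s\<close> by blast
      obtain j where j: "m = Suc j" using m by (cases m) auto
      define p where "p = (if even m then t else s)"
      define q where "q = (if even m then s else t)"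
      have r: "alt K t s = alt m t s \<circ> alt (K - m) p q"
        using alt_add[of m "K - m" t s] m(3) by (cases "even m") (simp_all add: p_def q_def)
      define z where "z = alt (K - m) p q \<circ> u'"
      have "u = alt m s t \<circ> z" unfolding u'(2) r m(2) z_def by (simp only: comp_assoc)
      then have "refl s \<circ> u = alt j t s \<circ> z" by (simp add: j comp_assoc)
      moreover have "z \<in> W" unfolding z_def by (intro W_comp alt_W u')
      ultimately have "len (refl s \<circ> u) \<le> j + len z" using len_alt_le by simp
      also have "\<dots> \<le> j + (K - m + len u')" unfolding z_def using len_alt_le u' by simp
      also have "\<dots> < len u" using u'(3) m(3) j by simp
      finally show False using less.prems(2) by simp
    qed
    then obtain c d where cd: "c \<ge> 0" "d \<ge> 0"
      "\<forall>v. alpha s (alt K t s v) = c * alpha s v + d * alpha t v" by (auto simp: nonneg_alt_def)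
    then have "alpha s \<circ> u = (\<lambda>v. c * (alpha s \<circ> u') v + d * (alpha t \<circ> u') v)"
      by (auto simp: u'(2))
    then show ?thesis using nonneg_comb[OF nn cd(1,2)] by simp
  qed
qed

lemma W_root_sign:
  assumes "u \<in> W" shows "nonneg (alpha s \<circ> u) \<or> nonneg (\<lambda>v. - alpha s (u v))"
proof (cases "len u \<le> len (refl s \<circ> u)")
  case True then show ?thesis using nonneg_if_not_shorter assms by blast
next
  case False
  then have "nonneg (alpha s \<circ> (refl s \<circ> u))"
    by (intro nonneg_if_not_shorter W_comp assms) auto
  then show ?thesis by (auto simp: o_def)
qed

text \<open>
Linear independence of the simple roots makes their values prescribable.
\<close>
lemma alpha_dual: obtains v where "\<And>i. alpha i v = c i"
proof -
  define E where "E v = (\<chi> i. alpha i v)" for v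
  have lin: "linear E" unfolding E_def by (rule linearI) (simp_all add: vec_eq_iff)
  have "range E = UNIV"
  proof (rule ccontr)
    assume "range E \<noteq> UNIV"
    moreover have "subspace (range E)" by (rule linear_subspace_image[OF lin subspace_UNIV])
    ultimately have "dim (range E) \<noteq> DIM(real^'i)"
      using dim_eq_full[of "range E"] span_eq_iff[of "range E"] by (metis (no_types))
    then have "dim (range E) < DIM(real^'i)" using dim_subset_UNIV[of "range E"] by linarith
    then obtain a where "a \<noteq> 0" "span (range E) \<subseteq> {x. a \<bullet> x = 0}"
      using lowdim_subset_hyperplane by blast
    then have a: "a \<noteq> 0" "\<forall>x\<in>range E. a \<bullet> x = 0" using span_superset[of "range E"] by auto
    have "\<forall>v. (\<Sum>i\<in>UNIV. a $ i * alpha i v) = 0" using a(2) by (auto simp: E_def inner_vec_def)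
    then have "a $ i = 0" for i using alpha_independent[of "\<lambda>i. a $ i"] by blast
    then show False using a(1) by (simp add: vec_eq_iff)
  qed
  then obtain v where "(\<chi> i. c i) = E v" by blast
  then have "alpha i v = c i" for i by (simp add: E_def vec_eq_iff)
  then show ?thesis by (rule that)
qed

lemma not_nonneg_both:
  assumes "nonneg b" "nonneg (\<lambda>v. - b v)" shows "b v = 0"
proof -
  obtain c d where c: "\<forall>i. 0 \<le> c i" "\<forall>v. b v = (\<Sum>i\<in>UNIV. c i * alpha i v)"
    and d: "\<forall>i. 0 \<le> d i" "\<forall>v. - b v = (\<Sum>i\<in>UNIV. d i * alpha i v)"
    using assms by (auto simp: nonneg_def)
  have "(\<Sum>i\<in>UNIV. (c i + d i) * alpha i v) = 0" for v
  proof -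
    have "(\<Sum>i\<in>UNIV. (c i + d i) * alpha i v) = b v + - b v"
      unfolding d(2)[rule_format] unfolding c(2)[rule_format]
      by (simp only: distrib_right sum.distrib)
    then show ?thesis by simp
  qed
  then have "c i + d i = 0" for i using alpha_independent[of "\<lambda>i. c i + d i"] by blast
  then have "c i = 0" for i using c(1) d(1) by (metis add_nonneg_eq_0_iff)
  then show ?thesis using c by simp
qed

text \<open>
  A nontrivial element is shortened by some simple reflection, and then makes the corresponding
  simple root negative.
\<close>
lemma W_eq_id_if_nonneg:
  assumes "u \<in> W" "\<And>j. nonneg (alpha j \<circ> u)" shows "u = id"
proof -
  obtain w where w: "word w = u" "length w = len u" using reduced_word assms(1) .
  show ?thesis
  proof (cases w)
    case Nil then show ?thesis using w by simp
  next
    case (Cons t w')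
    have u: "refl t \<circ> u = word w'" using w Cons by auto
    have "len (word w') < len u" using w Cons len_le[of w'] by simp
    then have "nonneg (alpha t \<circ> word w')"
      by (intro nonneg_if_not_shorter) (use w Cons in \<open>auto simp: W_eq_words\<close>)
    then have "nonneg (\<lambda>v. - (alpha t \<circ> u) v)" unfolding u[symmetric] by (auto simp: o_def)
    then have "alpha t (u v) = 0" for v using not_nonneg_both[OF assms(2)[of t]] by auto
    then have "alpha t (u (inv u (coalpha t))) = 0" by blast
    then show ?thesis using W_bij[OF assms(1)] cartan_diag[of t]
      by (simp add: bij_is_surj surj_f_inv_f)
  qed
qed

end

section \<open>Vectorial faces, chambers and panels\<close>

context root_datum
begin

lemma nonnegE:
  assumes "nonneg b"
  obtains c where "\<And>i. 0 \<le> c i" "\<And>v. b v = (\<Sum>i\<in>UNIV. c i * alpha i v)"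
  using assms unfolding nonneg_def by (elim exE conjE) (rule that, simp_all)

lemma nonneg_linear: "nonneg b \<Longrightarrow> linear b"
  unfolding nonneg_def
  by (auto intro!: linearI simp: algebra_simps sum.distrib sum_distrib_left)

text \<open>
  On \<open>Fv J\<close> all simple roots are nonnegative and the same ones vanish everywhere, so a nonnegative
  combination of them vanishes either everywhere or nowhere.
\<close>
lemma nonneg_on_Fv:
  assumes "nonneg b" "v \<in> Fv J"
  shows "0 \<le> b v" "b v = 0 \<Longrightarrow> u \<in> Fv J \<Longrightarrow> b u = 0"
proof -
  obtain c where c: "\<forall>i. 0 \<le> c i" "\<forall>v. b v = (\<Sum>i\<in>UNIV. c i * alpha i v)"
    using assms(1) by (auto simp: nonneg_def)
  have pos: "0 \<le> c i * alpha i v" for i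
    using c(1) assms(2) by (cases "i \<in> J") (auto simp: Fv_def less_imp_le)
  then show "0 \<le> b v" by (simp add: c(2) sum_nonneg)
  assume "b v = 0" and u: "u \<in> Fv J"
  then have z: "c i * alpha i v = 0" for i
    using pos c(2) by (simp add: sum_nonneg_eq_0_iff)
  have "c i * alpha i u = 0" for i
    using z[of i] assms(2) u by (cases "i \<in> J") (force simp: Fv_def)+
  then show "b u = 0" unfolding c(2)[rule_format] by (intro sum.neutral) blast
qed

lemma real_root_sign: "b \<in> real_roots \<Longrightarrow> nonneg b \<or> nonneg (\<lambda>v. - b v)"
  unfolding real_roots_def root_pairs_def using W_root_sign[OF W_inv] by (fastforce simp: o_def)

lemma real_root_nonzero: assumes "b \<in> real_roots" obtains v where "b v \<noteq> 0"
proof -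
  obtain i w where w: "w \<in> W" "b = alpha i \<circ> inv w"
    using assms by (auto simp: real_roots_def root_pairs_def)
  have "b (w (coalpha i)) = 2"
    using W_bij[OF w(1)] by (simp add: w(2) bij_is_inj cartan_diag)
  then show ?thesis using that[of "w (coalpha i)"] by simp
qed

text \<open>
  All simple roots are positive on the open chamber, and a real root is a nonzero combination of
  them with coefficients of one sign.
\<close>
lemma real_root_on_chamber:
  assumes "b \<in> real_roots" "d \<in> Fv {}" shows "b d \<noteq> 0"
proof
  assume z: "b d = 0"
  have zero: "b v = 0" if nb: "nonneg b" "b d = 0" for b v
  proof -
    obtain c where c: "\<And>i. 0 \<le> c i" "\<And>v. b v = (\<Sum>i\<in>UNIV. c i * alpha i v)"
      by (rule nonnegE[OF nb(1)]) (rule that)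
    have pos: "alpha i d > 0" for i using assms(2) by (auto simp: Fv_def)
    have "c i * alpha i d = 0" for i
      using nb(2) c pos by (simp add: sum_nonneg_eq_0_iff less_imp_le)
    then have "c i = 0" for i using pos[of i] by (metis mult_eq_0_iff less_irrefl)
    then show ?thesis using c by simp
  qed
  obtain v where "b v \<noteq> 0" using real_root_nonzero assms(1) .
  then show False
    using real_root_sign[OF assms(1)] zero[of b v] zero[of "\<lambda>v. - b v" v] z by auto
qed

lemma alpha_real_root: "alpha i \<in> real_roots"
proof -
  have "(alpha i \<circ> inv id, id (coalpha i)) \<in> root_pairs" unfolding root_pairs_def using W_id by blast
  then show ?thesis unfolding real_roots_def by (auto simp: image_iff intro!: bexI)
qed

lemma W_par_empty: "W_par {} = {id}"
proof -
  have "u = id" if "u \<in> generated_by ({} :: ('v \<Rightarrow> 'v) set)" for u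
    using that by induction auto
  then show ?thesis by (auto simp: W_par_def intro: gen_id)
qed

lemma finite_W_par_singleton: "finite (W_par {i})"
proof -
  have "u \<in> {id, refl i}" if "u \<in> generated_by {refl i}" for u
    using that
  proof induction
    case (gen_inv f)
    have "inv (refl i) = refl i" by (rule inv_unique_comp) simp_all
    then show ?case using gen_inv by (auto simp: inv_id)
  qed (auto simp: fun_eq_iff)
  then have "W_par {i} \<subseteq> {id, refl i}" by (auto simp: W_par_def)
  then show ?thesis using finite_subset by blast
qed

lemma Fv_nonempty: "\<exists>v. v \<in> Fv J"
proof -
  obtain v where "\<And>i. alpha i v = (if i \<in> J then 0 else 1)"
    using alpha_dual[of "\<lambda>i. if i \<in> J then 0 else 1"] by blast
  then show ?thesis by (auto simp: Fv_def intro!: exI[of _ v])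
qed

text \<open>
  Such an element maps each simple root to a root that is nonnegative on the panel.  By
  sign-coherence this root could only be a negative one by being a multiple of \<open>alpha i\<close>, which is
  excluded since \<open>alpha i\<close> is fixed.
\<close>
lemma W_eq_id_if_panel:
  assumes u: "u \<in> W" and i: "\<And>v. alpha i (u v) = alpha i v"
    and j: "\<And>j v. j \<noteq> i \<Longrightarrow> v \<in> Fv {i} \<Longrightarrow> 0 \<le> alpha j (u v)"
  shows "u = id"
proof (rule W_eq_id_if_nonneg[OF u])
  fix k
  show "nonneg (alpha k \<circ> u)"
  proof (cases "k = i")
    case True
    then have "alpha k \<circ> u = alpha i" using i by auto
    then show ?thesis using nonneg_alpha by simp
  next
    case False
    show ?thesis
    proof (rule ccontr)
      assume "\<not> ?thesis"
      then have neg: "nonneg (\<lambda>v. - alpha k (u v))" using W_root_sign[OF u, of k] by blast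
      then obtain c where c: "\<forall>l. 0 \<le> c l" "\<forall>v. - alpha k (u v) = (\<Sum>l\<in>UNIV. c l * alpha l v)"
        by (auto simp: nonneg_def)
      obtain h where h: "\<And>l. alpha l h = (if l \<in> {i} then 0 else 1)"
        using alpha_dual[of "\<lambda>l. if l \<in> {i} then 0 else 1"] by blast
      have "h \<in> Fv {i}" using h by (auto simp: Fv_def)
      have "(\<Sum>l\<in>UNIV. c l * alpha l h) = 0"
        using j[OF False \<open>h \<in> Fv {i}\<close>] nonneg_on_Fv(1)[OF neg \<open>h \<in> Fv {i}\<close>] c(2) by (metis add.inverse_neutral dual_order.antisym neg_0_le_iff_le)
      then have "c l * alpha l h = 0" for l
        using c(1) h by (subst (asm) sum_nonneg_eq_0_iff) auto
      then have "c l = 0" if "l \<noteq> i" for l using h[of l] that by (metis mult_eq_0_iff singletonD zero_neq_one)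
      then have "(\<Sum>l\<in>UNIV. c l * alpha l v) = c i * alpha i v" for v
        by (subst sum.remove[of _ i]) auto
      then have eq: "alpha k (u v) = - c i * alpha i v" for v using c(2) by (metis minus_minus mult_minus_left)
      obtain v where v: "\<And>l. alpha l v = (if l = k then 1 else 0)"
        using alpha_dual[of "\<lambda>l. if l = k then 1 else 0"] by blast
      have "u (inv u v) = v" using W_bij[OF u] by (simp add: bij_is_surj surj_f_inv_f)
      then have "alpha k v = - c i * alpha i v" using eq[of "inv u v"] i[of "inv u v"] by simp
      then show False using v[of k] v[of i] False by auto
    qed
  qed
qed

text \<open>
  The two candidates for an element stabilizing a panel, 1 and \<open>refl i\<close>, are distinguished by their
  action on \<open>alpha i\<close>.
\<close>
lemma W_eq_refl_if_panel:
  assumes w: "w \<in> W" and i: "\<And>v. alpha i (w v) = - alpha i v"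
    and j: "\<And>j v. j \<noteq> i \<Longrightarrow> v \<in> Fv {i} \<Longrightarrow> 0 \<le> alpha j (inv w v)"
  shows "w = refl i"
proof -
  have bij: "w (inv w v) = v" "inv w (w v) = v" for v
    using W_bij[OF w] by (simp_all add: bij_is_surj surj_f_inv_f bij_is_inj)
  have "inv w \<circ> refl i = id"
  proof (rule W_eq_id_if_panel)
    show "inv w \<circ> refl i \<in> W" by (intro W_comp W_inv w W_refl)
    show "alpha i ((inv w \<circ> refl i) v) = alpha i v" for v
      using i[of "inv w (refl i v)"] bij by simp
    show "0 \<le> alpha k ((inv w \<circ> refl i) v)" if "k \<noteq> i" "v \<in> Fv {i}" for k v
    proof -
      have "refl i v = v" using that by (auto simp: Fv_def refl_def)
      then show ?thesis using j[OF that] by simp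
    qed
  qed
  then have "inv w (refl i v) = v" for v by (metis comp_apply id_apply)
  then have "w v = refl i v" for v by (metis bij(1))
  then show ?thesis by blast
qed

text \<open>
  Panels lie in the interior of the Tits cone: far in the direction of a panel the signs of all
  simple roots except \<open>alpha i\<close> are fixed, and \<open>refl i\<close> corrects the sign of \<open>alpha i\<close> when needed.
\<close>
lemma panel_absorbs:
  assumes h: "h \<in> Fv {i}"
  shows "\<exists>N>0. \<exists>w\<in>W. \<exists>J. v + N *\<^sub>R h \<in> w ` Fv J"
proof -
  have hi: "alpha i h = 0" "\<And>j. j \<noteq> i \<Longrightarrow> alpha j h > 0" using h by (auto simp: Fv_def)
  define N where "N = 1 + (\<Sum>j\<in>UNIV - {i}. (\<bar>alpha j v\<bar> + \<bar>alpha j (refl i v)\<bar>) / alpha j h)"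
  have nn: "0 \<le> (\<bar>alpha j v\<bar> + \<bar>alpha j (refl i v)\<bar>) / alpha j h" if "j \<noteq> i" for j
    using hi(2)[OF that] by simp
  have "N \<ge> 1" unfolding N_def using sum_nonneg[of "UNIV - {i}", OF nn] by simp
  have big: "\<bar>alpha j v\<bar> + \<bar>alpha j (refl i v)\<bar> < N * alpha j h" if "j \<noteq> i" for j
  proof -
    have "(\<bar>alpha j v\<bar> + \<bar>alpha j (refl i v)\<bar>) / alpha j h
        \<le> (\<Sum>j\<in>UNIV - {i}. (\<bar>alpha j v\<bar> + \<bar>alpha j (refl i v)\<bar>) / alpha j h)"
      by (rule member_le_sum) (use that nn in auto)
    then have "(\<bar>alpha j v\<bar> + \<bar>alpha j (refl i v)\<bar>) / alpha j h < N" by (simp add: N_def)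
    then show ?thesis using hi(2)[OF that] by (simp add: pos_divide_less_eq)
  qed
  have rh: "refl i h = h" by (simp add: refl_def hi)

  have pos: "alpha j (v + N *\<^sub>R h) > 0" "alpha j (refl i v + N *\<^sub>R h) > 0" if "j \<noteq> i" for j
    using big[OF that] by (simp_all only: alpha_simps)
  have at_i: "alpha i (v + N *\<^sub>R h) = alpha i v" "alpha i (refl i v + N *\<^sub>R h) = - alpha i v"
    by (simp_all add: hi)
  consider "alpha i v = 0" | "alpha i v > 0" | "alpha i v < 0" by linarith
  then show ?thesis
  proof cases
    case 1
    then have "id (v + N *\<^sub>R h) \<in> id ` Fv {i}"
      using pos at_i by (auto simp: Fv_def simp del: alpha_simps)
    then show ?thesis using \<open>N \<ge> 1\<close> W_id by (metis id_apply less_le_trans zero_less_one)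
  next
    case 2
    then have "alpha j (v + N *\<^sub>R h) > 0" for j
      using pos(1)[of j] at_i by (cases "j = i") (simp_all del: alpha_simps)
    then have "v + N *\<^sub>R h \<in> id ` Fv {}" by (simp add: Fv_def del: alpha_simps)
    then show ?thesis using \<open>N \<ge> 1\<close> W_id by (metis less_le_trans zero_less_one)
  next
    case 3
    then have "alpha j (refl i v + N *\<^sub>R h) > 0" for j
      using pos(2)[of j] at_i by (cases "j = i") (simp_all del: alpha_simps)
    then have "refl i v + N *\<^sub>R h \<in> Fv {}" by (simp add: Fv_def del: alpha_simps)
    moreover have "refl i (refl i v + N *\<^sub>R h) = v + N *\<^sub>R h"
      using linear_refl[of i] by (simp add: linear_add linear_scale rh)
    ultimately have "v + N *\<^sub>R h \<in> refl i ` Fv {}" by (metis image_eqI)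
    then show ?thesis using \<open>N \<ge> 1\<close> W_refl by (metis less_le_trans zero_less_one)
  qed
qed

end

section \<open>Weights of the Kac--Moody algebra\<close>

context root_datum
begin

lemmas [trans] = eq_trans

lemma lie_idem: assumes "lie_eq z (LAdd z z)" shows "lie_eq z LZero"
proof -
  let ?n = "LScale (-1) z"
  have "lie_eq LZero (LAdd z ?n)" by (rule eq_sym[OF add_neg])
  also have "lie_eq (LAdd z ?n) (LAdd (LAdd z z) ?n)" by (rule cong_add[OF assms eq_refl])
  also have "lie_eq \<dots> (LAdd z (LAdd z ?n))" by (rule add_assoc)
  also have "lie_eq \<dots> (LAdd z LZero)" by (rule cong_add[OF eq_refl add_neg])
  also have "lie_eq \<dots> (LAdd LZero z)" by (rule add_comm)
  also have "lie_eq \<dots> z" by (rule add_zero)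
  finally show ?thesis by (rule eq_sym)
qed

lemma lie_zero_zero: "lie_eq LZero (LAdd LZero LZero)" by (rule eq_sym[OF add_zero])

lemma lie_scale_zero: "lie_eq (LScale 0 x) LZero"
  using scale_add_left[of 0 0 x] by (intro lie_idem) simp

lemma lie_scale_LZero: "lie_eq (LScale a LZero) LZero"
  by (rule lie_idem[OF eq_trans[OF cong_scale[OF lie_zero_zero] scale_add_right]])

lemma lie_br_zero_right: "lie_eq (LBr x LZero) LZero"
  by (rule lie_idem[OF eq_trans[OF cong_br[OF eq_refl lie_zero_zero] br_add_right]])

lemma lie_br_zero_left: "lie_eq (LBr LZero x) LZero"
  by (rule lie_idem[OF eq_trans[OF cong_br[OF lie_zero_zero eq_refl] br_add_left]])

lemma lie_neg_unique: assumes "lie_eq (LAdd a c) LZero" shows "lie_eq a (LScale (-1) c)"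
proof -
  let ?n = "LScale (-1) c"
  have "lie_eq a (LAdd LZero a)" by (rule eq_sym[OF add_zero])
  also have "lie_eq \<dots> (LAdd a LZero)" by (rule add_comm)
  also have "lie_eq \<dots> (LAdd a (LAdd c ?n))" by (rule cong_add[OF eq_refl eq_sym[OF add_neg]])
  also have "lie_eq \<dots> (LAdd (LAdd a c) ?n)" by (rule eq_sym[OF add_assoc])
  also have "lie_eq \<dots> (LAdd LZero ?n)" by (rule cong_add[OF assms eq_refl])
  also have "lie_eq \<dots> ?n" by (rule add_zero)
  finally show ?thesis .
qed

lemma lie_antisym: "lie_eq (LBr x y) (LScale (-1) (LBr y x))"
proof (rule lie_neg_unique)
  have "lie_eq (LAdd (LBr x y) (LBr y x)) (LAdd (LAdd LZero (LBr x y)) (LAdd (LBr y x) LZero))"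
    by (rule cong_add[OF eq_sym[OF add_zero] eq_trans[OF eq_sym[OF add_zero] add_comm]])
  also have "lie_eq \<dots> (LAdd (LAdd (LBr x x) (LBr x y)) (LAdd (LBr y x) (LBr y y)))"
    by (intro cong_add eq_sym[OF br_alt] eq_refl)
  also have "lie_eq \<dots> (LAdd (LBr x (LAdd x y)) (LBr y (LAdd x y)))"
    by (intro cong_add eq_sym[OF br_add_right])
  also have "lie_eq \<dots> (LBr (LAdd x y) (LAdd x y))" by (rule eq_sym[OF br_add_left])
  also have "lie_eq \<dots> LZero" by (rule br_alt)
  finally show "lie_eq (LAdd (LBr x y) (LBr y x)) LZero" .
qed

lemma lie_derivation: "lie_eq (LBr x (LBr y z)) (LAdd (LBr (LBr x y) z) (LBr y (LBr x z)))"
proof -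
  have "lie_eq (LBr x (LBr y z)) (LScale (-1) (LAdd (LBr y (LBr z x)) (LBr z (LBr x y))))"
    by (rule lie_neg_unique[OF jacobi])
  also have "lie_eq \<dots> (LAdd (LScale (-1) (LBr y (LBr z x))) (LScale (-1) (LBr z (LBr x y))))"
    by (rule scale_add_right)
  also have "lie_eq \<dots> (LAdd (LBr y (LBr x z)) (LBr (LBr x y) z))"
  proof (rule cong_add)
    show "lie_eq (LScale (-1) (LBr z (LBr x y))) (LBr (LBr x y) z)"
      by (rule eq_sym[OF lie_antisym])
    have "lie_eq (LBr y (LBr x z)) (LBr y (LScale (-1) (LBr z x)))"
      by (rule cong_br[OF eq_refl lie_antisym])
    also have "lie_eq \<dots> (LScale (-1) (LBr y (LBr z x)))" by (rule br_scale_right)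
    finally show "lie_eq (LScale (-1) (LBr y (LBr z x))) (LBr y (LBr x z))" by (rule eq_sym)
  qed
  also have "lie_eq \<dots> (LAdd (LBr (LBr x y) z) (LBr y (LBr x z)))" by (rule add_comm)
  finally show ?thesis .
qed

inductive lie_span :: "('i, 'v) lie_term set \<Rightarrow> ('i, 'v) lie_term \<Rightarrow> bool"
  for S :: "('i, 'v) lie_term set" where
  lspan_base: "x \<in> S \<Longrightarrow> lie_span S x"
| lspan_zero: "lie_span S LZero"
| lspan_add: "lie_span S x \<Longrightarrow> lie_span S y \<Longrightarrow> lie_span S (LAdd x y)"
| lspan_scale: "lie_span S x \<Longrightarrow> lie_span S (LScale a x)"
| lspan_eq: "lie_span S x \<Longrightarrow> lie_eq x y \<Longrightarrow> lie_span S y"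

lemma lie_span_mono: "lie_span S x \<Longrightarrow> S \<subseteq> T \<Longrightarrow> lie_span T x"
  by (induction rule: lie_span.induct) (auto intro: lie_span.intros)

lemma lie_span_ad:
  assumes "lie_span S x" and S: "\<And>m. m \<in> S \<Longrightarrow> lie_span T (LBr g m)"
  shows "lie_span T (LBr g x)"
  using assms(1)
proof induction
  case (lspan_base x) then show ?case by (rule S)
next
  case lspan_zero then show ?case by (rule lspan_eq[OF lie_span.lspan_zero eq_sym[OF lie_br_zero_right]])
next
  case (lspan_add x y)
  show ?case by (rule lspan_eq[OF lie_span.lspan_add[OF lspan_add.IH] eq_sym[OF br_add_right]])
next
  case (lspan_scale x a)
  show ?case by (rule lspan_eq[OF lie_span.lspan_scale[OF lspan_scale.IH] eq_sym[OF br_scale_right]])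
next
  case (lspan_eq x y)
  then show ?case using lie_span.lspan_eq cong_br[OF eq_refl] by blast
qed

definition weight :: "('v \<Rightarrow> real) \<Rightarrow> ('i, 'v) lie_term \<Rightarrow> bool" where
  "weight b x \<longleftrightarrow> (\<forall>h. lie_eq (LBr (GenH h) x) (LScale (complex_of_real (b h)) x))"

lemma weight_br:
  assumes "weight b x" "weight c y" shows "weight (\<lambda>h. b h + c h) (LBr x y)"
  unfolding weight_def
proof
  fix h
  let ?b = "complex_of_real (b h)" and ?c = "complex_of_real (c h)"
  have "lie_eq (LBr (GenH h) (LBr x y)) (LAdd (LBr (LBr (GenH h) x) y) (LBr x (LBr (GenH h) y)))"
    by (rule lie_derivation)
  also have "lie_eq \<dots> (LAdd (LBr (LScale ?b x) y) (LBr x (LScale ?c y)))"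
    using assms unfolding weight_def by (intro cong_add cong_br eq_refl) auto
  also have "lie_eq \<dots> (LAdd (LScale ?b (LBr x y)) (LScale ?c (LBr x y)))"
    by (intro cong_add br_scale_left br_scale_right)
  also have "lie_eq \<dots> (LScale (?b + ?c) (LBr x y))" by (rule eq_sym[OF scale_add_left])
  finally show "lie_eq (LBr (GenH h) (LBr x y)) (LScale (complex_of_real (b h + c h)) (LBr x y))"
    by simp
qed

inductive_set monomials :: "('i \<Rightarrow> ('i, 'v) lie_term) \<Rightarrow> ('i, 'v) lie_term set"
  for g :: "'i \<Rightarrow> ('i, 'v) lie_term" where
  mono_gen: "g i \<in> monomials g"
| mono_br: "m \<in> monomials g \<Longrightarrow> LBr (g i) m \<in> monomials g"

definition cartan_terms :: "('i, 'v) lie_term set" where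
  "cartan_terms = range GenH"

lemma span_br_cartan:
  assumes "weight b m" shows "lie_span {m} (LBr (LScale a (GenH h)) m)"
proof -
  have "lie_span {m} (LScale a (LScale (complex_of_real (b h)) m))"
    by (intro lspan_scale lspan_base) simp
  moreover have "lie_eq (LScale a (LScale (complex_of_real (b h)) m)) (LBr (LScale a (GenH h)) m)"
    using assms unfolding weight_def
    by (intro eq_sym[OF eq_trans[OF br_scale_left cong_scale]]) auto
  ultimately show ?thesis by (rule lspan_eq)
qed

lemma span_gen_cartan:
  assumes "weight b (g i)" shows "lie_span (monomials g) (LBr (g i) (GenH h))"
proof -
  have "lie_eq (LScale (-1) (LScale (complex_of_real (b h)) (g i))) (LBr (g i) (GenH h))"
    using assms unfolding weight_def
    by (intro eq_sym[OF eq_trans[OF lie_antisym cong_scale]]) auto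
  then show ?thesis by (rule lspan_eq[rotated]) (intro lspan_scale lspan_base mono_gen)
qed

lemma weight_monomials:
  assumes "\<And>i. weight (\<lambda>h. s * alpha i h) (g i)" "m \<in> monomials g"
  shows "\<exists>b. nonneg b \<and> weight (\<lambda>h. s * b h) m"
  using assms(2)
proof induction
  case (mono_gen i) then show ?case using assms(1) nonneg_alpha by blast
next
  case (mono_br m i)
  then obtain b where "nonneg b" "weight (\<lambda>h. s * b h) m" by blast
  then have "nonneg (\<lambda>h. 1 * alpha i h + 1 * b h)" "weight (\<lambda>h. s * alpha i h + s * b h) (LBr (g i) m)"
    by (intro nonneg_comb nonneg_alpha weight_br assms(1); simp)+
  then show ?case by (intro exI[of _ "\<lambda>h. alpha i h + b h"]) (auto simp: distrib_left)
qed

text \<open>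
  Commuting an opposite generator past the outermost factor of a monomial produces either an
  element of the Cartan subalgebra, acting on the rest by a scalar, or a shorter instance.
  The generators \<open>g\<close> and \<open>g'\<close> stand for \<open>GenE\<close>, \<open>GenF\<close> in either order, with \<open>s\<close> the sign of the
  weights of \<open>g\<close>.
\<close>
lemma ad_opposite_monomials:
  assumes w: "\<And>i. weight (\<lambda>h. s * alpha i h) (g i)"
    and opp: "\<And>i j. \<exists>a h. lie_eq (LBr (g' j) (g i)) (LScale a (GenH h))"
    and "m \<in> monomials g"
  shows "lie_span (monomials g \<union> cartan_terms) (LBr (g' j) m)"
  using assms(3)
proof induction
  case (mono_gen i)
  obtain a h where "lie_eq (LBr (g' j) (g i)) (LScale a (GenH h))" using opp by blast
  moreover have "lie_span (monomials g \<union> cartan_terms) (LScale a (GenH h))"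
    by (intro lspan_scale lspan_base) (simp add: cartan_terms_def)
  ultimately show ?case using lspan_eq eq_sym by blast
next
  case (mono_br m i)
  let ?T = "monomials g \<union> cartan_terms"
  obtain a h where ah: "lie_eq (LBr (g' j) (g i)) (LScale a (GenH h))" using opp by blast
  obtain b where b: "weight (\<lambda>h. s * b h) m" using weight_monomials[OF w mono_br.hyps] by blast
  have "lie_span ?T (LBr (LScale a (GenH h)) m)"
    by (rule lie_span_mono[OF span_br_cartan[OF b]]) (use mono_br in auto)
  then have 1: "lie_span ?T (LBr (LBr (g' j) (g i)) m)"
    by (rule lspan_eq) (rule cong_br[OF eq_sym[OF ah] eq_refl])
  have 2: "lie_span ?T (LBr (g i) (LBr (g' j) m))"
  proof (rule lie_span_ad[OF mono_br.IH])
    fix m' assume "m' \<in> ?T"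
    moreover have "lie_span ?T (LBr (g i) (GenH v))" for v
      by (rule lie_span_mono[OF span_gen_cartan[OF w]]) simp
    moreover have "lie_span ?T (LBr (g i) m')" if "m' \<in> monomials g"
      using that by (intro lspan_base UnI1 monomials.mono_br)
    ultimately show "lie_span ?T (LBr (g i) m')" by (auto simp: cartan_terms_def)
  qed
  show ?case by (rule lspan_eq[OF lspan_add[OF 1 2] eq_sym[OF lie_derivation]])
qed

lemma weight_E: "weight (\<lambda>h. 1 * alpha i h) (GenE i)"
  using h_e by (simp add: weight_def)

lemma weight_F: "weight (\<lambda>h. - 1 * alpha i h) (GenF i)"
  using h_f by (simp add: weight_def)

lemma br_E_F: "\<exists>a h. lie_eq (LBr (GenE j) (GenF i)) (LScale a (GenH h))"
proof (cases "i = j")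
  case True
  then show ?thesis using eq_trans[OF e_f_same eq_sym[OF scale_one]] by blast
next
  case False
  then have "lie_eq (LBr (GenE j) (GenF i)) (LScale 0 (GenH 0))"
    by (intro eq_trans[OF e_f_diff eq_sym[OF lie_scale_zero]]) simp
  then show ?thesis by blast
qed

lemma br_F_E: "\<exists>a h. lie_eq (LBr (GenF j) (GenE i)) (LScale a (GenH h))"
proof -
  obtain a h where "lie_eq (LBr (GenE i) (GenF j)) (LScale a (GenH h))" using br_E_F by blast
  then show ?thesis using eq_trans[OF lie_antisym eq_trans[OF cong_scale scale_scale]] by blast
qed

definition weight_terms :: "('i, 'v) lie_term set" where
  "weight_terms = monomials GenE \<union> monomials GenF \<union> cartan_terms"

lemma weight_termsE:
  assumes "m \<in> weight_terms"
  obtains "m \<in> monomials GenE" | "m \<in> monomials GenF" | h where "m = GenH h"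
  using assms by (auto simp: weight_terms_def cartan_terms_def)

definition sign_coherent :: "('v \<Rightarrow> real) \<Rightarrow> bool" where
  "sign_coherent b \<longleftrightarrow> nonneg b \<or> nonneg (\<lambda>v. - b v)"

lemma coherent_linear: assumes "sign_coherent b" shows "linear b"
proof -
  have "linear (\<lambda>v. - (- b v))" if "nonneg (\<lambda>v. - b v)"
    by (rule linear_compose_neg[OF nonneg_linear[OF that]])
  then show ?thesis using assms nonneg_linear by (auto simp: sign_coherent_def)
qed

lemma weight_terms_coherent:
  assumes "m \<in> weight_terms" shows "\<exists>b. sign_coherent b \<and> weight b m"
  using assms
proof (cases rule: weight_termsE)
  case 1
  then show ?thesis using weight_monomials[OF weight_E] by (force simp: sign_coherent_def)
next
  case 2
  then obtain b where b: "nonneg b" "weight (\<lambda>h. - 1 * b h) m"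
    using weight_monomials[OF weight_F] by blast
  then show ?thesis by (intro exI[of _ "\<lambda>h. - 1 * b h"]) (auto simp: sign_coherent_def)
next
  case (3 h)
  then have "weight (\<lambda>h. 0) m"
    unfolding weight_def using eq_trans[OF h_h eq_sym[OF lie_scale_zero]] by auto
  moreover have "sign_coherent (\<lambda>h. 0)" by (auto simp: sign_coherent_def nonneg_def intro!: exI[of _ "\<lambda>i. 0"])
  ultimately show ?thesis by blast
qed

text \<open>
  The span of the iterated brackets of the \<open>e\<^sub>i\<close>, those of the \<open>f\<^sub>i\<close> and the Cartan subalgebra is
  stable under the brackets with all generators, hence under all brackets, and contains the
  generators.
\<close>
lemma triangular_decomposition: "lie_span weight_terms x"
proof -
  let ?D = "lie_span weight_terms"
  have sub: "monomials GenE \<subseteq> weight_terms" "monomials GenF \<subseteq> weight_terms"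
    "monomials GenE \<union> cartan_terms \<subseteq> weight_terms" "monomials GenF \<union> cartan_terms \<subseteq> weight_terms"
    by (auto simp: weight_terms_def)
  have E: "?D (LBr (GenE i) m)" if "m \<in> weight_terms" for i m
    using that
  proof (cases rule: weight_termsE)
    case 1
    then show ?thesis using sub by (intro lspan_base) (auto intro: monomials.mono_br)
  next
    case 2
    then show ?thesis by (rule lie_span_mono[OF ad_opposite_monomials[OF weight_F br_E_F] sub(4)])
  next
    case 3
    then show ?thesis using lie_span_mono[OF span_gen_cartan[of _ GenE, OF weight_E] sub(1)]
      by (auto simp: cartan_terms_def)
  qed
  have F: "?D (LBr (GenF i) m)" if "m \<in> weight_terms" for i m
    using that
  proof (cases rule: weight_termsE)
    case 2
    then show ?thesis using sub by (intro lspan_base) (auto intro: monomials.mono_br)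
  next
    case 1
    then show ?thesis by (rule lie_span_mono[OF ad_opposite_monomials[OF weight_E br_F_E] sub(3)])
  next
    case 3
    then show ?thesis using lie_span_mono[OF span_gen_cartan[of _ GenF, OF weight_F] sub(2)]
      by (auto simp: cartan_terms_def)
  qed
  have H: "?D (LBr (GenH h) m)" if m: "m \<in> weight_terms" for h m
  proof -
    have "\<exists>b. weight b m"
      using weight_terms_coherent[OF m] by blast
    then obtain b where "lie_eq (LBr (GenH h) m) (LScale (complex_of_real (b h)) m)"
      unfolding weight_def by blast
    then show ?thesis by (rule lspan_eq[OF lspan_scale[OF lspan_base[OF m]] eq_sym])
  qed
  have "?D x \<and> (\<forall>y. ?D y \<longrightarrow> ?D (LBr x y))"
  proof (induction x)
    case LZero
    show ?case using lspan_zero lspan_eq[OF lspan_zero eq_sym[OF lie_br_zero_left]] by blast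
  next
    case (LAdd a b)
    have "?D (LBr (LAdd a b) y)" if "?D y" for y
      by (rule lspan_eq[OF lspan_add eq_sym[OF br_add_left]]) (use LAdd that in blast)+
    then show ?case using LAdd lspan_add by blast
  next
    case (LScale c a)
    then show ?case using lspan_scale lspan_eq[OF lspan_scale eq_sym[OF br_scale_left]] by blast
  next
    case (LBr a b)
    have "?D (LBr (LBr a b) y)" if y: "?D y" for y
    proof -
      let ?u = "LBr a (LBr b y)" and ?v = "LBr b (LBr a y)"
      have "lie_eq (LAdd ?u (LScale (-1) ?v)) (LAdd (LAdd (LBr (LBr a b) y) ?v) (LScale (-1) ?v))"
        by (rule cong_add[OF lie_derivation eq_refl])
      also have "lie_eq \<dots> (LAdd (LBr (LBr a b) y) (LAdd ?v (LScale (-1) ?v)))" by (rule add_assoc)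
      also have "lie_eq \<dots> (LAdd (LBr (LBr a b) y) LZero)" by (rule cong_add[OF eq_refl add_neg])
      also have "lie_eq \<dots> (LBr (LBr a b) y)" by (rule eq_trans[OF add_comm add_zero])
      finally have "lie_eq (LAdd ?u (LScale (-1) ?v)) (LBr (LBr a b) y)" .
      moreover have "?D (LAdd ?u (LScale (-1) ?v))"
        using LBr y by (intro lspan_add lspan_scale) auto
      ultimately show ?thesis by (rule lspan_eq[rotated])
    qed
    then show ?case using LBr by blast
  next
    case (GenH v)
    then show ?case using lie_span_ad[OF _ H] by (auto simp: weight_terms_def cartan_terms_def intro: lspan_base)
  next
    case (GenE i)
    then show ?case using lie_span_ad[OF _ E] by (auto simp: weight_terms_def intro: lspan_base mono_gen)
  next
    case (GenF i)
    then show ?case using lie_span_ad[OF _ F] by (auto simp: weight_terms_def intro: lspan_base mono_gen)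
  qed
  then show ?thesis by blast
qed

text \<open>
The product of the commuting operators \<open>ad h - b(h)\<close>, for the \<open>b\<close> in the list.
\<close>
primrec annihilate :: "('v \<Rightarrow> real) list \<Rightarrow> 'v \<Rightarrow> ('i, 'v) lie_term \<Rightarrow> ('i, 'v) lie_term" where
  "annihilate [] h x = x"
| "annihilate (b # bs) h x = LAdd (LBr (GenH h) (annihilate bs h x))
      (LScale (- complex_of_real (b h)) (annihilate bs h x))"

lemma annihilate_cong: "lie_eq x y \<Longrightarrow> lie_eq (annihilate bs h x) (annihilate bs h y)"
  by (induction bs) (auto intro: cong_add cong_br cong_scale eq_refl)

lemma lie_add_swap: "lie_eq (LAdd (LAdd a b) (LAdd c d)) (LAdd (LAdd a c) (LAdd b d))"
proof -
  have "lie_eq (LAdd (LAdd a b) (LAdd c d)) (LAdd a (LAdd b (LAdd c d)))" by (rule add_assoc)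
  also have "lie_eq \<dots> (LAdd a (LAdd (LAdd b c) d))" by (rule cong_add[OF eq_refl eq_sym[OF add_assoc]])
  also have "lie_eq \<dots> (LAdd a (LAdd (LAdd c b) d))" by (intro cong_add eq_refl add_comm)
  also have "lie_eq \<dots> (LAdd a (LAdd c (LAdd b d)))" by (rule cong_add[OF eq_refl add_assoc])
  also have "lie_eq \<dots> (LAdd (LAdd a c) (LAdd b d))" by (rule eq_sym[OF add_assoc])
  finally show ?thesis .
qed

lemma annihilate_add:
  "lie_eq (annihilate bs h (LAdd x y)) (LAdd (annihilate bs h x) (annihilate bs h y))"
proof (induction bs)
  case (Cons b bs)
  let ?x = "annihilate bs h x" and ?y = "annihilate bs h y" and ?c = "- complex_of_real (b h)"
  have "lie_eq (annihilate (b # bs) h (LAdd x y)) (LAdd (LBr (GenH h) (LAdd ?x ?y)) (LScale ?c (LAdd ?x ?y)))"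
    using Cons by (auto intro: cong_add cong_br cong_scale eq_refl)
  also have "lie_eq \<dots> (LAdd (LAdd (LBr (GenH h) ?x) (LBr (GenH h) ?y)) (LAdd (LScale ?c ?x) (LScale ?c ?y)))"
    by (intro cong_add br_add_right scale_add_right)
  also have "lie_eq \<dots> (LAdd (annihilate (b # bs) h x) (annihilate (b # bs) h y))"
    using lie_add_swap by simp
  finally show ?case .
qed (simp add: eq_refl)

lemma annihilate_scale: "lie_eq (annihilate bs h (LScale a x)) (LScale a (annihilate bs h x))"
proof (induction bs)
  case (Cons b bs)
  let ?x = "annihilate bs h x" and ?c = "- complex_of_real (b h)"
  have "lie_eq (annihilate (b # bs) h (LScale a x)) (LAdd (LBr (GenH h) (LScale a ?x)) (LScale ?c (LScale a ?x)))"
    using Cons by (auto intro: cong_add cong_br cong_scale eq_refl)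
  also have "lie_eq \<dots> (LAdd (LScale a (LBr (GenH h) ?x)) (LScale a (LScale ?c ?x)))"
    using eq_trans[OF scale_scale eq_sym[OF scale_scale[of a ?c ?x, unfolded mult.commute[of a ?c]]]]
    by (intro cong_add br_scale_right)
  also have "lie_eq \<dots> (LScale a (annihilate (b # bs) h x))"
    using eq_sym[OF scale_add_right] by simp
  finally show ?case .
qed (simp add: eq_refl)

text \<open>
On a weight vector the operator is a scalar, which vanishes if its weight is in the list.
\<close>
lemma annihilate_weight:
  assumes "weight b x"
  shows "lie_eq (annihilate bs h x) (LScale (\<Prod>c\<leftarrow>bs. complex_of_real (b h - c h)) x)"
proof (induction bs)
  case Nil then show ?case by (simp add: eq_sym[OF scale_one])
next
  case (Cons c bs)
  let ?p = "\<Prod>c\<leftarrow>bs. complex_of_real (b h - c h)" and ?c = "complex_of_real (c h)" and ?b = "complex_of_real (b h)"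
  have "lie_eq (annihilate (c # bs) h x) (LAdd (LBr (GenH h) (LScale ?p x)) (LScale (- ?c) (LScale ?p x)))"
    using Cons by (auto intro: cong_add cong_br cong_scale eq_refl)
  also have "lie_eq \<dots> (LAdd (LScale ?p (LScale ?b x)) (LScale (- ?c * ?p) x))"
    using assms unfolding weight_def
    by (intro cong_add scale_scale eq_trans[OF br_scale_right cong_scale]) auto
  also have "lie_eq \<dots> (LAdd (LScale (?p * ?b) x) (LScale (- ?c * ?p) x))"
    by (intro cong_add scale_scale eq_refl)
  also have "lie_eq \<dots> (LScale (?p * ?b + - ?c * ?p) x)" by (rule eq_sym[OF scale_add_left])
  finally have "lie_eq (annihilate (c # bs) h x) (LScale (?p * ?b + - ?c * ?p) x)" .
  moreover have "?p * ?b + - ?c * ?p = (\<Prod>c\<leftarrow>c # bs. complex_of_real (b h - c h))"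
    by (simp add: algebra_simps)
  ultimately show ?case by (simp only:)
qed

text \<open>
  The product of the \<open>ad h - b(h)\<close> over the weights of the terms of a sum kills the sum.  The
  statement for all lists containing these weights makes it stable under addition.
\<close>
lemma annihilated_by_coherent_weights:
  "\<exists>B. finite B \<and> (\<forall>b\<in>B. sign_coherent b) \<and>
     (\<forall>bs h. B \<subseteq> set bs \<longrightarrow> lie_eq (annihilate bs h x) LZero)"
  using triangular_decomposition[of x]
proof (induction rule: lie_span.induct)
  case (lspan_base x)
  then obtain b where b: "sign_coherent b" "weight b x" using weight_terms_coherent by blast
  have "lie_eq (annihilate bs h x) LZero" if "b \<in> set bs" for bs h
  proof -
    have "(\<Prod>c\<leftarrow>bs. complex_of_real (b h - c h)) = 0" using that by (auto simp: prod_list_zero_iff)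
    then show ?thesis using annihilate_weight[OF b(2), of bs h] eq_trans[OF _ lie_scale_zero] by simp
  qed
  then show ?case using b(1) by (intro exI[of _ "{b}"]) auto
next
  case lspan_zero
  have "lie_eq (annihilate bs h LZero) LZero" for bs h
    using eq_trans[OF annihilate_cong[OF eq_sym[OF lie_scale_zero]] eq_trans[OF annihilate_scale lie_scale_zero]] .
  then show ?case by (intro exI[of _ "{}"]) auto
next
  case (lspan_add x y)
  then obtain B C where "finite B" "\<forall>b\<in>B. sign_coherent b"
    "\<forall>bs h. B \<subseteq> set bs \<longrightarrow> lie_eq (annihilate bs h x) LZero"
    "finite C" "\<forall>b\<in>C. sign_coherent b"
    "\<forall>bs h. C \<subseteq> set bs \<longrightarrow> lie_eq (annihilate bs h y) LZero" by blast
  then show ?case using eq_trans[OF annihilate_add eq_trans[OF cong_add add_zero]]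
    by (intro exI[of _ "B \<union> C"]) auto
next
  case (lspan_scale x a)
  have "lie_eq (annihilate bs h (LScale a x)) LZero" if "lie_eq (annihilate bs h x) LZero" for bs h
    by (rule eq_trans[OF annihilate_scale eq_trans[OF cong_scale[OF that] lie_scale_LZero]])
  then show ?case using lspan_scale.IH by (elim exE) (rule exI, force)
next
  case (lspan_eq x y)
  have "lie_eq (annihilate bs h y) LZero" if "lie_eq (annihilate bs h x) LZero" for bs h
    by (rule eq_trans[OF annihilate_cong[OF eq_sym[OF lspan_eq.hyps(2)]] that])
  then show ?case using lspan_eq.IH by (elim exE) (rule exI, force)
qed

text \<open>
  Applied to a vector of weight \<open>b\<close>, the annihilating product shows that for each \<open>h\<close> the value
  \<open>b(h)\<close> is taken by one of finitely many sign-coherent weights.  A vector space is not a finite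
  union of proper subspaces, so one of these weights is \<open>b\<close>.
\<close>
lemma lie_root_coherent: assumes "b \<in> lie_roots" shows "sign_coherent b"
proof -
  obtain x where lin: "linear b" and x: "\<not> lie_eq x LZero" "weight b x"
    using assms by (auto simp: lie_roots_def weight_def)
  obtain B where B: "finite B" "\<forall>b\<in>B. sign_coherent b"
    "\<forall>bs h. B \<subseteq> set bs \<longrightarrow> lie_eq (annihilate bs h x) LZero" using annihilated_by_coherent_weights[of x] by (elim exE conjE) (rule that)
  obtain bs where bs: "set bs = B" using B(1) finite_list by blast
  have ex: "\<exists>c\<in>B. b h - c h = 0" for h
  proof (rule ccontr)
    let ?p = "\<Prod>c\<leftarrow>bs. complex_of_real (b h - c h)"
    assume "\<not> ?thesis"
    then have "?p \<noteq> 0" using bs by (auto simp: prod_list_zero_iff simp flip: of_real_diff)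
    have "lie_eq x (LScale (inverse ?p * ?p) x)" using \<open>?p \<noteq> 0\<close> by (simp add: eq_sym[OF scale_one])
    also have "lie_eq \<dots> (LScale (inverse ?p) (LScale ?p x))" by (rule eq_sym[OF scale_scale])
    also have "lie_eq \<dots> (LScale (inverse ?p) (annihilate bs h x))"
      by (rule cong_scale[OF eq_sym[OF annihilate_weight[OF x(2)]]])
    also have "lie_eq \<dots> (LScale (inverse ?p) LZero)" using B(3) bs by (intro cong_scale) auto
    also have "lie_eq \<dots> LZero" by (rule lie_scale_LZero)
    finally show False using x(1) by simp
  qed
  have lin_coh: "linear c" if "c \<in> B" for c using coherent_linear B(2) that by blast
  have "b \<in> B"
  proof (rule ccontr)
    assume "b \<notin> B"
    have "negligible {h. b h - c h = 0}" if c: "c \<in> B" for c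
    proof -
      let ?K = "{h. b h - c h = 0}"
      have lin: "linear (\<lambda>h. b h - c h)" using lin lin_coh[OF c] by (rule linear_compose_sub)
      then have sub: "subspace ?K" by (rule linear_subspace_kernel)
      obtain h where "b h \<noteq> c h" using \<open>b \<notin> B\<close> c by (metis ext)
      then have "span ?K \<noteq> UNIV" using sub by (auto simp: span_eq_iff[THEN iffD2])
      then have "dim ?K < DIM('v)" using dim_eq_full[of ?K] dim_subset_UNIV[of ?K] by linarith
      then show ?thesis by (rule negligible_lowdim)
    qed
    then have "negligible (\<Union>c\<in>B. {h. b h - c h = 0})" using B(1) by (intro negligible_Union) auto
    moreover have "(\<Union>c\<in>B. {h. b h - c h = 0}) = UNIV" using ex by auto
    ultimately show False by (metis non_negligible_UNIV)
  qed
  then show ?thesis using B(2) by blast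
qed

end

section \<open>Coroots and the open chamber\<close>

context root_datum
begin

lemma cartan_facts:
  "cartan i i = 2" "i \<noteq> j \<Longrightarrow> cartan i j \<le> 0" "cartan i j = 0 \<longleftrightarrow> cartan j i = 0"
  using cartan_diag cartan_offdiag cartan_zero by (auto simp: cartan_def)

text \<open>
  The image of the transposed matrix is a linear subspace; if it misses the open positive orthant, a
  hyperplane separates the two, and its normal vector is the required one.
\<close>
lemma gordan_cartan:
  assumes no: "\<nexists>u. \<forall>j. 0 < (\<Sum>i\<in>UNIV. u i * cartan i j)"
  obtains y where "\<And>j. 0 \<le> y j" "\<exists>j. y j \<noteq> 0" "\<And>i. (\<Sum>j\<in>UNIV. cartan i j * y j) = 0"
proof -
  define L where "L u = (\<chi> j. \<Sum>i\<in>UNIV. u $ i * cartan i j)" for u :: "real^'i"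
  have linL: "linear L"
    unfolding L_def by (rule linearI) (simp_all add: vec_eq_iff algebra_simps sum.distrib sum_distrib_left)
  define P where "P = {x :: real^'i. \<forall>j. 0 < x $ j}"
  have sub: "subspace (range L)" by (rule linear_subspace_image[OF linL subspace_UNIV])
  have "P = (\<Inter>j. {x. axis j 1 \<bullet> x > 0})" by (auto simp: P_def inner_axis')
  then have "convex P" by (simp add: convex_INT convex_halfspace_gt)
  moreover have "range L \<inter> P = {}"
  proof (rule ccontr)
    assume "range L \<inter> P \<noteq> {}"
    then obtain u where "L u \<in> P" by auto
    then have "\<forall>j. 0 < (\<Sum>i\<in>UNIV. (u $ i) * cartan i j)" by (simp add: L_def P_def)
    then show False using no[unfolded not_ex, rule_format, of "\<lambda>i. u $ i"] by simp
  qed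
  moreover have "P \<noteq> {}" by (auto simp: P_def intro!: exI[of _ "\<chi> j. 1"])
  moreover have "convex (range L)" by (rule subspace_imp_convex[OF sub])
  moreover have "range L \<noteq> {}" by simp
  ultimately obtain a b where a: "a \<noteq> 0" "\<forall>x\<in>range L. a \<bullet> x \<le> b" "\<forall>x\<in>P. b \<le> a \<bullet> x"
    using separating_hyperplane_sets[of "range L" P] by blast
  have "a \<bullet> 0 \<le> b" using a(2) subspace_0[OF sub] by blast
  then have "0 \<le> b" by simp
  have zero: "a \<bullet> x = 0" if x: "x \<in> range L" for x
  proof (rule ccontr)
    assume "a \<bullet> x \<noteq> 0"
    have "((b + 1) / (a \<bullet> x)) *\<^sub>R x \<in> range L" using x by (rule subspace_scale[OF sub])
    then have "a \<bullet> (((b + 1) / (a \<bullet> x)) *\<^sub>R x) \<le> b" using a(2) by blast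
    then show False using \<open>a \<bullet> x \<noteq> 0\<close> by simp
  qed
  have nn: "0 \<le> a $ j" for j
  proof (rule ccontr)
    assume "\<not> 0 \<le> a $ j"
    then have neg: "a $ j < 0" by simp
    define K where "K = \<bar>\<Sum>k\<in>UNIV. a $ k\<bar>"
    define s where "s = (K + 1) / (- a $ j)"
    have "s > 0" unfolding s_def using neg by (intro divide_pos_pos) (auto simp: K_def)
    define x where "x = (\<chi> k. 1) + s *\<^sub>R axis j (1 :: real)"
    have "x \<in> P" using \<open>s > 0\<close> by (auto simp: x_def P_def axis_def)
    then have "0 \<le> a \<bullet> x" using a(3) \<open>0 \<le> b\<close> by force
    also have "a \<bullet> x = (\<Sum>k\<in>UNIV. a $ k) + a $ j * s"
      by (simp add: x_def inner_add_right inner_axis) (simp add: inner_vec_def)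
    also have "a $ j * s = - (K + 1)" using neg by (simp add: s_def)
    finally show False by (simp add: K_def)
  qed
  have "(\<Sum>j\<in>UNIV. cartan i j * a $ j) = 0" for i
  proof -
    have "L (axis i 1) = (\<chi> j. cartan i j)" unfolding L_def
      by (simp add: vec_eq_iff axis_def if_distrib[of "\<lambda>x. x * _"] cong: if_cong)
    moreover have "a \<bullet> L (axis i 1) = 0" by (rule zero) simp
    ultimately show ?thesis by (simp add: inner_vec_def mult.commute)
  qed
  moreover have "\<exists>j. a $ j \<noteq> 0" using a(1) by (simp add: vec_eq_iff)
  ultimately show ?thesis using that[of "\<lambda>j. a $ j"] nn by blast
qed

text \<open>
  The kernel and the cone condition in the definition of affine type are both obtained by
  subtracting from a vector \<open>u\<close> the largest multiple of \<open>y\<close> that keeps it nonnegative on \<open>J\<close>: the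
  set of the zeros of the difference is then separated from its complement in \<open>J\<close>, so it is \<open>J\<close>.
\<close>
lemma affine_typeI:
  assumes J: "indecomposable_component J"
    and pos: "\<And>j. j \<in> J \<Longrightarrow> 0 < y j"
    and ker: "\<And>i. i \<in> J \<Longrightarrow> (\<Sum>j\<in>J. cartan i j * y j) = 0"
  shows "affine_type J"
proof -
  have Jne: "J \<noteq> {}" using J by (simp add: indecomposable_component_def)
  have key: "\<exists>t. \<forall>j\<in>J. u j = t * y j"
    if u: "\<And>i. i \<in> J \<Longrightarrow> (\<Sum>j\<in>J. cartan i j * u j) \<ge> 0" for u
  proof -
    define t where "t = Min ((\<lambda>j. u j / y j) ` J)"
    define z where "z j = u j - t * y j" for j
    have z0: "0 \<le> z j" if "j \<in> J" for j
    proof -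
      have "t \<le> u j / y j" unfolding t_def using that by (intro Min_le) auto
      then show ?thesis using pos[OF that] by (simp add: z_def pos_le_divide_eq)
    qed
    have "t \<in> (\<lambda>j. u j / y j) ` J" unfolding t_def using Jne by (intro Min_in) auto
    then obtain k where k: "k \<in> J" "z k = 0"
      using pos by (auto simp: z_def) (metis less_irrefl nonzero_mult_div_cancel_right nonzero_eq_divide_eq)
    have zu: "(\<Sum>j\<in>J. cartan i j * z j) \<ge> 0" if "i \<in> J" for i
    proof -
      have "(\<Sum>j\<in>J. cartan i j * z j) = (\<Sum>j\<in>J. cartan i j * u j) - t * (\<Sum>j\<in>J. cartan i j * y j)"
        by (simp add: z_def algebra_simps sum_subtractf sum_distrib_left)
      then show ?thesis using u[OF that] ker[OF that] by simp
    qed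
    define K where "K = {j \<in> J. z j = 0}"
    have "cartan i j = 0" if i: "i \<in> K" and j: "j \<in> J - K" for i j
    proof -
      have iJ: "i \<in> J" "z i = 0" using i by (auto simp: K_def)
      have np: "cartan i l * z l \<le> 0" if "l \<in> J" for l
        using iJ z0[OF that] cartan_facts(2)[of i l] by (cases "l = i") (auto simp: mult_nonpos_nonneg)
      have "(\<Sum>l\<in>J. - (cartan i l * z l)) = 0"
        using zu[OF iJ(1)] sum_nonneg[of J "\<lambda>l. - (cartan i l * z l)"] np
        by (fastforce simp: sum_negf)
      then have "cartan i j * z j = 0"
        using np j by (subst (asm) sum_nonneg_eq_0_iff) auto
      then show ?thesis using j by (auto simp: K_def)
    qed
    moreover have "K \<noteq> {}" using k by (auto simp: K_def)
    moreover have "K \<subseteq> J" by (auto simp: K_def)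
    ultimately have "K = J" using J unfolding indecomposable_component_def by blast
    then show ?thesis by (intro exI[of _ t]) (auto simp: K_def z_def)
  qed
  define y' where "y' = (\<chi> i. if i \<in> J then y i else 0)"
  have y'J: "y' $ j = y j" if "j \<in> J" for j using that by (simp add: y'_def)
  have ker': "(\<Sum>j\<in>J. cartan i j * y' $ j) = 0" if "i \<in> J" for i
    using ker[OF that] y'J by simp
  have "{u :: real^'i. (\<forall>i\<in>J. (\<Sum>j\<in>J. cartan i j * u $ j) = 0) \<and> (\<forall>i\<in>- J. u $ i = 0)} = span {y'}"
    (is "?Ker = _")
  proof
    show "?Ker \<subseteq> span {y'}"
    proof
      fix u assume u: "u \<in> ?Ker"
      then obtain t where "\<forall>j\<in>J. u $ j = t * y j" using key[of "\<lambda>j. u $ j"] by auto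
      then have "u = t *\<^sub>R y'" using u by (auto simp: vec_eq_iff y'_def)
      then show "u \<in> span {y'}" by (simp add: span_scale span_base)
    qed
    have "c *\<^sub>R y' \<in> ?Ker" for c
    proof -
      have "(\<Sum>j\<in>J. cartan i j * (c *\<^sub>R y') $ j) = c * (\<Sum>j\<in>J. cartan i j * y' $ j)" for i
        by (simp add: sum_distrib_left algebra_simps)
      then show ?thesis using ker' by (simp add: y'_def del: vector_scaleR_component) (simp add: y'_def)
    qed
    then show "span {y'} \<subseteq> ?Ker" unfolding span_singleton by blast
  qed
  moreover have "y' \<noteq> 0"
  proof -
    obtain j where "j \<in> J" using Jne by blast
    then have "y' $ j > 0" using pos y'J by simp
    then show ?thesis by auto
  qed
  ultimately have "dim ?Ker = 1" by simp
  moreover have "(\<forall>j\<in>J. y' $ j > 0) \<and> (\<forall>i\<in>J. (\<Sum>j\<in>J. cartan i j * y' $ j) = 0)"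
    using pos y'J ker' by simp
  moreover have "\<forall>i\<in>J. (\<Sum>j\<in>J. cartan i j * u $ j) = 0"
    if nn: "\<forall>i\<in>J. (\<Sum>j\<in>J. cartan i j * u $ j) \<ge> 0" for u :: "real^'i"
  proof -
    obtain t where "\<forall>j\<in>J. u $ j = t * y j" using key[of "\<lambda>j. u $ j"] nn by blast
    then have "(\<Sum>j\<in>J. cartan i j * u $ j) = t * (\<Sum>j\<in>J. cartan i j * y j)" for i
      by (simp add: sum_distrib_left algebra_simps)
    then show ?thesis using ker by simp
  qed
  ultimately show ?thesis unfolding affine_type_def by blast
qed

text \<open>
  A nonnegative vector killed by the Cartan matrix has a support without entries of the matrix
  leading out of it; a minimal nonempty subset of the support with this property is an
  indecomposable component, of affine type.
\<close>
lemma coroot_combination_in_chamber: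
  assumes na: no_affine_component
  obtains u where "\<And>j. 0 < (\<Sum>i\<in>UNIV. u i * cartan i j)"
proof (rule ccontr)
  assume "\<not> thesis"
  then have "\<nexists>u. \<forall>j. 0 < (\<Sum>i\<in>UNIV. u i * cartan i j)" using that by blast
  then obtain y where y: "\<And>j. 0 \<le> y j" "\<exists>j. y j \<noteq> 0" "\<And>i. (\<Sum>j\<in>UNIV. cartan i j * y j) = 0"
    by (rule gordan_cartan) blast
  define K where "K = {j. y j \<noteq> 0}"
  have K: "cartan i j = 0" if "i \<in> - K" "j \<in> K" for i j
  proof -
    have np: "cartan i l * y l \<le> 0" for l
      using that y(1)[of l] cartan_facts(2)[of i l] by (cases "l = i") (auto simp: K_def mult_nonpos_nonneg)
    have "(\<Sum>l\<in>UNIV. - (cartan i l * y l)) = 0" using y(3)[of i] by (simp add: sum_negf)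
    then have "cartan i j * y j = 0" using np by (subst (asm) sum_nonneg_eq_0_iff) auto
    then show ?thesis using that by (auto simp: K_def)
  qed
  define closed where "closed J \<longleftrightarrow> J \<noteq> {} \<and> (\<forall>i\<in>J. \<forall>j\<in>- J. cartan i j = 0)" for J
  have "closed K" using y(2) K cartan_facts(3) unfolding closed_def K_def by blast
  define J where "J = arg_min card (\<lambda>J. closed J \<and> J \<subseteq> K)"
  have J: "closed J" "J \<subseteq> K" using arg_min_natI[of "\<lambda>J. closed J \<and> J \<subseteq> K" K card] \<open>closed K\<close> by (auto simp: J_def)
  have J_min: "card J \<le> card J'" if "closed J'" "J' \<subseteq> K" for J'
    unfolding J_def by (rule arg_min_nat_le) (use that in auto)
  have ind: "indecomposable_component J"
    unfolding indecomposable_component_def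
  proof (intro conjI allI impI)
    show "J \<noteq> {}" "\<forall>i\<in>J. \<forall>j\<in>- J. cartan i j = 0" using J by (auto simp: closed_def)
    fix L assume L: "L \<noteq> {} \<and> L \<subset> J"
    show "\<exists>i\<in>L. \<exists>j\<in>J - L. cartan i j \<noteq> 0"
    proof (rule ccontr)
      assume "\<not> ?thesis"
      then have "closed L" using L J(1) unfolding closed_def by blast
      then have "card J \<le> card L" using J_min L J(2) by blast
      moreover have "card L < card J" using L by (intro psubset_card_mono) auto
      ultimately show False by simp
    qed
  qed
  have "affine_type J"
  proof (rule affine_typeI[OF ind])
    show "0 < y j" if "j \<in> J" for j using that J(2) y(1)[of j] by (force simp: K_def)
    show "(\<Sum>j\<in>J. cartan i j * y j) = 0" if "i \<in> J" for i
    proof -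
      have "(\<Sum>j\<in>J. cartan i j * y j) = (\<Sum>j\<in>UNIV. cartan i j * y j)"
        using J(1) that by (intro sum.mono_neutral_left) (auto simp: closed_def)
      then show ?thesis using y(3) by simp
    qed
  qed
  then show False using na ind by (auto simp: no_affine_component_def)
qed

text \<open>
  Being in the open chamber is an open condition on the coefficients and stable under scaling, so
  the coefficients can be taken in the given multiples of the integers.
\<close>
lemma lattice_meets_chamber:
  assumes no_affine_component and c: "\<And>i. c i \<noteq> 0"
  obtains n :: "'i \<Rightarrow> int" where "(\<Sum>i\<in>UNIV. (of_int (n i) * c i) *\<^sub>R coalpha i) \<in> Fv {}"
proof -
  obtain u where u: "\<And>j. 0 < (\<Sum>i\<in>UNIV. u i * cartan i j)"
    using coroot_combination_in_chamber[OF assms(1)] by blast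
  \<comment> \<open>The scale \<open>N\<close> makes the margin \<open>N m\<close> exceed the total rounding error, which is at most \<open>B\<close>.\<close>
  define m where "m = Min (range (\<lambda>j. \<Sum>i\<in>UNIV. u i * cartan i j))"
  have m: "0 < m" unfolding m_def using u by (subst Min_gr_iff) auto
  have mle: "m \<le> (\<Sum>i\<in>UNIV. u i * cartan i j)" for j unfolding m_def by (intro Min_le) auto
  define B where "B = (\<Sum>j\<in>UNIV. \<Sum>i\<in>UNIV. \<bar>c i * cartan i j\<bar>)"
  define N where "N = (B + 1) / m"
  define n where "n i = \<lfloor>N * u i / c i\<rfloor>" for i
  have "0 < (\<Sum>i\<in>UNIV. of_int (n i) * c i * cartan i j)" for j
  proof -
    have "(\<Sum>i\<in>UNIV. N * u i * cartan i j) - (\<Sum>i\<in>UNIV. of_int (n i) * c i * cartan i j)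
        = (\<Sum>i\<in>UNIV. (N * u i / c i - of_int (n i)) * (c i * cartan i j))"
      using c by (simp add: algebra_simps sum_subtractf)
    also have "\<dots> \<le> (\<Sum>i\<in>UNIV. \<bar>c i * cartan i j\<bar>)"
    proof (rule sum_mono)
      fix i
      have "0 \<le> N * u i / c i - of_int (n i)" "N * u i / c i - of_int (n i) \<le> 1"
        unfolding n_def by linarith+
      then have "\<bar>(N * u i / c i - of_int (n i)) * (c i * cartan i j)\<bar> \<le> 1 * \<bar>c i * cartan i j\<bar>"
        unfolding abs_mult by (intro mult_mono) auto
      then show "(N * u i / c i - of_int (n i)) * (c i * cartan i j) \<le> \<bar>c i * cartan i j\<bar>" by linarith
    qed
    also have "\<dots> \<le> B" unfolding B_def
      by (rule member_le_sum[of j UNIV "\<lambda>j. \<Sum>i\<in>UNIV. \<bar>c i * cartan i j\<bar>"]) (auto simp: sum_nonneg)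
    finally have 1: "(\<Sum>i\<in>UNIV. N * u i * cartan i j) - B \<le> (\<Sum>i\<in>UNIV. of_int (n i) * c i * cartan i j)" by simp
    have "N > 0" unfolding N_def B_def using m by (intro divide_pos_pos add_nonneg_pos sum_nonneg) auto
    then have "N * m \<le> N * (\<Sum>i\<in>UNIV. u i * cartan i j)" using mle by simp
    moreover have "N * m = B + 1" using m by (simp add: N_def)
    ultimately have "B + 1 \<le> (\<Sum>i\<in>UNIV. N * u i * cartan i j)" by (simp add: sum_distrib_left mult.assoc)
    then show ?thesis using 1 by simp
  qed
  moreover have "alpha j (\<Sum>i\<in>UNIV. (of_int (n i) * c i) *\<^sub>R coalpha i) = (\<Sum>i\<in>UNIV. of_int (n i) * c i * cartan i j)" for j
    using linear_sum[OF alpha_linear[of j], of "\<lambda>i. (of_int (n i) * c i) *\<^sub>R coalpha i" UNIV] by (simp add: cartan_def)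
  ultimately show ?thesis by (intro that[of n]) (auto simp: Fv_def)
qed

end

context model_apartment
begin

section \<open>The affine Weyl group\<close>

lemma W_subset_Wa: "W \<subseteq> Wa"
proof -
  have refl_Wa: "refl i \<in> Wa" for i
  proof -
    have "(alpha i \<circ> inv id, id (coalpha i)) \<in> root_pairs" unfolding root_pairs_def using W_id by blast
    moreover have "0 \<in> Lam (alpha i \<circ> inv id)" using Lam_zero[OF alpha_real_root[of i]] by (simp add: inv_id)
    moreover have "refl i = (\<lambda>v. v - ((alpha i \<circ> inv id) v + 0) *\<^sub>R id (coalpha i))"
      by (auto simp: refl_def inv_id)
    ultimately show ?thesis unfolding Wa_def by (intro gen_base) blast
  qed
  have "u \<in> Wa" if "u \<in> generated_by (refl ` UNIV)" for u
    using that
  proof induction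
    case (gen_base s) then show ?case using refl_Wa by blast
  qed (auto simp only: Wa_def intro: generated_by.intros)
  then show ?thesis by (auto simp: W_def W_par_def)
qed

lemma W_inverse: assumes "w \<in> W" shows "w (inv w v) = v" "inv w (w v) = v"
  using W_bij[OF assms] by (simp_all add: bij_is_surj surj_f_inv_f bij_is_inj)

lemma Wa_affine:
  assumes "a \<in> Wa" obtains w t where "w \<in> W" "\<And>v. a v = w v + t"
proof -
  have "\<exists>w\<in>W. \<exists>t. a = (\<lambda>v. w v + t)"
    using assms unfolding Wa_def
  proof induction
    case gen_id
    show ?case using W_id by (intro bexI[of _ id] exI[of _ 0]) auto
  next
    case (gen_base s)
    then obtain i w k where w: "w \<in> W"
      and s: "s = (\<lambda>v. v - ((alpha i \<circ> inv w) v + k) *\<^sub>R w (coalpha i))"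
      unfolding root_pairs_def by blast
    have lin: "linear w" using W_linear w .
    have "s = (\<lambda>v. (w \<circ> refl i \<circ> inv w) v + (- k *\<^sub>R w (coalpha i)))"
      unfolding s using W_inverse[OF w] lin
      by (auto simp: fun_eq_iff refl_def linear_diff linear_scale scaleR_left_distrib)
    moreover have "w \<circ> refl i \<circ> inv w \<in> W" using w by (intro W_comp W_inv W_refl)
    ultimately show ?case by blast
  next
    case (gen_comp f g)
    then obtain u s w t where *: "u \<in> W" "f = (\<lambda>v. u v + s)" "w \<in> W" "g = (\<lambda>v. w v + t)" by blast
    then have "f \<circ> g = (\<lambda>v. (u \<circ> w) v + (u t + s))"
      using W_linear[OF *(1)] by (auto simp: fun_eq_iff linear_add)
    then show ?case using W_comp * by blast
  next
    case (gen_inv f)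
    then obtain u s where *: "u \<in> W" "f = (\<lambda>v. u v + s)" by blast
    have lin: "linear (inv u)" using W_linear W_inv *(1) by blast
    have "inv f = (\<lambda>v. inv u v + (- inv u s))"
      by (rule inv_unique_comp) (use * W_inverse[OF *(1)] lin W_linear[OF *(1)] in \<open>auto simp: fun_eq_iff linear_add linear_neg linear_diff\<close>)
    then show ?case using W_inv[OF *(1)] by blast
  qed
  then show ?thesis using that by auto
qed

section \<open>Standard spherical faces\<close>

text \<open>
  The spherical faces with \<open>w = 1\<close>.  Since \<open>W\<close> is contained in \<open>Wa\<close>, every sector-face becomes one with
  such a direction after a change of chart of its apartment; on these directions the sign of a
  combination of simple roots is visible.
\<close>
definition std :: "'v set \<Rightarrow> bool" where
  "std F \<longleftrightarrow> (\<exists>s\<in>{1, -1}. \<exists>J. finite (W_par J) \<and> F = vec_face s id J)"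

lemma vec_face_scale:
  assumes "F \<in> vec_faces" "v \<in> F" "0 < c" shows "c *\<^sub>R v \<in> F"
proof -
  obtain s w J where F: "F = vec_face s w J" "w \<in> W" using assms by (auto simp: vec_faces_def)
  obtain x where x: "x \<in> Fv J" "v = s *\<^sub>R w x" using assms by (auto simp: F vec_face_def)
  have "c *\<^sub>R x \<in> Fv J" using x(1) assms(3) by (auto simp: Fv_def)
  moreover have "c *\<^sub>R v = s *\<^sub>R w (c *\<^sub>R x)" using W_linear[OF F(2)] x by (simp add: linear_scale)
  ultimately show ?thesis by (auto simp: F vec_face_def)
qed

lemma vec_face_uminus: assumes "F \<in> vec_faces" shows "uminus ` F \<in> vec_faces"
proof -
  obtain s w J where F: "F = vec_face s w J" "w \<in> W" "s \<in> {1, -1}" using assms by (auto simp: vec_faces_def)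
  have "uminus ` F = vec_face (- s) w J" by (auto simp: F vec_face_def image_iff)
  then show ?thesis using F by (force simp: vec_faces_def)
qed

lemma spherical_face_double: assumes "F \<in> spherical_faces" shows "(\<lambda>v. 2 *\<^sub>R v) ` F = F"
proof -
  have F: "F \<in> vec_faces" using assms by (auto simp: spherical_faces_def vec_faces_def)
  show ?thesis
  proof
    show "(\<lambda>v. 2 *\<^sub>R v) ` F \<subseteq> F" using vec_face_scale[OF F] by auto
    show "F \<subseteq> (\<lambda>v. 2 *\<^sub>R v) ` F"
    proof
      fix v assume "v \<in> F"
      then have "(1/2) *\<^sub>R v \<in> F" by (intro vec_face_scale[OF F]) auto
      then show "v \<in> (\<lambda>v. 2 *\<^sub>R v) ` F" by (force simp: image_iff)
    qed
  qed
qed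

lemma stdE:
  assumes "std F"
  obtains s J where "s = 1 \<or> s = -1" "finite (W_par J)" "F = vec_face s id J"
    "\<And>v. v \<in> F \<longleftrightarrow> s *\<^sub>R v \<in> Fv J"
    "\<And>v. v \<in> F \<longleftrightarrow> (\<forall>i. (i \<in> J \<longrightarrow> s * alpha i v = 0) \<and> (i \<notin> J \<longrightarrow> s * alpha i v > 0))"
proof -
  obtain s J where s: "s = 1 \<or> s = -1" "finite (W_par J)" "F = vec_face s id J"
    using assms by (auto simp: std_def)
  have "v \<in> F \<longleftrightarrow> s *\<^sub>R v \<in> Fv J" for v
  proof
    assume "v \<in> F"
    moreover have "s * s = 1" using s(1) by auto
    ultimately show "s *\<^sub>R v \<in> Fv J" by (auto simp: s(3) vec_face_def)
  next
    assume "s *\<^sub>R v \<in> Fv J"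
    moreover have "s *\<^sub>R (s *\<^sub>R v) = v" using s(1) by auto
    ultimately show "v \<in> F" unfolding s(3) vec_face_def
      by (intro image_eqI[of _ _ "s *\<^sub>R v"]) (simp_all only: id_apply)
  qed
  then show ?thesis using that[of s J] s by (auto simp: Fv_def)
qed

lemma std_spherical: "std F \<Longrightarrow> F \<in> spherical_faces"
  unfolding std_def spherical_faces_def using W_id by blast

lemma spherical_vec: "F \<in> spherical_faces \<Longrightarrow> F \<in> vec_faces"
  by (auto simp: spherical_faces_def vec_faces_def)

lemma std_nonempty: "std F \<Longrightarrow> F \<noteq> {}"
  using Fv_nonempty by (auto simp: std_def vec_face_def)

lemma std_add: "std F \<Longrightarrow> u \<in> F \<Longrightarrow> v \<in> F \<Longrightarrow> u + v \<in> F"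
  by (erule stdE) (auto simp: distrib_left add_pos_pos)

lemma std_scale: "std F \<Longrightarrow> u \<in> F \<Longrightarrow> 0 < c \<Longrightarrow> c *\<^sub>R u \<in> F"
  using vec_face_scale spherical_vec std_spherical by blast

lemma std_half: assumes "std F" "u \<in> F" obtains v where "v \<in> F" "u = v + v"
proof
  show "(1/2) *\<^sub>R u \<in> F" by (rule std_scale) (use assms in auto)
  show "u = (1/2) *\<^sub>R u + (1/2) *\<^sub>R u" by (simp flip: scaleR_left_distrib)
qed

text \<open>
  A standard face is open in its linear span, the common kernel of the simple roots vanishing on it.
\<close>
lemma std_absorb:
  assumes F: "std F" and "h \<in> F" "\<And>i. alpha i h = 0 \<Longrightarrow> alpha i v = 0"
  shows "\<forall>\<^sub>F t in at_top. v + t *\<^sub>R h \<in> F"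
proof -
  obtain s J where s: "s = 1 \<or> s = -1"
    and F: "\<And>v. v \<in> F \<longleftrightarrow> (\<forall>i. (i \<in> J \<longrightarrow> s * alpha i v = 0) \<and> (i \<notin> J \<longrightarrow> s * alpha i v > 0))"
    using stdE[OF F] by metis
  have "\<forall>\<^sub>F t in at_top. s * alpha i (v + t *\<^sub>R h) > 0" if "i \<notin> J" for i
  proof -
    have p: "s * alpha i h > 0" using F assms(2) that by auto
    have "s * alpha i (v + t *\<^sub>R h) > 0" if t: "t > \<bar>s * alpha i v\<bar> / (s * alpha i h)" for t
    proof -
      have "\<bar>s * alpha i v\<bar> < t * (s * alpha i h)" using t p by (simp add: pos_divide_less_eq)
      then have "0 < s * alpha i v + t * (s * alpha i h)" by linarith
      also have "\<dots> = s * alpha i (v + t *\<^sub>R h)" by (simp add: algebra_simps)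
      finally show ?thesis .
    qed
    then show ?thesis using eventually_gt_at_top[of "\<bar>s * alpha i v\<bar> / (s * alpha i h)"] by (rule eventually_mono[rotated])
  qed
  then have "\<forall>\<^sub>F t in at_top. \<forall>i\<in>- J. s * alpha i (v + t *\<^sub>R h) > 0"
    by (intro eventually_ball_finite) auto
  then show ?thesis
  proof (rule eventually_mono)
    fix t assume t: "\<forall>i\<in>- J. s * alpha i (v + t *\<^sub>R h) > 0"
    have "s * alpha i (v + t *\<^sub>R h) = 0" if "i \<in> J" for i
    proof -
      have "alpha i h = 0" using F assms(2) that s by auto
      then show ?thesis using assms(3) by simp
    qed
    then show "v + t *\<^sub>R h \<in> F" using t F by blast
  qed
qed

section \<open>Enclosed sets\<close>

lemma root_coherent: "b \<in> real_roots \<union> imaginary_roots \<Longrightarrow> sign_coherent b"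
  using real_root_sign lie_root_coherent by (auto simp: sign_coherent_def imaginary_roots_def)

lemma coherent_sign_on_std:
  assumes b: "sign_coherent b" and F: "std F" "u \<in> F" "v \<in> F" "0 \<le> b u" shows "0 \<le> b v"
proof -
  obtain s J where s: "s = 1 \<or> s = -1" "\<And>v. v \<in> F \<longleftrightarrow> s *\<^sub>R v \<in> Fv J" using stdE[OF F(1)] by metis
  have lin: "linear b" using coherent_linear b .
  have *: "0 \<le> c * b (s *\<^sub>R v)" "c * b (s *\<^sub>R u) \<le> 0 \<Longrightarrow> b (s *\<^sub>R v) = 0"
    if c: "nonneg (\<lambda>v. c * b v)" "c \<noteq> 0" for c
  proof -
    show "0 \<le> c * b (s *\<^sub>R v)" using nonneg_on_Fv(1)[OF c(1)] s(2) F by blast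
    assume "c * b (s *\<^sub>R u) \<le> 0"
    then have "c * b (s *\<^sub>R u) = 0" using nonneg_on_Fv(1)[OF c(1)] s(2) F by (meson dual_order.antisym)
    then show "b (s *\<^sub>R v) = 0" using nonneg_on_Fv(2)[OF c(1), of "s *\<^sub>R u" J "s *\<^sub>R v"] s(2) F c(2) by auto
  qed
  from b consider "nonneg (\<lambda>v. 1 * b v)" | "nonneg (\<lambda>v. - 1 * b v)" by (auto simp: sign_coherent_def)
  then show ?thesis
  proof cases
    case 1
    show ?thesis using *[OF 1] s(1) F(4) lin by (auto simp: linear_scale linear_neg)
  next
    case 2
    show ?thesis using *[OF 2] s(1) F(4) lin by (auto simp: linear_scale linear_neg)
  qed
qed

lemma coherent_zero:
  assumes "sign_coherent b" "v \<in> Fv UNIV" shows "b v = 0"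
proof -
  have "a v = 0" if "nonneg a" for a
    using that assms(2) unfolding nonneg_def Fv_def by auto
  then show ?thesis using assms(1) unfolding sign_coherent_def by force
qed

text \<open>
  The half-spaces with parameter \<open>\<infinity>\<close> are dropped and the remaining parameters are real numbers.
\<close>
lemma enclosedE:
  assumes "S \<in> enclosed_sets"
  obtains R r where "\<And>b. b \<in> R \<Longrightarrow> sign_coherent b" "S = {v. \<forall>b\<in>R. 0 \<le> b v + r b}"
proof -
  let ?Rt = "real_roots \<union> imaginary_roots"
  obtain k where S: "S = (\<Inter>b\<in>?Rt. half_apt b (k b))"
    and k: "\<forall>b\<in>?Rt. k b \<in> ereal ` Lam_ext b \<union> {\<infinity>}"
    using assms by (auto simp: enclosed_sets_def)
  define R where "R = {b \<in> ?Rt. k b \<noteq> \<infinity>}"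
  have "v \<in> half_apt b (k b) \<longleftrightarrow> (b \<in> R \<longrightarrow> 0 \<le> b v + real_of_ereal (k b))" if b: "b \<in> ?Rt" for b v
  proof (cases "k b = \<infinity>")
    case True then show ?thesis by (simp add: half_apt_def R_def)
  next
    case False
    then obtain x where "k b = ereal x" using k b by blast
    then show ?thesis using b by (simp add: half_apt_def R_def)
  qed
  then have "S = {v. \<forall>b\<in>R. 0 \<le> b v + real_of_ereal (k b)}"
    unfolding S by (auto simp: R_def)
  moreover have coh: "sign_coherent b" if "b \<in> R" for b using root_coherent that by (auto simp: R_def)
  ultimately show ?thesis by (intro that[of R "\<lambda>b. real_of_ereal (k b)"])
qed

text \<open>
All roots vanish where all simple roots do.
\<close>
lemma enclosed_common_kernel:
  assumes "S \<in> enclosed_sets" "p \<in> S" "v \<in> Fv UNIV" shows "p + v \<in> S"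
proof -
  obtain R r where R: "\<And>b. b \<in> R \<Longrightarrow> sign_coherent b" "S = {v. \<forall>b\<in>R. 0 \<le> b v + r b}"
    using enclosedE assms(1) by blast
  have eq: "b (p + v) = b p" if "b \<in> R" for b
    using linear_add[OF coherent_linear[OF R(1)[OF that]], of p v] coherent_zero[OF R(1)[OF that] assms(3)] by simp
  show ?thesis unfolding R(2)
  proof (intro CollectI ballI)
    fix b assume "b \<in> R"
    then show "0 \<le> b (p + v) + r b" using eq[of b] assms(2) R(2) by simp
  qed
qed

text \<open>
  A half-space meeting a ray in arbitrarily far points is bounded by a root that is nonnegative on
  its direction, hence on the whole vectorial face containing this direction.
\<close>
lemma enclosed_recession:
  assumes "S \<in> enclosed_sets" "p \<in> S" and F: "std F" "h \<in> F" "h' \<in> F"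
    and freq: "\<And>T. \<exists>t\<ge>T. y + t *\<^sub>R h \<in> S"
  shows "p + h' \<in> S"
proof -
  obtain R r where R: "\<And>b. b \<in> R \<Longrightarrow> sign_coherent b" "S = {v. \<forall>b\<in>R. 0 \<le> b v + r b}"
    using enclosedE assms(1) by blast
  have nn: "0 \<le> b h'" if b: "b \<in> R" for b
  proof -
    have lin: "linear b" using coherent_linear R(1) b by blast
    have "0 \<le> b h"
    proof (rule ccontr)
      assume "\<not> ?thesis"
      then have neg: "b h < 0" by simp
      obtain t where t: "t \<ge> (\<bar>b y + r b\<bar> + 1) / (- b h)" "y + t *\<^sub>R h \<in> S" using freq by blast
      then have "\<bar>b y + r b\<bar> + 1 \<le> t * (- b h)" using neg pos_divide_le_eq[of "- b h" "\<bar>b y + r b\<bar> + 1" t] by simp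
      moreover have "0 \<le> b y + t * b h + r b" using t(2) b R(2) lin by (auto simp: linear_add linear_scale)
      ultimately show False by linarith
    qed
    then show ?thesis using coherent_sign_on_std R(1) b F by blast
  qed
  show ?thesis unfolding R(2)
  proof (intro CollectI ballI)
    fix b assume b: "b \<in> R"
    have "b (p + h') = b p + b h'" using linear_add coherent_linear R(1) b by blast
    then show "0 \<le> b (p + h') + r b" using nn[OF b] b assms(2) R(2) by fastforce
  qed
qed

text \<open>
Enclosed sets are closed.
\<close>
lemma enclosed_endpoint:
  assumes "S \<in> enclosed_sets" "0 < e" "\<And>t. 0 < t \<Longrightarrow> t < e \<Longrightarrow> p + t *\<^sub>R d \<in> S" shows "p \<in> S"
proof -
  obtain R r where R: "\<And>b. b \<in> R \<Longrightarrow> sign_coherent b" "S = {v. \<forall>b\<in>R. 0 \<le> b v + r b}"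
    using enclosedE assms(1) by blast
  have "0 \<le> b p + r b" if b: "b \<in> R" for b
  proof (rule ccontr)
    assume "\<not> ?thesis"
    then have neg: "b p + r b < 0" by simp
    have lin: "linear b" using coherent_linear R(1) b by blast
    define t where "t = min (e / 2) (- (b p + r b) / (2 * (\<bar>b d\<bar> + 1)))"
    have "0 < - (b p + r b) / (2 * (\<bar>b d\<bar> + 1))" using neg by (intro divide_pos_pos) auto
    then have t: "0 < t" "t < e" using assms(2) unfolding t_def by linarith+
    have "0 \<le> b p + t * b d + r b" using assms(3)[OF t] b R(2) lin by (auto simp: linear_add linear_scale)
    moreover have "t * (2 * (\<bar>b d\<bar> + 1)) \<le> - (b p + r b)"
      using min.cobounded2[of "e / 2" "- (b p + r b) / (2 * (\<bar>b d\<bar> + 1))"] unfolding t_def[symmetric]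
      by (subst (asm) pos_le_divide_eq) auto
    moreover have "t * b d \<le> t * \<bar>b d\<bar>" using t(1) by simp
    moreover have "0 \<le> t * \<bar>b d\<bar>" using t(1) by simp
    ultimately show False using neg t by (simp add: algebra_simps)
  qed
  then show ?thesis using R(2) by blast
qed

section \<open>Germs and chimneys\<close>

lemma in_filter_iff: "in_filter S F \<longleftrightarrow> eventually (\<lambda>x. x \<in> S) F"
  by (simp add: in_filter_def le_principal)

lemma encl_ge:
  assumes "\<And>S. S \<in> enclosed_sets \<Longrightarrow> in_filter S F \<Longrightarrow> Z \<le> principal S" shows "Z \<le> encl F"
  unfolding encl_def by (rule INF_greatest) (use assms in auto)

lemma encl_le: "S \<in> enclosed_sets \<Longrightarrow> in_filter S F \<Longrightarrow> encl F \<le> principal S"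
  unfolding encl_def by (rule INF_lower) auto

lemma eventually_encl_point:
  assumes "eventually P (encl F)" "\<And>S. S \<in> enclosed_sets \<Longrightarrow> in_filter S F \<Longrightarrow> x \<in> S" shows "P x"
proof -
  have "principal {x} \<le> encl F" by (rule encl_ge) (use assms(2) in auto)
  then have "eventually P (principal {x})" using assms(1) by (auto simp: le_filter_def)
  then show ?thesis by (simp add: eventually_principal)
qed

lemma encl_extensive: "F \<le> encl F"
  by (rule encl_ge) (simp add: in_filter_def)

text \<open>
  The closed face through \<open>u\<close> of minimal dimension; it is generated by the point \<open>u\<close>, and serves to
  apply (MA3) and (MA4) to a point.
\<close>
definition point_face :: "'v \<Rightarrow> 'v filter" where
  "point_face u = encl (local_face u (Fv UNIV))"

lemma point_face_closed: "point_face u \<in> closed_faces"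
proof -
  have "vec_face 1 id UNIV \<in> vec_faces" using W_id by (force simp: vec_faces_def)
  then have "Fv UNIV \<in> vec_faces" by (simp add: vec_face_def)
  then show ?thesis unfolding point_face_def closed_faces_def local_faces_def by blast
qed

lemma point_face_le: assumes "S \<in> enclosed_sets" "u \<in> S" shows "point_face u \<le> principal S"
  unfolding point_face_def
proof (rule encl_le[OF assms(1)])
  have "(+) u ` Fv UNIV \<subseteq> S" using enclosed_common_kernel assms by auto
  then show "in_filter S (local_face u (Fv UNIV))"
    unfolding in_filter_def local_face_def by (meson inf.coboundedI2 principal_le_iff)
qed

lemma point_face_le_encl: "point_face u \<le> encl (principal {u})"
  by (rule encl_ge) (auto intro!: point_face_le simp: in_filter_def)

lemma point_in_local_face: "in_filter S (local_face u (Fv UNIV)) \<Longrightarrow> u \<in> S"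
  unfolding in_filter_iff local_face_def eventually_inf_principal
  by (drule eventually_nhds_x_imp_x) (auto simp: Fv_def image_iff)

lemma eventually_point_face: "eventually P (point_face u) \<Longrightarrow> P u"
  unfolding point_face_def by (rule eventually_encl_point) (auto intro: point_in_local_face)

text \<open>
  The degenerate ray, reduced to its base point, occurs for the face of type \<open>UNIV\<close>, which contains 0.
\<close>
lemma ray_MA2: assumes "std F" "h \<in> F" shows "principal (ray x (x + h)) \<in> MA2_filters"
proof (cases "h = 0")
  case True
  then have "ray x (x + h) = {x}" by (auto simp: ray_def)
  then show ?thesis by (auto simp: MA2_filters_def)
next
  case False
  obtain s J where s: "s = 1 \<or> s = -1" "finite (W_par J)" "\<And>v. v \<in> F \<longleftrightarrow> s *\<^sub>R v \<in> Fv J"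
    using stdE[OF assms(1)] by metis
  have "s *\<^sub>R h \<in> vec_face 1 id J" using s(3) assms(2) by (simp add: vec_face_def)
  then have "s *\<^sub>R h \<in> tits_cone_sph" unfolding tits_cone_sph_def using W_id s(2) by blast
  then have "lt_sph x (x + h) \<or> lt_sph (x + h) x" using s(1) by (auto simp: lt_sph_def)
  then have "ray x (x + h) \<in> generic_rays" using False unfolding generic_rays_def
    by (intro CollectI exI[of _ x] exI[of _ "x + h"]) simp
  then show ?thesis by (auto simp: MA2_filters_def)
qed

lemma enclosed_ray:
  assumes "S \<in> enclosed_sets" "ray x (x + h) \<subseteq> S" "std F" "h \<in> F" "h' \<in> F" shows "x + h' \<in> S"
proof (rule enclosed_recession[OF assms(1) _ assms(3-5)])
  show "x \<in> S" using assms(2) by (force simp: ray_def)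
  show "\<exists>t\<ge>T. x + t *\<^sub>R h \<in> S" for T
    using assms(2) by (intro exI[of _ "max T 0"] conjI) (simp, force simp: ray_def)
qed

lemma chimney_germ_le:
  assumes S: "S \<in> enclosed_sets" and F: "std F" "xi \<in> F" "\<And>h. h \<in> F \<Longrightarrow> x + xi + h \<in> S"
  shows "chimney_germ (local_face x F) F \<le> principal S"
proof -
  have "eventually (\<lambda>u. u \<in> (+) xi ` (+) x ` F) (filtermap ((+) xi) (local_face x F))"
    unfolding eventually_filtermap local_face_def eventually_inf_principal by (intro always_eventually) blast
  moreover have "eventually (\<lambda>u. u \<in> F) (principal F)" by (simp add: eventually_principal)
  moreover have "u + v \<in> S" if uv: "u \<in> (+) xi ` (+) x ` F" "v \<in> F" for u v
  proof -
    obtain h where h: "h \<in> F" "u = xi + (x + h)" using uv(1) by auto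
    then show ?thesis using F(3)[OF std_add[OF F(1) h(1) uv(2)]] by (simp add: algebra_simps)
  qed
  ultimately have "in_filter S (filter_plus (filtermap ((+) xi) (local_face x F)) F)"
    unfolding in_filter_iff filter_plus_def eventually_filtermap[of _ "\<lambda>(u, v). u + v"] eventually_prod_filter
    by (intro exI[of _ "\<lambda>u. u \<in> (+) xi ` (+) x ` F"] exI[of _ "\<lambda>u. u \<in> F"]) auto
  then have "chimney (filtermap ((+) xi) (local_face x F)) F \<le> principal S"
    unfolding chimney_def by (rule encl_le[OF S])
  then show ?thesis unfolding chimney_germ_def using F(2) by (meson INF_lower order_trans)
qed

text \<open>
  What is used of a member of a chimney germ: it contains, far in the direction of \<open>F\<close>, all the sector-faces
  of direction \<open>F\<close> based on a short segment from \<open>z\<close> in the direction \<open>d\<close>.  The base point of the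
  segment is included because enclosed sets are closed.
\<close>
lemma eventually_chimney_germ:
  assumes ev: "eventually P (chimney_germ (local_face z F') F)"
    and F: "std F" and F': "F' \<in> vec_faces" "d \<in> F'"
  obtains xi e where "xi \<in> F" "0 < e" "\<And>t h. 0 \<le> t \<Longrightarrow> t < e \<Longrightarrow> h \<in> F \<Longrightarrow> P (z + t *\<^sub>R d + xi + h)"
proof -
  \<comment> \<open>The sets \<open>Z\<close> are directed, and their filter is finer than the chimney germ.\<close>
  define Z where "Z = (\<lambda>(xi, e). {z + t *\<^sub>R d + xi + h | t h. 0 \<le> t \<and> t < e \<and> h \<in> F})"
  let ?I = "F \<times> {0 :: real <..}"
  have "(INF i\<in>?I. principal (Z i)) \<le> chimney_germ (local_face z F') F"
    unfolding chimney_germ_def chimney_def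
  proof (intro INF_greatest encl_ge)
    fix xi S assume xi: "xi \<in> F" and S: "S \<in> enclosed_sets"
      "in_filter S (filter_plus (filtermap ((+) xi) (local_face z F')) F)"
    then obtain Pf Pg where "eventually (\<lambda>x. Pf (xi + x)) (local_face z F')" "\<forall>x\<in>F. Pg x"
      "\<forall>x y. Pf x \<longrightarrow> Pg y \<longrightarrow> x + y \<in> S"
      unfolding in_filter_iff filter_plus_def eventually_filtermap eventually_prod_filter eventually_principal
      by auto
    then have "eventually (\<lambda>x. \<forall>h\<in>F. xi + x + h \<in> S) (local_face z F')" by (auto elim: eventually_mono)
    then obtain e where e: "0 < e" "\<And>x. dist x z < e \<Longrightarrow> x \<in> (+) z ` F' \<Longrightarrow> \<forall>h\<in>F. xi + x + h \<in> S"
      unfolding local_face_def eventually_inf_principal eventually_nhds_metric by blast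
    define e' where "e' = e / (norm d + 1)"
    have e': "0 < e'" using e(1) by (auto simp: e'_def add_nonneg_pos intro!: divide_pos_pos)
    have in_S: "xi + (z + t *\<^sub>R d) + h \<in> S" if t: "0 < t" "t < e'" and h: "h \<in> F" for t h
    proof -
      have "t * (norm d + 1) < e" using t(2) by (simp add: e'_def pos_less_divide_eq add_nonneg_pos)
      then have "t * norm d < e" using t(1) by (simp add: algebra_simps)
      then have "dist (z + t *\<^sub>R d) z < e" using t(1) by (simp add: dist_norm)
      moreover have "z + t *\<^sub>R d \<in> (+) z ` F'" using vec_face_scale[OF F' t(1)] by blast
      ultimately show ?thesis using e(2) h by blast
    qed
    have "xi + z + h \<in> S" if "h \<in> F" for h
      by (rule enclosed_endpoint[OF S(1) e', of _ d]) (use in_S that in \<open>simp add: algebra_simps\<close>)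
    then have "Z (xi, e') \<subseteq> S" unfolding Z_def
      using in_S by (auto simp: algebra_simps) (metis add.commute add.left_commute less_eq_real_def scaleR_zero_left add_0)
    then have "principal (Z (xi, e')) \<le> principal S" by simp
    moreover have "(INF i\<in>?I. principal (Z i)) \<le> principal (Z (xi, e'))" by (rule INF_lower) (use xi e' in auto)
    ultimately show "(INF i\<in>?I. principal (Z i)) \<le> principal S" by (rule order_trans[rotated])
  qed
  then have "eventually P (INF i\<in>?I. principal (Z i))" using ev by (auto simp: le_filter_def)
  moreover have "\<exists>x\<in>?I. principal (Z x) \<le> inf (principal (Z a)) (principal (Z b))"
    if ab: "a \<in> ?I" "b \<in> ?I" for a b
  proof -
    obtain xi e xi' e' where [simp]: "a = (xi, e)" "b = (xi', e')" by (cases a, cases b)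
    have "Z (xi + xi', min e e') \<subseteq> Z a \<inter> Z b"
    proof
      fix v assume "v \<in> Z (xi + xi', min e e')"
      then obtain t h where v: "v = z + t *\<^sub>R d + (xi + xi') + h" "0 \<le> t" "t < e" "t < e'" "h \<in> F"
        by (auto simp: Z_def)
      have "v = z + t *\<^sub>R d + xi + (xi' + h)" "v = z + t *\<^sub>R d + xi' + (xi + h)" "xi' + h \<in> F" "xi + h \<in> F"
        using ab v std_add[OF F] by (auto simp: algebra_simps)
      then have "v \<in> Z (xi, e)" "v \<in> Z (xi', e')" unfolding Z_def case_prod_conv using v(2-4) by blast+
      then show "v \<in> Z a \<inter> Z b" by simp
    qed
    moreover have "(xi + xi', min e e') \<in> ?I" using ab std_add[OF F] by auto
    ultimately show ?thesis by (intro bexI[of _ "(xi + xi', min e e')"]) simp_all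
  qed
  moreover have "?I \<noteq> {}" using std_nonempty[OF F] by (auto intro: gt_ex)
  ultimately have "\<exists>i\<in>?I. eventually P (principal (Z i))" by (subst (asm) eventually_INF_base) auto
  then obtain xi e where "xi \<in> F" "0 < e" "\<forall>x\<in>Z (xi, e). P x" by (auto simp: eventually_principal)
  then show ?thesis by (intro that[of xi e]) (auto simp: Z_def)
qed

end

context masure
begin

section \<open>Charts and the axioms\<close>

definition chart :: "('v \<Rightarrow> 'p) \<Rightarrow> bool" where
  "chart f \<longleftrightarrow> (\<exists>A\<in>Apts. f \<in> Isom A)"

lemma chartI: "A \<in> Apts \<Longrightarrow> f \<in> Isom A \<Longrightarrow> chart f" by (auto simp: chart_def)

lemma Isom_facts:
  assumes "A \<in> Apts" "f \<in> Isom A"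
  shows "inj f" "range f = A" "Isom A = {f \<circ> w | w. w \<in> Wa}"
proof -
  have "bij_betw f UNIV A \<and> Isom A = {f \<circ> w | w. w \<in> Wa}"
    using ma1 assms by (auto simp: MA1_def apartment_def)
  then show "inj f" "range f = A" "Isom A = {f \<circ> w | w. w \<in> Wa}" by (auto simp: bij_betw_def)
qed

lemma chart_facts:
  assumes "chart f"
  shows "inj f" "range f \<in> Apts" "f \<in> Isom (range f)"
  using assms Isom_facts by (auto simp: chart_def)

lemma Apts_chart: assumes "A \<in> Apts" obtains f where "chart f" "range f = A" "f \<in> Isom A"
proof -
  have "Isom A \<noteq> {}" using ma1 assms by (auto simp: MA1_def apartment_def)
  then obtain f where "f \<in> Isom A" by blast
  then show ?thesis using that Isom_facts(2) assms chartI by blast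
qed

lemma chart_comp: assumes "chart f" "a \<in> Wa" shows "chart (f \<circ> a)" "range (f \<circ> a) = range f"
proof -
  have "f \<circ> a \<in> Isom (range f)" using Isom_facts(3)[OF chart_facts(2,3)[OF assms(1)]] assms(2) by blast
  then show "chart (f \<circ> a)" "range (f \<circ> a) = range f"
    using chart_facts(2)[OF assms(1)] Isom_facts(2) chartI by blast+
qed

lemma chart_same_range:
  assumes "chart f" "chart g" "range f = range g" obtains a where "a \<in> Wa" "g = f \<circ> a"
  using Isom_facts(3)[OF chart_facts(2,3)[OF assms(1)]] chart_facts(3)[OF assms(2)] assms(3) that by auto

text \<open>
  Composing charts with Weyl isomorphisms turns the conclusions of the axioms into statements on
  pairs of charts that agree on a filter of the model apartment.
\<close>
lemma Weyl_iso_chart: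
  assumes "chart f" "B \<in> Apts" "apt_iso Wa (range f) B \<phi>"
  obtains f' where "chart f'" "range f' = B" "\<And>v. f' v = \<phi> (f v)"
proof -
  obtain g where g: "chart g" "range g = B" "g \<in> Isom B" using Apts_chart assms(2) by blast
  define a where "a = inv g \<circ> \<phi> \<circ> f"
  have a: "a \<in> Wa" using assms g chart_facts(3)[OF assms(1)] by (auto simp: apt_iso_def a_def)
  have "g (a v) = \<phi> (f v)" for v
  proof -
    have "\<phi> (f v) \<in> range g" using assms(3) g(2) by (auto simp: apt_iso_def bij_betw_def)
    then show ?thesis by (simp add: a_def f_inv_into_f)
  qed
  then show ?thesis using that[of "g \<circ> a"] chart_comp[OF g(1) a] g(2) by simp
qed

lemma in_filter_image: "in_filter B (filtermap f F) \<longleftrightarrow> eventually (\<lambda>v. f v \<in> B) F"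
  by (simp add: in_filter_iff eventually_filtermap)

lemma filtercomap_filtermap_inj:
  assumes "inj f" shows "filtercomap f (filtermap f F) = F"
proof (rule antisym[OF _ filtercomap_filtermap], rule filter_leI)
  fix P assume P: "eventually P F"
  have "eventually (\<lambda>y. \<exists>x. y = f x \<and> P x) (filtermap f F)"
    unfolding eventually_filtermap using P by (auto elim: eventually_mono)
  then show "eventually P (filtercomap f (filtermap f F))"
    unfolding eventually_filtercomap using assms by (auto simp: inj_eq intro!: exI)
qed

lemma encl_agree_chart:
  assumes f: "chart f" and B: "B \<in> Apts" and agree: "encl_agree (range f) B (filtermap f F)"
  shows "eventually (\<lambda>v. f v \<in> B) (encl F)"
    and "\<exists>f'. chart f' \<and> range f' = B \<and> eventually (\<lambda>v. f' v = f v) (encl F)"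
proof -
  have *: "encl_chart f (filtermap f F) = filtermap f (encl F)"
    using chart_facts(1)[OF f] by (simp add: encl_chart_def filtercomap_filtermap_inj)
  obtain \<phi> where 1: "in_filter (range f \<inter> B) (filtermap f (encl F))"
    and \<phi>: "apt_iso Wa (range f) B \<phi>" "eventually (\<lambda>x. \<phi> x = x) (filtermap f (encl F))"
    using agree chart_facts(3)[OF f] unfolding encl_agree_def *[symmetric] by blast
  show "eventually (\<lambda>v. f v \<in> B) (encl F)" using 1 by (simp add: in_filter_image)
  obtain f' where "chart f'" "range f' = B" "\<And>v. f' v = \<phi> (f v)" using Weyl_iso_chart[OF f B \<phi>(1)] by metis
  then show "\<exists>f'. chart f' \<and> range f' = B \<and> eventually (\<lambda>v. f' v = f v) (encl F)"
    using \<phi>(2) by (auto simp: eventually_filtermap)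
qed

lemma MA2_chart:
  assumes f: "chart f" and B: "B \<in> Apts" and "F \<in> MA2_filters" "eventually (\<lambda>v. f v \<in> B) F"
  shows "eventually (\<lambda>v. f v \<in> B) (encl F)"
    and "\<exists>f'. chart f' \<and> range f' = B \<and> eventually (\<lambda>v. f' v = f v) (encl F)"
proof -
  have "encl_agree (range f) B (filtermap f F)"
    using ma2 chart_facts(2,3)[OF f] assms unfolding MA2_def in_filter_image by blast
  then show "eventually (\<lambda>v. f v \<in> B) (encl F)"
    "\<exists>f'. chart f' \<and> range f' = B \<and> eventually (\<lambda>v. f' v = f v) (encl F)"
    using encl_agree_chart[OF f B] by blast+
qed

lemma MA4_chart:
  assumes f: "chart f" and B: "B \<in> Apts" and R: "R \<in> splayed_chimney_germs" "F \<in> closed_faces"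
    and "eventually (\<lambda>v. f v \<in> B) R" "eventually (\<lambda>v. f v \<in> B) F"
  shows "\<exists>f'. chart f' \<and> range f' = B \<and> eventually (\<lambda>v. f' v = f v) (encl (sup R F))"
proof -
  have t: "filtermap f R \<in> transfer splayed_chimney_germs"
    "filtermap f F \<in> transfer (closed_faces \<union> solid_chimney_germs)"
    using chart_facts(2,3)[OF f] R unfolding transfer_def by blast+
  have "in_filter (range f) (filtermap f R)" "in_filter (range f) (filtermap f F)"
    "in_filter B (filtermap f R)" "in_filter B (filtermap f F)"
    using assms(5,6) by (simp_all add: in_filter_image)
  then have "encl_agree (range f) B (sup (filtermap f R) (filtermap f F))"
    using ma4[unfolded MA4_def] t chart_facts(2)[OF f] B by blast
  then show ?thesis using encl_agree_chart(2)[OF f B] by (simp add: filtermap_sup)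
qed

lemma MA3_chart:
  assumes "chart f" "chart g" "R \<in> splayed_chimney_germs" "F \<in> closed_faces"
  obtains B where "B \<in> Apts" "eventually (\<lambda>v. f v \<in> B) R" "eventually (\<lambda>v. g v \<in> B) F"
proof -
  have "filtermap f R \<in> transfer splayed_chimney_germs"
    "filtermap g F \<in> transfer (closed_faces \<union> solid_chimney_germs)"
    using chart_facts(2,3) assms unfolding transfer_def by blast+
  then obtain B where "B \<in> Apts" "in_filter B (filtermap f R)" "in_filter B (filtermap g F)"
    using ma3[unfolded MA3_def] by blast
  then show ?thesis using that by (simp add: in_filter_image)
qed

lemma chimney_germ_splayed:
  "F' \<in> vec_faces \<Longrightarrow> std F \<Longrightarrow> chimney_germ (local_face z F') F \<in> splayed_chimney_germs"
  unfolding splayed_chimney_germs_def local_faces_def using std_spherical by blast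

lemma point_face_in_apartment:
  assumes f: "chart f" and B: "B \<in> Apts" and "f u \<in> B"
  shows "eventually (\<lambda>v. f v \<in> B) (point_face u)"
proof -
  have "eventually (\<lambda>v. f v \<in> B) (encl (principal {u}))"
    by (rule MA2_chart(1)[OF f B]) (use assms in \<open>auto simp: MA2_filters_def eventually_principal\<close>)
  then show ?thesis using point_face_le_encl by (auto simp: le_filter_def)
qed

section \<open>Sector-faces through a point\<close>

lemma Wa_fix_cone:
  assumes a: "a \<in> Wa" and F: "std F" and fixed: "\<And>h. h \<in> F \<Longrightarrow> a (y + h) = y + h"
  obtains w where "linear w" "\<And>v. a v = y + w (v - y)" "\<And>h. h \<in> F \<Longrightarrow> w h = h"
proof -
  obtain w t where w: "w \<in> W" "\<And>v. a v = w v + t" using Wa_affine[OF a] by metis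
  have lin: "linear w" using W_linear w(1) .
  have wh: "w h = h" if h: "h \<in> F" for h
  proof -
    have "a (y + (h + h)) - a (y + h) = h" using fixed h std_add[OF F h h] by simp
    then show ?thesis by (simp add: w(2) linear_add[OF lin])
  qed
  obtain h where h: "h \<in> F" using std_nonempty[OF F] by blast
  have "w y + t = y" using fixed[OF h] wh[OF h] by (simp add: w(2) linear_add[OF lin])
  then have "a v = y + w (v - y)" for v by (simp add: w(2) linear_diff[OF lin] algebra_simps)
  then show ?thesis using that lin wh by blast
qed

text \<open>
  (MA2) for a ray in the sector-face gives a chart that agrees with \<open>f\<close> on the enclosure of the ray,
  which contains a shortening of the sector-face.  Charts obtained from different rays differ by an
  affine map fixing a common shortening, so the first of them agrees with \<open>f\<close> on all of it.
\<close>
lemma apartment_containing_sector_face: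
  assumes f: "chart f" and B: "B \<in> Apts" and F: "std F" and sub: "f ` (+) x ` F \<subseteq> B"
  obtains f' where "chart f'" "range f' = B" "\<And>h. h \<in> F \<Longrightarrow> f' (x + h) = f (x + h)"
proof -
  have ex: "\<exists>f'. chart f' \<and> range f' = B \<and> (\<forall>h\<in>F. f' (x + k + h) = f (x + k + h))" if k: "k \<in> F" for k
  proof -
    have "f (x + k + t *\<^sub>R k) \<in> B" if "0 \<le> t" for t
    proof -
      have "(1 + t) *\<^sub>R k \<in> F" using std_scale[OF F k] that by simp
      then have "f (x + (1 + t) *\<^sub>R k) \<in> B" using sub by blast
      then show ?thesis by (simp add: algebra_simps)
    qed
    then have "eventually (\<lambda>v. f v \<in> B) (principal (ray (x + k) (x + k + k)))"
      by (auto simp: eventually_principal ray_def)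
    then obtain f' where f': "chart f'" "range f' = B"
      "eventually (\<lambda>v. f' v = f v) (encl (principal (ray (x + k) (x + k + k))))"
      using MA2_chart(2)[OF f B ray_MA2[OF F k]] by blast
    have "f' (x + k + h) = f (x + k + h)" if h: "h \<in> F" for h
      by (rule eventually_encl_point[OF f'(3)]) (auto intro!: enclosed_ray[OF _ _ F k h] simp: in_filter_def)
    then show ?thesis using f' by blast
  qed
  obtain k where k: "k \<in> F" using std_nonempty[OF F] by blast
  obtain f1 where f1: "chart f1" "range f1 = B" "\<forall>h\<in>F. f1 (x + k + h) = f (x + k + h)" using ex[OF k] by blast
  have "f1 (x + h) = f (x + h)" if h: "h \<in> F" for h
  proof -
    obtain g where g: "g \<in> F" "h = g + g" using std_half[OF F h] by blast
    obtain f2 where f2: "chart f2" "range f2 = B" "\<forall>h\<in>F. f2 (x + g + h) = f (x + g + h)" using ex[OF g(1)] by blast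
    obtain a where a: "a \<in> Wa" "f1 = f2 \<circ> a" using chart_same_range[OF f2(1) f1(1)] f1(2) f2(2) by blast
    have "a ((x + k + g) + l) = (x + k + g) + l" if l: "l \<in> F" for l
    proof -
      have "f2 (a ((x + k + g) + l)) = f1 (x + k + (g + l))" using a(2) by (simp add: algebra_simps)
      also have "\<dots> = f (x + k + (g + l))" using f1(3) std_add[OF F g(1) l] by blast
      also have "x + k + (g + l) = x + g + (k + l)" by (simp add: algebra_simps)
      also have "f (x + g + (k + l)) = f2 (x + g + (k + l))" using f2(3) std_add[OF F k l] by simp
      finally show ?thesis using chart_facts(1)[OF f2(1)] by (simp add: inj_eq algebra_simps)
    qed
    then obtain w where w: "linear w" "\<And>v. a v = (x + k + g) + w (v - (x + k + g))" "\<And>h. h \<in> F \<Longrightarrow> w h = h"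
      using Wa_fix_cone[OF a(1) F] by metis
    have "a (x + h) = (x + k + g) + w (g - k)" unfolding w(2) g(2) by (simp add: algebra_simps)
    also have "w (g - k) = g - k" using w k g by (simp add: linear_diff)
    finally have "a (x + h) = x + g + g" by simp
    then have "f1 (x + h) = f2 (x + g + g)" using a(2) by simp
    then show ?thesis using f2(3) g by (simp add: add.assoc)
  qed
  then show ?thesis using that f1 by blast
qed

text \<open>
  (MA3) for the chimney germ and the minimal closed face at \<open>p\<close> gives the apartment.  (MA4) for the same
  germ and the closed face at a point far inside the chimney then makes a chart of it agree with \<open>f\<close>.
\<close>
lemma chart_through_point_and_germ:
  assumes f: "chart f" and F: "std F" and F': "F' \<in> vec_faces" "F' \<noteq> {}"
  obtains h where "chart h" "p \<in> range h" "eventually (\<lambda>v. h v = f v) (chimney_germ (local_face z F') F)"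
proof -
  let ?R = "chimney_germ (local_face z F') F"
  have "p \<in> \<Union>Apts" using apts_cover by simp
  then obtain A where A: "A \<in> Apts" "p \<in> A" by blast
  obtain g where "chart g" "range g = A" using Apts_chart[OF A(1)] by metis
  then obtain u where g: "chart g" "p = g u" using A(2) by blast
  obtain B where B: "B \<in> Apts" "eventually (\<lambda>v. f v \<in> B) ?R" "eventually (\<lambda>v. g v \<in> B) (point_face u)"
    using MA3_chart[OF f g(1) chimney_germ_splayed[OF F'(1) F] point_face_closed] by metis
  have "p \<in> B" using eventually_point_face[OF B(3)] g(2) by simp
  obtain d where d: "d \<in> F'" using F'(2) by blast
  obtain xi e where xi: "xi \<in> F" "0 < e"
    "\<And>t h. 0 \<le> t \<Longrightarrow> t < e \<Longrightarrow> h \<in> F \<Longrightarrow> f (z + t *\<^sub>R d + xi + h) \<in> B"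
    using eventually_chimney_germ[OF B(2) F F'(1) d] by metis
  have "f (z + xi + xi) \<in> B" using xi(3)[of 0 xi] xi(1,2) by simp
  then have "eventually (\<lambda>v. f v \<in> B) (point_face (z + xi + xi))" using point_face_in_apartment[OF f B(1)] by blast
  then obtain h where h: "chart h" "range h = B" "eventually (\<lambda>v. h v = f v) (encl (sup ?R (point_face (z + xi + xi))))"
    using MA4_chart[OF f B(1) chimney_germ_splayed[OF F'(1) F] point_face_closed B(2)] by blast
  have "?R \<le> encl (sup ?R (point_face (z + xi + xi)))"
    by (rule order_trans[OF sup_ge1 encl_extensive])
  then have "eventually (\<lambda>v. h v = f v) ?R" using h(3) by (auto simp: le_filter_def)
  then show ?thesis using that h \<open>p \<in> B\<close> by blast
qed

text \<open>
  By (MA4), the two apartments share the enclosure of the point \<open>h1 u1 = h2 u2\<close> and of the germ in direction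
  \<open>F\<close>; this enclosure contains the sector-face \<open>u1 + F\<close>, because a half-space containing \<open>u1\<close> and the germ
  contains it.
\<close>
lemma sector_face_determined:
  assumes h: "chart h1" "chart h2" "h1 u1 = h2 u2" and F: "std F" and xi: "xi1 \<in> F" "xi2 \<in> F"
    and agree: "\<And>k. k \<in> F \<Longrightarrow> h1 (x + xi1 + k) = f (x + xi1 + k)"
      "\<And>k. k \<in> F \<Longrightarrow> h2 (x + xi2 + k) = f (x + xi2 + k)"
    and k: "k \<in> F"
  shows "h1 (u1 + k) = h2 (u2 + k)"
proof -
  define xi where "xi = xi1 + xi2"
  have xiF: "xi \<in> F" using std_add[OF F] xi by (simp add: xi_def)
  have eq: "h1 (x + xi + l) = h2 (x + xi + l)" if l: "l \<in> F" for l
    using agree(1)[OF std_add[OF F xi(2) l]] agree(2)[OF std_add[OF F xi(1) l]]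
    by (simp add: xi_def algebra_simps)
  let ?B = "range h2"
  let ?R = "chimney_germ (local_face x F) F"
  have B: "?B \<in> Apts" using chart_facts h by blast
  have FF: "F \<in> vec_faces" using F std_spherical spherical_vec by blast
  have inR: "eventually (\<lambda>v. h1 v \<in> ?B) ?R"
  proof -
    let ?r = "ray (x + xi + k) (x + xi + k + k)"
    have "h1 (x + xi + k + t *\<^sub>R k) \<in> ?B" if "0 \<le> t" for t
    proof -
      have "(1 + t) *\<^sub>R k \<in> F" using std_scale[OF F k] that by simp
      then have "h1 (x + xi + (1 + t) *\<^sub>R k) \<in> ?B" using eq by simp
      then show ?thesis by (simp add: algebra_simps)
    qed
    then have "eventually (\<lambda>v. h1 v \<in> ?B) (principal ?r)" by (auto simp: eventually_principal ray_def)
    then have "eventually (\<lambda>v. h1 v \<in> ?B) (encl (principal ?r))"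
      using MA2_chart(1)[OF h(1) B ray_MA2[OF F k]] by blast
    moreover have "?R \<le> encl (principal ?r)"
    proof (rule encl_ge)
      fix S assume S: "S \<in> enclosed_sets" "in_filter S (principal ?r)"
      show "?R \<le> principal S"
      proof (rule chimney_germ_le[OF S(1) F std_add[OF F xiF k]])
        fix l assume "l \<in> F"
        then have "(x + xi + k) + l \<in> S" using enclosed_ray[OF S(1) _ F k] S(2) by (simp add: in_filter_def)
        then show "x + (xi + k) + l \<in> S" by (simp add: algebra_simps)
      qed
    qed
    ultimately show ?thesis by (auto simp: le_filter_def)
  qed
  have "eventually (\<lambda>v. h1 v \<in> ?B) (point_face u1)"
    by (rule point_face_in_apartment[OF h(1) B]) (use h(3) in auto)
  then obtain g where g: "chart g" "range g = ?B" "eventually (\<lambda>v. g v = h1 v) (encl (sup ?R (point_face u1)))"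
    using MA4_chart[OF h(1) B chimney_germ_splayed[OF FF F] point_face_closed inR] by blast
  obtain a where a: "a \<in> Wa" "g = h2 \<circ> a" using chart_same_range[OF h(2) g(1)] g(2) by metis
  have near: "g (u1 + l) = h1 (u1 + l)" if l: "l \<in> F \<or> l = 0" for l
  proof (rule eventually_encl_point[OF g(3)])
    fix S assume S: "S \<in> enclosed_sets" "in_filter S (sup ?R (point_face u1))"
    then have S2: "eventually (\<lambda>v. v \<in> S) ?R" "eventually (\<lambda>v. v \<in> S) (point_face u1)"
      by (auto simp: in_filter_iff eventually_sup)
    have u1: "u1 \<in> S" using eventually_point_face[OF S2(2)] .
    obtain zeta e where zeta: "zeta \<in> F" "0 < e"
      "\<And>t l. 0 \<le> t \<Longrightarrow> t < e \<Longrightarrow> l \<in> F \<Longrightarrow> x + t *\<^sub>R k + zeta + l \<in> S"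
      using eventually_chimney_germ[OF S2(1) F FF k] by metis
    have "\<exists>t\<ge>T. (x + zeta) + t *\<^sub>R k \<in> S" for T
      using zeta(3)[of 0 "max T 1 *\<^sub>R k"] zeta(2) std_scale[OF F k, of "max T 1"]
      by (intro exI[of _ "max T 1"]) simp
    then have "u1 + l \<in> S" if "l \<in> F" using enclosed_recession[OF S(1) u1 F k that] by blast
    then show "u1 + l \<in> S" using l u1 by auto
  qed
  have "?R \<le> encl (sup ?R (point_face u1))" by (rule order_trans[OF sup_ge1 encl_extensive])
  then have ev: "eventually (\<lambda>v. g v = h1 v) ?R" using g(3) by (auto simp: le_filter_def)
  obtain zeta e where zeta: "zeta \<in> F" "0 < e"
    "\<And>t l. 0 \<le> t \<Longrightarrow> t < e \<Longrightarrow> l \<in> F \<Longrightarrow> g (x + t *\<^sub>R k + zeta + l) = h1 (x + t *\<^sub>R k + zeta + l)"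
    using eventually_chimney_germ[OF ev F FF k] by metis
  define y where "y = x + xi + zeta"
  have "a (y + l) = y + l" if l: "l \<in> F" for l
  proof -
    have "h2 (a (y + l)) = g (x + zeta + (xi + l))" using a(2) by (simp add: y_def algebra_simps)
    also have "\<dots> = h1 (x + xi + (zeta + l))"
      using zeta(3)[of 0 "xi + l"] zeta(2) std_add[OF F xiF l] by (simp add: algebra_simps)
    also have "\<dots> = h2 (y + l)" using eq[OF std_add[OF F zeta(1) l]] by (simp add: y_def algebra_simps)
    finally show ?thesis using chart_facts(1)[OF h(2)] by (simp add: inj_eq)
  qed
  then obtain w where w: "linear w" "\<And>v. a v = y + w (v - y)" "\<And>l. l \<in> F \<Longrightarrow> w l = l"
    using Wa_fix_cone[OF a(1) F] by metis
  have "h2 (a u1) = h2 u2" using near[of 0] a(2) h(3) by simp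
  then have au: "a u1 = u2" using chart_facts(1)[OF h(2)] by (simp add: inj_eq)
  have "a (u1 + k) = a u1 + k" unfolding w(2) using w(1,3) k
    by (simp add: linear_diff linear_add algebra_simps)
  then have "h2 (a (u1 + k)) = h2 (u2 + k)" using au by simp
  then show ?thesis using near[of k] a(2) k by simp
qed

end

context masure
begin

section \<open>Parallel sector-faces\<close>

abbreviation sector_face :: "('v \<Rightarrow> 'p) \<Rightarrow> 'v \<Rightarrow> 'v set \<Rightarrow> 'p set" where
  "sector_face f x F \<equiv> f ` (+) x ` F"

lemma translate_translate: "(+) (a :: 'v) ` (+) b ` K = (+) (a + b) ` K"
  by (auto simp: image_image add.assoc)

text \<open>
  A set \<open>K = 2 K\<close> with \<open>L = t + K = 2 L\<close> satisfies \<open>t + K = 2 t + K\<close>, and cancelling \<open>t\<close> gives \<open>K = L\<close>.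
  The vector \<open>t\<close> itself need not be 0, as the cones may contain lines.
\<close>
lemma cone_translate:
  fixes s x :: 'v
  assumes "(+) s ` K = (+) x ` L" and "(\<lambda>v. 2 *\<^sub>R v) ` K = K" "(\<lambda>v. 2 *\<^sub>R v) ` L = L"
  shows "K = L"
proof -
  define t where "t = s - x"
  have "(+) (-x) ` (+) s ` K = (+) (-x) ` (+) x ` L" using assms(1) by simp
  then have L: "L = (+) t ` K" unfolding translate_translate by (simp add: t_def)
  have "(\<lambda>v. 2 *\<^sub>R v) ` (+) t ` K = (+) (t + t) ` (\<lambda>v. 2 *\<^sub>R v) ` K"
    by (simp add: image_image scaleR_2 algebra_simps)
  then have "(+) t ` K = (+) (t + t) ` K" using L assms(2,3) by simp
  then have "(+) (-t) ` (+) t ` K = (+) (-t) ` (+) (t + t) ` K" by simp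
  then have "K = (+) t ` K" unfolding translate_translate by simp
  then show ?thesis using L by simp
qed

text \<open>
  Two representations of the same sector-face differ by a chart agreeing on it and by an element of
  the affine Weyl group.  The base points correspond only up to a translation preserving the face.
\<close>
lemma sector_face_eq:
  assumes f: "chart f" and g: "chart g" and F: "std F" and G: "(\<lambda>v. 2 *\<^sub>R v) ` G = G"
    and eq: "sector_face f x F = sector_face g z G"
  obtains g' w t where "chart g'" "range g' = range g" "w \<in> W" "\<And>h. h \<in> F \<Longrightarrow> g' (x + h) = f (x + h)"
    "\<And>v. g v = g' (w v + t)" "w ` G = F" "(+) (w z + t) ` F = (+) x ` F"
proof -
  have "sector_face f x F \<subseteq> range g" using eq by blast
  then obtain g' where g': "chart g'" "range g' = range g" "\<And>h. h \<in> F \<Longrightarrow> g' (x + h) = f (x + h)"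
    using apartment_containing_sector_face[OF f chart_facts(2)[OF g] F] by metis
  obtain a where a: "a \<in> Wa" "g = g' \<circ> a" using chart_same_range[OF g'(1) g g'(2)] by metis
  obtain w t where w: "w \<in> W" "\<And>v. a v = w v + t" using Wa_affine[OF a(1)] by metis
  have lin: "linear w" using W_linear w(1) .
  have "g' ` (+) (w z + t) ` w ` G = sector_face g z G"
    using a(2) w(2) lin by (simp add: image_image linear_add algebra_simps)
  also have "\<dots> = g' ` (+) x ` F" unfolding eq[symmetric] using g'(3) by (auto simp: image_image)
  finally have T: "(+) (w z + t) ` w ` G = (+) x ` F"
    using chart_facts(1)[OF g'(1)] by (simp add: inj_image_eq_iff)
  have "(\<lambda>v. 2 *\<^sub>R v) ` w ` G = w ` (\<lambda>v. 2 *\<^sub>R v) ` G" using lin by (simp add: image_image linear_scale)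
  then have "w ` G = F"
    using cone_translate[OF T] G spherical_face_double[OF std_spherical[OF F]] by simp
  then show ?thesis using that g' a(2) w T by (metis comp_apply)
qed

text \<open>
  The shortenings of a sector-face do not depend on the chart in which it is represented.
\<close>
lemma shortening_std:
  assumes f: "chart f" and F: "std F" and sh: "shortening (sector_face f x F) T"
  shows "\<exists>z\<in>F. T = sector_face f (x + z) F"
proof -
  obtain A g z G xi where A: "A \<in> Apts" "g \<in> Isom A" and G: "G \<in> spherical_faces" "xi \<in> G"
    and eq: "sector_face f x F = sector_face g z G" and T: "T = sector_face g (z + xi) G"
    using sh unfolding shortening_def by blast
  obtain g' w t where g': "chart g'" "range g' = range g" "w \<in> W" "\<And>h. h \<in> F \<Longrightarrow> g' (x + h) = f (x + h)"
    "\<And>v. g v = g' (w v + t)" "w ` G = F" "(+) (w z + t) ` F = (+) x ` F"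
    by (rule sector_face_eq[OF f chartI[OF A] F spherical_face_double[OF G(1)] eq]) (rule that)
  have lin: "linear w" using W_linear g'(3) .
  have wxi: "w xi \<in> F" using g'(6) G(2) by blast
  have "T = g' ` (+) (w xi) ` (+) (w z + t) ` w ` G"
    unfolding T using g'(5) lin by (simp add: image_image linear_add algebra_simps)
  also have "\<dots> = g' ` (+) (x + w xi) ` F" unfolding g'(6,7) translate_translate by (simp add: add.commute)
  also have "\<dots> = sector_face f (x + w xi) F"
  proof -
    have "g' ((x + w xi) + h) = f ((x + w xi) + h)" if "h \<in> F" for h
      using g'(4)[OF std_add[OF F wxi that]] by (simp add: add.assoc)
    then show ?thesis by (simp add: image_image)
  qed
  finally show ?thesis using wxi by blast
qed

lemma shorteningI: "chart f \<Longrightarrow> F \<in> spherical_faces \<Longrightarrow> z \<in> F \<Longrightarrow> shortening (sector_face f x F) (sector_face f (x + z) F)"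
  unfolding shortening_def chart_def by blast

lemma spherical_nonempty: "F \<in> spherical_faces \<Longrightarrow> F \<noteq> {}"
  using Fv_nonempty by (auto simp: spherical_faces_def vec_face_def)

lemma parallel_same_chart:
  assumes f: "chart f" and F: "F \<in> spherical_faces"
  shows "sector_face f y F \<in> ideal_class (sector_face f x F)"
proof -
  obtain z where "z \<in> F" using spherical_nonempty[OF F] by blast
  then show ?thesis unfolding ideal_class_def parallel_def
    using shorteningI[OF f F] chart_facts(2,3)[OF f] F by blast
qed

lemma standardize:
  assumes f: "chart f" and F: "F \<in> spherical_faces"
  obtains f' F' w where "chart f'" "range f' = range f" "std F'" "w \<in> W"
    "\<And>v. f v = f' (w v)" "\<And>x. sector_face f x F = sector_face f' (w x) F'"
proof -
  obtain s w J where F: "F = vec_face s w J" "s \<in> {1, -1}" "w \<in> W" "finite (W_par J)"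
    using F by (auto simp: spherical_faces_def)
  define F' where "F' = vec_face s id J"
  have "std F'" using F by (auto simp: std_def F'_def)
  have w': "inv w \<in> W" using W_inv F(3) .
  have "f v = (f \<circ> w) (inv w v)" for v using W_inverse[OF F(3)] by simp
  moreover have "sector_face f x F = sector_face (f \<circ> w) (inv w x) F'" for x
  proof -
    have lin: "linear w" using W_linear F(3) .
    have "F = w ` F'" unfolding F F'_def vec_face_def using lin by (simp add: image_image linear_scale)
    then show ?thesis using lin W_inverse[OF F(3)] by (simp add: image_image linear_add)
  qed
  moreover have "chart (f \<circ> w)" "range (f \<circ> w) = range f" using chart_comp[OF f] W_subset_Wa F(3) by blast+
  ultimately show ?thesis using that[of "f \<circ> w" F' "inv w"] \<open>std F'\<close> w' by blast
qed

text \<open>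
  A sector-face \<open>S\<close> based at \<open>p\<close> and parallel to \<open>x0 + F\<close> in the chart \<open>f0\<close> is linked to it by a chart
  \<open>f'\<close> in which both have shortenings of direction \<open>F\<close>.  The three charts are chosen so that
  the direction is \<open>F\<close> in each of them.
\<close>
lemma parallel_normal_form:
  assumes f0: "chart f0" and F: "std F" and S: "S \<in> ideal_class (sector_face f0 x0 F)" "based_at p S"
  obtains f' k u y z where "chart f'" "chart k" "z \<in> F" "k u = p" "S = sector_face k u F"
    "\<And>h. h \<in> F \<Longrightarrow> f' (x0 + z + h) = f0 (x0 + z + h)" "\<And>h. h \<in> F \<Longrightarrow> k (y + h) = f' (y + h)"
proof -
  obtain A f x y G where A: "A \<in> Apts" "f \<in> Isom A" and G: "G \<in> spherical_faces"
    and sh: "shortening (sector_face f0 x0 F) (sector_face f x G)" "shortening S (sector_face f y G)"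
    using S(1) unfolding ideal_class_def parallel_def by blast
  obtain z where z: "z \<in> F" "sector_face f x G = sector_face f0 (x0 + z) F"
    using shortening_std[OF f0 F sh(1)] by blast
  obtain f' w t where f': "chart f'" "range f' = range f" "w \<in> W"
    "\<And>h. h \<in> F \<Longrightarrow> f' (x0 + z + h) = f0 (x0 + z + h)"
    "\<And>v. f v = f' (w v + t)" "w ` G = F" "(+) (w x + t) ` F = (+) (x0 + z) ` F"
    by (rule sector_face_eq[OF f0 chartI[OF A] F spherical_face_double[OF G] z(2)[symmetric]]) (rule that)
  have "linear w" using W_linear f'(3) .
  then have y: "sector_face f y G = sector_face f' (w y + t) F"
    unfolding f'(6)[symmetric] using f'(5) by (simp add: image_image linear_add algebra_simps)
  obtain B k0 u0 K0 where B: "B \<in> Apts" "k0 \<in> Isom B" and K0: "K0 \<in> spherical_faces" "p = k0 u0" "S = sector_face k0 u0 K0"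
    using S(2) unfolding based_at_def by blast
  obtain k1 K w1 where k1: "chart k1" "range k1 = range k0" "std K" "w1 \<in> W"
    "\<And>v. k0 v = k1 (w1 v)" "\<And>x. sector_face k0 x K0 = sector_face k1 (w1 x) K"
    by (rule standardize[OF chartI[OF B] K0(1)]) (rule that)
  define u1 where "u1 = w1 u0"
  have S1: "S = sector_face k1 u1 K" "p = k1 u1" using K0 k1 by (auto simp: u1_def)
  obtain kap where kap: "kap \<in> K" "sector_face f' (w y + t) F = sector_face k1 (u1 + kap) K"
    using shortening_std[OF k1(1,3)] sh(2) S1(1) y by metis
  obtain k w2 t2 where k: "chart k" "range k = range k1" "w2 \<in> W"
    "\<And>h. h \<in> F \<Longrightarrow> k (w y + t + h) = f' (w y + t + h)" "\<And>v. k1 v = k (w2 v + t2)" "w2 ` K = F"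
    "(+) (w2 (u1 + kap) + t2) ` F = (+) (w y + t) ` F"
    by (rule sector_face_eq[OF f'(1) k1(1) F spherical_face_double[OF std_spherical[OF k1(3)]] kap(2)]) (rule that)
  have "linear w2" using W_linear k(3) .
  then have "S = sector_face k (w2 u1 + t2) F"
    unfolding S1(1) k(6)[symmetric] using k(5) by (simp add: image_image linear_add algebra_simps)
  then show ?thesis
    by (intro that[of f' k z "w2 u1 + t2" "w y + t"])
       (use f'(1,4) k(1,4) k(5)[symmetric] z(1) S1(2) in auto)
qed

section \<open>The sector-face based at a point in a class of ideal panels\<close>

text \<open>
  \<open>S\<close> is the sector-face based at \<open>p\<close> in an apartment containing \<open>p\<close> and a shortening of the sector-face of
  base point \<open>z\<close> and direction \<open>F\<close> of the chart \<open>f\<close>.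
\<close>
definition leads_to :: "('v \<Rightarrow> 'p) \<Rightarrow> 'v set \<Rightarrow> 'p \<Rightarrow> 'v \<Rightarrow> 'p set \<Rightarrow> bool" where
  "leads_to f F p z S \<longleftrightarrow> (\<exists>h u. chart h \<and> h u = p \<and> S = sector_face h u F \<and>
     (\<exists>xi\<in>F. \<forall>l\<in>F. h (z + xi + l) = f (z + xi + l)))"

lemma leads_to_unique:
  assumes F: "std F" and "leads_to f F p z S" "leads_to f F p z S'" shows "S = S'"
proof -
  obtain h u xi where h: "chart h" "h u = p" "S = sector_face h u F" "xi \<in> F"
    "\<forall>l\<in>F. h (z + xi + l) = f (z + xi + l)" using assms(2) unfolding leads_to_def by blast
  obtain h' u' xi' where h': "chart h'" "h' u' = p" "S' = sector_face h' u' F" "xi' \<in> F"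
    "\<forall>l\<in>F. h' (z + xi' + l) = f (z + xi' + l)" using assms(3) unfolding leads_to_def by blast
  have "h (u + k) = h' (u' + k)" if "k \<in> F" for k
    by (rule sector_face_determined[OF h(1) h'(1) _ F h(4) h'(4), where x = z and f = f])
       (use h h' that in auto)
  then show ?thesis using h(3) h'(3) by (auto simp: image_image)
qed

lemma leads_to_locally_constant:
  assumes f: "chart f" and F: "std F" and F': "F' \<in> vec_faces" "d \<in> F'"
  obtains S e where "0 < e" "\<And>t. 0 \<le> t \<Longrightarrow> t < e \<Longrightarrow> leads_to f F p (z + t *\<^sub>R d) S"
proof -
  have "F' \<noteq> {}" using F'(2) by blast
  then obtain h where h: "chart h" "p \<in> range h" "eventually (\<lambda>v. h v = f v) (chimney_germ (local_face z F') F)"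
    using chart_through_point_and_germ[OF f F F'(1)] by metis
  obtain u where u: "h u = p" using h(2) by blast
  obtain xi e where xi: "xi \<in> F" "0 < e"
    "\<And>t l. 0 \<le> t \<Longrightarrow> t < e \<Longrightarrow> l \<in> F \<Longrightarrow> h (z + t *\<^sub>R d + xi + l) = f (z + t *\<^sub>R d + xi + l)"
    using eventually_chimney_germ[OF h(3) F F'] by metis
  then have "leads_to f F p (z + t *\<^sub>R d) (sector_face h u F)" if "0 \<le> t" "t < e" for t
    unfolding leads_to_def using h(1) u that by blast
  then show ?thesis using that xi(2) by blast
qed

lemma leads_to_exists: assumes "chart f" "std F" shows "\<exists>S. leads_to f F p z S"
proof -
  obtain d where d: "d \<in> F" using std_nonempty[OF assms(2)] by blast
  have "F \<in> vec_faces" using assms(2) std_spherical spherical_vec by blast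
  then obtain S e where "0 < e" "\<And>t. 0 \<le> t \<Longrightarrow> t < e \<Longrightarrow> leads_to f F p (z + t *\<^sub>R d) S"
    using leads_to_locally_constant[OF assms _ d] by metis
  then have "leads_to f F p (z + 0 *\<^sub>R d) S" by blast
  then show ?thesis by auto
qed

text \<open>
  Chimneys based on the local faces of directions \<open>F'\<close> and \<open>-F'\<close> show that the sector-face at \<open>p\<close> is
  locally constant on both sides of each point of the line; the line is connected.
\<close>
lemma leads_to_along_face:
  assumes f: "chart f" and F: "std F" and F': "F' \<in> vec_faces" "d \<in> F'" and S: "leads_to f F p z S"
  shows "leads_to f F p (z + d) S"
proof -
  define s where "s t = (THE S. leads_to f F p (z + t *\<^sub>R d) S)" for t
  have s: "leads_to f F p (z + t *\<^sub>R d) T \<longleftrightarrow> T = s t" for t T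
  proof -
    obtain T' where T': "leads_to f F p (z + t *\<^sub>R d) T'" using leads_to_exists[OF f F] by blast
    then have "s t = T'" unfolding s_def by (rule the_equality) (rule leads_to_unique[OF F _ T'])
    then show ?thesis using T' leads_to_unique[OF F] by blast
  qed
  have "\<forall>\<^sub>F t' in at t. s t = s t'" for t
  proof -
    obtain S1 e1 where 1: "0 < e1" "\<And>r. 0 \<le> r \<Longrightarrow> r < e1 \<Longrightarrow> leads_to f F p ((z + t *\<^sub>R d) + r *\<^sub>R d) S1"
      using leads_to_locally_constant[OF f F F'] by metis
    have "- d \<in> uminus ` F'" using F'(2) by blast
    then obtain S2 e2 where 2: "0 < e2" "\<And>r. 0 \<le> r \<Longrightarrow> r < e2 \<Longrightarrow> leads_to f F p ((z + t *\<^sub>R d) + r *\<^sub>R (- d)) S2"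
      using leads_to_locally_constant[OF f F vec_face_uminus[OF F'(1)]] by metis
    have c1: "s (t + r) = S1" if "0 \<le> r" "r < e1" for r
      using 1(2)[OF that] s[of "t + r" S1] by (simp add: algebra_simps)
    have c2: "s (t - r) = S2" if "0 \<le> r" "r < e2" for r
      using 2(2)[OF that] s[of "t - r" S2] by (simp add: algebra_simps)
    have st: "s t = S1" "s t = S2" using c1[of 0] c2[of 0] 1(1) 2(1) by auto
    have "s t = s t'" if "dist t' t < min e1 e2" for t'
    proof (cases "t \<le> t'")
      case True
      then show ?thesis using c1[of "t' - t"] st that by (simp add: dist_real_def)
    next
      case False
      then show ?thesis using c2[of "t - t'"] st that by (simp add: dist_real_def)
    qed
    then show ?thesis unfolding eventually_at using 1(1) 2(1) by (intro exI[of _ "min e1 e2"]) auto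
  qed
  then have "s 0 = s 1" by (intro connected_local_const[of UNIV]) auto
  then show ?thesis using s[of 0 S] s[of 1 S] S by simp
qed

lemma leads_to_shift:
  assumes F: "std F" and k: "k \<in> F" shows "leads_to f F p (z + k) S \<longleftrightarrow> leads_to f F p z S"
proof
  assume "leads_to f F p (z + k) S"
  then obtain h u xi where h: "chart h" "h u = p" "S = sector_face h u F" "xi \<in> F"
    "\<forall>l\<in>F. h (z + k + xi + l) = f (z + k + xi + l)" unfolding leads_to_def by blast
  then have "\<forall>l\<in>F. h (z + (k + xi) + l) = f (z + (k + xi) + l)" by (simp add: algebra_simps)
  then show "leads_to f F p z S" unfolding leads_to_def using h std_add[OF F k h(4)] by blast
next
  assume "leads_to f F p z S"
  then obtain h u xi where h: "chart h" "h u = p" "S = sector_face h u F" "xi \<in> F"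
    "\<forall>l\<in>F. h (z + xi + l) = f (z + xi + l)" unfolding leads_to_def by blast
  then have "\<forall>l\<in>F. h (z + xi + (k + l)) = f (z + xi + (k + l))" using std_add[OF F k] by blast
  then have "\<forall>l\<in>F. h (z + k + xi + l) = f (z + k + xi + l)" by (simp add: algebra_simps)
  then show "leads_to f F p (z + k) S" unfolding leads_to_def using h by blast
qed

lemma leads_to_cong:
  assumes F: "std F" and eq: "\<And>l. l \<in> F \<Longrightarrow> f (z + l) = f' (z + l)" and "leads_to f F p z S"
  shows "leads_to f' F p z S"
proof -
  obtain h u xi where h: "chart h" "h u = p" "S = sector_face h u F" "xi \<in> F"
    "\<forall>l\<in>F. h (z + xi + l) = f (z + xi + l)" using assms(3) unfolding leads_to_def by blast
  have "h (z + xi + l) = f' (z + xi + l)" if "l \<in> F" for l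
    using h(5) that eq[OF std_add[OF F h(4) that]] by (simp add: add.assoc)
  then show ?thesis unfolding leads_to_def using h by blast
qed

definition std_panel :: "'v set \<Rightarrow> bool" where
  "std_panel F \<longleftrightarrow> (\<exists>s\<in>{1, -1}. \<exists>i. F = vec_face s id {i})"

lemma std_panel_std: "std_panel F \<Longrightarrow> std F"
  unfolding std_panel_def std_def using finite_W_par_singleton by blast

lemma std_panel_absorbs:
  assumes F: "std_panel F" and h: "h \<in> F" shows "\<exists>N>0. \<exists>F'\<in>vec_faces. v + N *\<^sub>R h \<in> F'"
proof -
  obtain s i where s: "s \<in> {1, -1}" "F = vec_face s id {i}" using F by (auto simp: std_panel_def)
  then obtain h' where h': "h' \<in> Fv {i}" "h = s *\<^sub>R h'" using h by (auto simp: vec_face_def)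
  obtain N w J where N: "N > 0" "w \<in> W" "s *\<^sub>R v + N *\<^sub>R h' \<in> w ` Fv J"
    using panel_absorbs[OF h'(1), of "s *\<^sub>R v"] by blast
  have "v + N *\<^sub>R h = s *\<^sub>R (s *\<^sub>R v + N *\<^sub>R h')" using s(1) h'(2) by (auto simp: algebra_simps)
  then have "v + N *\<^sub>R h \<in> vec_face s w J" using N(3) unfolding vec_face_def by (auto simp: image_iff)
  then show ?thesis using N s unfolding vec_faces_def by blast
qed

text \<open>
  A shortening does not change the sector-face at \<open>p\<close>, and after a long enough shortening the two points
  are joined by a segment in the direction of a vectorial face.
\<close>
lemma leads_to_independent:
  assumes f: "chart f" and F: "std_panel F" and S: "leads_to f F p z S" shows "leads_to f F p z' S"
proof -
  note standard = std_panel_std[OF F]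
  obtain h where h: "h \<in> F" using std_nonempty[OF standard] by blast
  obtain N F' where N: "N > 0" "F' \<in> vec_faces" "(z' - z) + N *\<^sub>R h \<in> F'" using std_panel_absorbs[OF F h] by blast
  have "leads_to f F p (z + ((z' - z) + N *\<^sub>R h)) S" by (rule leads_to_along_face[OF f standard N(2,3) S])
  then have "leads_to f F p (z' + N *\<^sub>R h) S" by simp
  then show ?thesis using leads_to_shift[OF standard std_scale[OF standard h N(1)]] by simp
qed

text \<open>
  The chart \<open>f'\<close> linking \<open>S\<close> to the class leads to \<open>S\<close> from one of its points, hence from all of them, in
  particular from a point where it agrees with \<open>f0\<close>.
\<close>
lemma leads_to_if_based:
  assumes f0: "chart f0" and F: "std_panel F" and S: "S \<in> ideal_class (sector_face f0 x0 F)" "based_at p S"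
  shows "leads_to f0 F p x0 S"
proof -
  note standard = std_panel_std[OF F]
  obtain f' k u y z where *: "chart f'" "chart k" "z \<in> F" "k u = p" "S = sector_face k u F"
    "\<And>h. h \<in> F \<Longrightarrow> f' (x0 + z + h) = f0 (x0 + z + h)" "\<And>h. h \<in> F \<Longrightarrow> k (y + h) = f' (y + h)"
    by (rule parallel_normal_form[OF f0 standard S]) (rule that)
  have "k (y + z + l) = f' (y + z + l)" if "l \<in> F" for l
    using *(7)[OF std_add[OF standard *(3) that]] by (simp add: add.assoc)
  then have "leads_to f' F p y S" unfolding leads_to_def using * by blast
  then have "leads_to f' F p (x0 + z) S" by (rule leads_to_independent[OF *(1) F])
  then have "leads_to f0 F p (x0 + z) S" using leads_to_cong[OF standard, of f' "x0 + z" f0 p S] *(6) by blast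
  then show ?thesis using leads_to_shift[OF standard *(3)] by simp
qed

lemma panel_unique:
  assumes "chart f0" "std_panel F" "S \<in> ideal_class (sector_face f0 x0 F)" "based_at p S"
    "S' \<in> ideal_class (sector_face f0 x0 F)" "based_at p S'"
  shows "S = S'"
  using leads_to_unique[OF std_panel_std[OF assms(2)]] leads_to_if_based assms by metis

lemma based_atI: "chart f \<Longrightarrow> F \<in> spherical_faces \<Longrightarrow> based_at (f x) (sector_face f x F)"
  unfolding based_at_def chart_def by blast

text \<open>
The description in the definition of \<open>Q\<close> is satisfied by exactly one sector-face.
\<close>
lemma Q_panel:
  assumes f: "chart f" and F: "std_panel F"
  shows "Q (f v) (ideal_class (sector_face f x F)) = sector_face f v F"
  unfolding Q_def
proof (rule the_equality)
  have sph: "F \<in> spherical_faces" using F std_panel_std std_spherical by blast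
  show "sector_face f v F \<in> ideal_class (sector_face f x F) \<and> based_at (f v) (sector_face f v F)"
    using parallel_same_chart[OF f sph] based_atI[OF f sph] by blast
  then show "S = sector_face f v F" if "S \<in> ideal_class (sector_face f x F) \<and> based_at (f v) S" for S
    using panel_unique[OF f F] that by blast
qed

lemma eventually_sector_germ:
  assumes f: "chart f" and F: "std F"
  shows "eventually P (sector_germ (sector_face f x F)) \<longleftrightarrow> (\<exists>z\<in>F. \<forall>h\<in>F. P (f (x + z + h)))"
proof -
  have sh: "{T. shortening (sector_face f x F) T} = (\<lambda>z. sector_face f (x + z) F) ` F"
    using shortening_std[OF f F, of x] shorteningI[OF f std_spherical[OF F]] by blast
  have "sector_germ (sector_face f x F) = (INF z\<in>F. principal (sector_face f (x + z) F))"
    unfolding sector_germ_def sh by (simp add: image_image)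
  moreover have "\<exists>c\<in>F. principal (sector_face f (x + c) F)
      \<le> inf (principal (sector_face f (x + a) F)) (principal (sector_face f (x + b) F))"
    if ab: "a \<in> F" "b \<in> F" for a b
  proof (rule bexI[OF _ std_add[OF F ab]])
    have "f (x + (a + b) + h) \<in> sector_face f (x + a) F" "f (x + (a + b) + h) \<in> sector_face f (x + b) F"
      if h: "h \<in> F" for h
    proof -
      have "x + (a + b) + h = (x + a) + (b + h)" "x + (a + b) + h = (x + b) + (a + h)" by (auto simp: algebra_simps)
      then show "f (x + (a + b) + h) \<in> sector_face f (x + a) F" "f (x + (a + b) + h) \<in> sector_face f (x + b) F"
        using std_add[OF F] ab h by (metis imageI)+
    qed
    then show "principal (sector_face f (x + (a + b)) F)
      \<le> inf (principal (sector_face f (x + a) F)) (principal (sector_face f (x + b) F))" by auto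
  qed
  ultimately show ?thesis
    using std_nonempty[OF F] by (simp add: eventually_INF_base eventually_principal)
qed

end

lemma strongly_transitive_reflection:
  assumes "strongly_transitive act H X" "(l, C) \<in> X" "c \<in> C"
  obtains g where "g \<in> H" "\<And>t. act g (l t) = l (2 * c - t)"
proof -
  have "(\<lambda>t. 2 * c - t) \<in> generated_by {\<lambda>t. 2 * c - t | c. c \<in> C}"
    by (intro gen_base) (use assms(3) in blast)
  moreover have "\<forall>\<gamma>\<in>generated_by {\<lambda>t. 2 * c - t | c. c \<in> C}.
      \<exists>g\<in>H. act g ` range l = range l \<and> (\<forall>t. act g (l t) = l (\<gamma> t))"
    using assms(1,2) unfolding strongly_transitive_def by fast
  ultimately show ?thesis using that by meson
qed

context masure
begin

section \<open>Affine reflections induced by the group\<close>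

lemma subgroup_facts:
  assumes "vectorially_Weyl_subgroup G" "g \<in> G"
  shows "bij g" "inv g \<in> G" "A \<in> Apts \<Longrightarrow> g ` A \<in> Apts" "g \<in> Aut"
proof -
  show g: "bij g" "inv g \<in> G" "g \<in> Aut"
    using assms unfolding vectorially_Weyl_subgroup_def bij_subgroup_def by auto
  have "(`) g ` Apts = Apts" using g(3) by (simp add: Aut_def)
  then show "A \<in> Apts \<Longrightarrow> g ` A \<in> Apts" by blast
qed

lemma automorphism_in_charts:
  assumes G: "vectorially_Weyl_subgroup G" "g \<in> G" and f: "chart f" "chart f'" "range f' = g ` range f"
  obtains w t where "w \<in> W" "\<And>v. g (f v) = f' (w v + t)"
proof -
  have "apt_iso (WV \<inter> AutA) (range f) (g ` range f) g"
    using G chart_facts(2)[OF f(1)] unfolding vectorially_Weyl_subgroup_def vectorially_Weyl_def by blast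
  moreover have "f \<in> Isom (range f)" "f' \<in> Isom (g ` range f)"
    using chart_facts(3) f by metis+
  ultimately have "inv f' \<circ> g \<circ> f \<in> WV" unfolding apt_iso_def by blast
  then obtain w t where w: "w \<in> W" "inv f' \<circ> g \<circ> f = (\<lambda>v. w v + t)" unfolding WV_def by blast
  have "g (f v) = f' (w v + t)" for v
  proof -
    have "w v + t = inv f' (g (f v))" using w(2) by (metis comp_apply)
    moreover have "g (f v) \<in> range f'" using f(3) by blast
    ultimately show ?thesis by (simp add: f_inv_into_f)
  qed
  then show ?thesis using that w(1) by blast
qed

text \<open>
  A vector on which \<open>alpha i\<close> is 1; its multiples are representatives of the points of the line
  \<open>V / ker (alpha i)\<close>.
\<close>
definition half_coroot :: "'i \<Rightarrow> 'v" where
  "half_coroot i = (1/2) *\<^sub>R coalpha i"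

lemma alpha_half_coroot [simp]: "alpha i (half_coroot i) = 1"
  by (simp add: half_coroot_def cartan_diag)

definition panel :: "'i \<Rightarrow> 'v set" where
  "panel i = Fv {i}"

lemma panel_facts:
  "std_panel (panel i)" "std_panel (uminus ` panel i)" "panel i \<in> vec_panels"
  "uminus ` panel i \<in> vec_panels" "panel i \<in> spherical_faces" "uminus ` panel i \<in> spherical_faces"
proof -
  have e: "panel i = vec_face 1 id {i}" "uminus ` panel i = vec_face (-1) id {i}"
    by (simp_all add: panel_def vec_face_def)
  show p: "std_panel (panel i)" "std_panel (uminus ` panel i)"
    unfolding std_panel_def using e by blast+
  have "card {i} = 1" by simp
  then show "panel i \<in> vec_panels" "uminus ` panel i \<in> vec_panels"
    unfolding vec_panels_def using e W_id by blast+
  show "panel i \<in> spherical_faces" "uminus ` panel i \<in> spherical_faces"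
    using p std_panel_std std_spherical by blast+
qed

text \<open>
  The panel spans the kernel of \<open>alpha i\<close>, so sector-faces based at points with the same value of
  \<open>alpha i\<close> have a common shortening.
\<close>
lemma sector_germ_panel_cong:
  assumes f: "chart f" and a: "alpha i v = alpha i v'"
  shows "sector_germ (sector_face f v (panel i)) = sector_germ (sector_face f v' (panel i))"
proof -
  have F: "std (panel i)" using panel_facts std_panel_std by blast
  have imp: "\<exists>z\<in>panel i. \<forall>h\<in>panel i. P (f (y' + z + h))"
    if ex: "\<exists>z\<in>panel i. \<forall>h\<in>panel i. P (f (y + z + h))" and y: "alpha i y = alpha i y'" for P y y'
  proof -
    obtain z where z: "z \<in> panel i" "\<forall>h\<in>panel i. P (f (y + z + h))" using ex by blast
    obtain h0 where h0: "h0 \<in> panel i" using std_nonempty[OF F] by blast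
    have "\<forall>\<^sub>F t in at_top. (y - y') + t *\<^sub>R h0 \<in> panel i"
      by (rule std_absorb[OF F h0]) (use h0 y in \<open>auto simp: panel_def Fv_def split: if_splits\<close>, metis ComplI less_irrefl singletonD)
    then have "\<forall>\<^sub>F t in at_top. t > 0 \<and> (y - y') + t *\<^sub>R h0 \<in> panel i"
      using eventually_gt_at_top[of 0] by eventually_elim auto
    then obtain t where t: "t > 0" "(y - y') + t *\<^sub>R h0 \<in> panel i"
      unfolding eventually_at_top_linorder by blast
    have "P (f (y' + (z + ((y - y') + t *\<^sub>R h0)) + h))" if "h \<in> panel i" for h
    proof -
      have "P (f (y + z + (t *\<^sub>R h0 + h)))" using z(2) std_add[OF F std_scale[OF F h0 t(1)] that] by blast
      then show ?thesis by (simp add: algebra_simps)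
    qed
    then show ?thesis using std_add[OF F z(1) t(2)] by blast
  qed
  have "eventually P (sector_germ (sector_face f v (panel i)))
      \<longleftrightarrow> eventually P (sector_germ (sector_face f v' (panel i)))" for P
    unfolding eventually_sector_germ[OF f F] using imp[of P v v'] imp[of P v' v] a by metis
  then show ?thesis by (simp add: filter_eq_iff)
qed

text \<open>
  A point \<open>f v'\<close> is reached from a point of a shortening of its sector-face contained in \<open>g ` range f\<close> by going back
  in the class of \<open>-F\<close>.  That class is fixed by \<open>g\<close>, so the sector-face of base point \<open>f y\<close> in it is
  the image under \<open>g\<close> of one in \<open>range f\<close>, and is unique.
\<close>
lemma germ_reflection_covers:
  assumes G: "vectorially_Weyl_subgroup G" "g \<in> G" and f: "chart f"
    and opp: "(`) g ` ideal_class (sector_face f x (uminus ` panel i)) = ideal_class (sector_face f x (uminus ` panel i))"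
    and germ: "\<And>v v'. alpha i v + alpha i v' = c \<Longrightarrow>
      filtermap g (sector_germ (sector_face f v (panel i))) = sector_germ (sector_face f v' (panel i))"
  shows "range f \<subseteq> g ` range f"
proof
  fix p assume "p \<in> range f"
  then obtain v' where p: "p = f v'" by blast
  have F: "std (panel i)" using panel_facts std_panel_std by blast
  define v where "v = (c - alpha i v') *\<^sub>R half_coroot i"
  have v: "alpha i v + alpha i v' = c" by (simp add: v_def)
  have "eventually (\<lambda>p. p \<in> g ` range f) (filtermap g (sector_germ (sector_face f v (panel i))))"
    unfolding eventually_filtermap eventually_sector_germ[OF f F] using std_nonempty[OF F] by blast
  then obtain z where z: "z \<in> panel i" "\<forall>h\<in>panel i. f (v' + z + h) \<in> g ` range f"
    unfolding germ[OF v] eventually_sector_germ[OF f F] by blast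
  define y where "y = v' + z + z"
  obtain u where u: "f y = g (f u)" using z by (auto simp: y_def)
  let ?F = "uminus ` panel i" and ?s = "ideal_class (sector_face f x (uminus ` panel i))"
  have "sector_face f u ?F \<in> ?s" by (rule parallel_same_chart[OF f panel_facts(6)])
  then have "g ` sector_face f u ?F \<in> ?s" using opp by blast
  moreover have "based_at (f y) (g ` sector_face f u ?F)"
  proof -
    obtain f' where f': "chart f'" "range f' = g ` range f"
      using Apts_chart[OF subgroup_facts(3)[OF G chart_facts(2)[OF f]]] by metis
    obtain w t where w: "w \<in> W" "\<And>v. g (f v) = f' (w v + t)"
      using automorphism_in_charts[OF G f f'] by metis
    have lin: "linear w" using W_linear w(1) .
    have "g ` sector_face f u ?F = sector_face f' (w u + t) (w ` ?F)"
      using lin by (simp add: image_image w(2) linear_diff linear_neg algebra_simps)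
    moreover have "w ` ?F = vec_face (-1) w {i}"
      using lin by (simp add: vec_face_def panel_def image_image linear_neg)
    moreover have "vec_face (-1) w {i} \<in> spherical_faces"
      unfolding spherical_faces_def using w(1) finite_W_par_singleton by blast
    moreover have "f y = f' (w u + t)" using u w(2) by simp
    ultimately show ?thesis using based_atI[OF f'(1)] by metis
  qed
  ultimately have "g ` sector_face f u ?F = sector_face f y ?F"
    using panel_unique[OF f panel_facts(2)] parallel_same_chart[OF f panel_facts(6)]
      based_atI[OF f panel_facts(6)] by metis
  moreover have "p \<in> sector_face f y ?F"
  proof -
    have "v' = y + - (z + z)" by (simp add: y_def)
    then show ?thesis using std_add[OF F z(1) z(1)] unfolding p by blast
  qed
  ultimately show "p \<in> g ` range f" by blast
qed

text \<open>
  Let \<open>w\<close> be the linear part of \<open>g\<close> in the chart.  Comparing germs shows that \<open>w\<^sup>-\<^sup>1\<close> maps the panel into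
  its closure, so \<open>w\<close> acts on \<open>alpha i\<close> by a scalar, which the action on the line shows to be -1; then
  \<open>w = refl i\<close>.
\<close>
lemma reflection_from_germs:
  assumes G: "vectorially_Weyl_subgroup G" "g \<in> G" and f: "chart f" and stab: "g ` range f = range f"
    and germ: "\<And>v v'. alpha i v + alpha i v' = c \<Longrightarrow>
      filtermap g (sector_germ (sector_face f v (panel i))) = sector_germ (sector_face f v' (panel i))"
  shows "\<exists>t. (\<forall>v. g (f v) = f (refl i v + t)) \<and> alpha i t = c"
proof -
  have F: "std (panel i)" using panel_facts std_panel_std by blast
  obtain w t where w: "w \<in> W" "\<And>v. g (f v) = f (w v + t)"
    using automorphism_in_charts[OF G f f stab[symmetric]] by metis
  define u where "u = inv w"
  have lin: "linear w" "linear u" using W_linear w(1) W_inv by (auto simp: u_def)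
  have uw: "u (w v) = v" "w (u v) = v" for v using W_inverse[OF w(1)] by (auto simp: u_def)
  have key: "\<exists>z\<in>panel i. \<forall>h\<in>panel i. u (v' + z + h - w v - t) \<in> panel i"
    if v: "alpha i v + alpha i v' = c" for v v'
  proof -
    have "eventually (\<lambda>p. p \<in> sector_face f (w v + t) (w ` panel i)) (filtermap g (sector_germ (sector_face f v (panel i))))"
      unfolding eventually_filtermap eventually_sector_germ[OF f F]
    proof -
      obtain z where z: "z \<in> panel i" using std_nonempty[OF F] by blast
      have "g (f (v + z + h)) \<in> sector_face f (w v + t) (w ` panel i)" if "h \<in> panel i" for h
      proof -
        have "w (v + z + h) + t = (w v + t) + w (z + h)" using lin by (simp add: linear_add algebra_simps)
        then show ?thesis using std_add[OF F z that] w(2) by (metis imageI)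
      qed
      then show "\<exists>z\<in>panel i. \<forall>h\<in>panel i. g (f (v + z + h)) \<in> sector_face f (w v + t) (w ` panel i)"
        using z by blast
    qed
    then obtain z where z: "z \<in> panel i" "\<forall>h\<in>panel i. f (v' + z + h) \<in> sector_face f (w v + t) (w ` panel i)"
      unfolding germ[OF v] eventually_sector_germ[OF f F] by blast
    have "u (v' + z + h - w v - t) \<in> panel i" if "h \<in> panel i" for h
    proof -
      obtain k where k: "k \<in> panel i" "f (v' + z + h) = f (w v + t + w k)" using z(2) \<open>h \<in> panel i\<close> by blast
      then have "v' + z + h = w v + t + w k" using chart_facts(1)[OF f] by (simp add: inj_eq)
      then have "v' + z + h - w v - t = w k" by simp
      then show ?thesis using k uw by simp
    qed
    then show ?thesis using z by blast
  qed
  have Fi: "alpha i h = 0" if "h \<in> panel i" for h using that by (simp add: panel_def Fv_def)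
  have Fj: "0 < alpha j h" if "h \<in> panel i" "j \<noteq> i" for h j using that by (simp add: panel_def Fv_def)
  obtain z where z: "\<And>h. h \<in> panel i \<Longrightarrow> u (c *\<^sub>R half_coroot i + z + h - w 0 - t) \<in> panel i"
    using key[of 0 "c *\<^sub>R half_coroot i"] by auto
  define y where "y = c *\<^sub>R half_coroot i + z - w 0 - t"
  have y: "u y + u h \<in> panel i" if "h \<in> panel i" for h
    using z[OF that] lin(2) by (simp add: y_def linear_add linear_diff algebra_simps)
  \<comment> \<open>The translate of \<open>u h\<close> by \<open>u y\<close> is in the panel for all \<open>h\<close> of a cone; multiples of \<open>h\<close> give the signs.\<close>
  have j: "0 \<le> alpha j (u h)" if h: "h \<in> panel i" and "j \<noteq> i" for j h
  proof (rule ccontr)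
    assume "\<not> ?thesis"
    then have neg: "alpha j (u h) < 0" by simp
    define n where "n = (\<bar>alpha j (u y)\<bar> + 1) / - alpha j (u h)"
    have "n > 0" unfolding n_def using neg by (intro divide_pos_pos) auto
    then have "0 < alpha j (u y + u (n *\<^sub>R h))" using Fj[OF y[OF std_scale[OF F h]] \<open>j \<noteq> i\<close>] by blast
    also have "alpha j (u y + u (n *\<^sub>R h)) = alpha j (u y) + n * alpha j (u h)"
      using lin(2) by (simp add: linear_scale)
    also have "n * alpha j (u h) = - (\<bar>alpha j (u y)\<bar> + 1)" using neg by (simp add: n_def)
    finally show False by simp
  qed
  have i0: "alpha i (u h) = 0" if h: "h \<in> panel i" for h
    using Fi[OF y[OF h]] Fi[OF y[OF std_add[OF F h h]]] lin(2) by (simp add: linear_add)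
  have iker: "alpha i (u d) = 0" if d: "alpha i d = 0" for d
  proof -
    obtain h where h: "h \<in> panel i" using std_nonempty[OF F] by blast
    have "\<forall>\<^sub>F t in at_top. d + t *\<^sub>R h \<in> panel i"
      by (rule std_absorb[OF F h]) (use d Fj[OF h] in force)
    then obtain n where "d + n *\<^sub>R h \<in> panel i"
      unfolding eventually_at_top_linorder by blast
    then have "alpha i (u (d + n *\<^sub>R h)) = 0" by (rule i0)
    then show ?thesis using i0[OF h] lin(2) by (simp add: linear_add linear_scale)
  qed
  \<comment> \<open>The simple root \<open>alpha i\<close> vanishes after \<open>u\<close> on its own kernel, so \<open>u\<close> multiplies it by a scalar.\<close>
  define kap where "kap = alpha i (u (half_coroot i))"
  have ui: "alpha i (u v) = kap * alpha i v" for v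
  proof -
    have "alpha i (u (v - alpha i v *\<^sub>R half_coroot i)) = 0" by (rule iker) simp
    then show ?thesis using lin(2) by (simp add: linear_diff linear_scale kap_def)
  qed
  have "kap \<noteq> 0"
  proof
    assume "kap = 0"
    then have "alpha i (u (w (half_coroot i))) = 0" using ui by simp
    then show False using uw by simp
  qed
  have main: "alpha i v' = alpha i (w v) + alpha i t" if v: "alpha i v + alpha i v' = c" for v v'
  proof -
    obtain z where z: "z \<in> panel i" "\<forall>h\<in>panel i. u (v' + z + h - w v - t) \<in> panel i" using key[OF v] by blast
    then have "alpha i (u (v' + z + z - w v - t)) = 0" using Fi by blast
    then show ?thesis using \<open>kap \<noteq> 0\<close> Fi[OF z(1)] by (simp add: ui)
  qed
  have t: "alpha i t = c" using main[of 0 "c *\<^sub>R half_coroot i"] lin(1) by (simp add: linear_0)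
  have "alpha i (w v) = - alpha i v" for v
    using main[of v "(c - alpha i v) *\<^sub>R half_coroot i"] t by simp
  then have "w = refl i"
    using W_eq_refl_if_panel[OF w(1)] j by (simp add: panel_def u_def)
  then show ?thesis using w(2) t by blast
qed

text \<open>
  The uniqueness of sector-faces shows that the apartment \<open>range f\<close> defines a line of the panel tree, so
  that (LST) applies to it.
\<close>
lemma reflection_of_panel_tree:
  assumes G: "vectorially_Weyl_subgroup G" and LST: "LST G" and card: "CARD('i) \<ge> 2"
    and f: "chart f" and k: "k \<in> Lam (alpha i)"
  shows "\<exists>g\<in>G. \<exists>t. (\<forall>v. g (f v) = f (refl i v + t)) \<and> alpha i t = - 2 * k"
proof -
  let ?F = "panel i" and ?F' = "uminus ` panel i"
  define s where "s = ideal_class (sector_face f 0 ?F)"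
  define s' where "s' = ideal_class (sector_face f 0 ?F')"
  define l where "l t = sector_germ (sector_face f (t *\<^sub>R half_coroot i) ?F)" for t
  define C where "C = {c. wall (alpha i) (- c) \<in> walls}"
  have A: "range f \<in> Apts" "f \<in> Isom (range f)" using chart_facts[OF f] by auto
  have pan: "s \<in> ideal_panels" "s' \<in> ideal_panels"
    unfolding s_def s'_def ideal_panels_def using A panel_facts(3,4) by blast+
  have opp: "opposite s s'"
    unfolding s_def s'_def opposite_def using A panel_facts(5) by blast
  have bd: "s \<in> boundary (range f)" "s' \<in> boundary (range f)"
    unfolding s_def s'_def boundary_def using A panel_facts(5,6) by blast+
  have l: "l (alpha i v) = sector_germ (sector_face f v ?F)" for v
    unfolding l_def by (rule sector_germ_panel_cong[OF f]) simp
  have "(l, C) \<in> panel_tree_lines s s'"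
    unfolding panel_tree_lines_def
  proof (intro CollectI case_prodI bexI[OF _ A(1)] bexI[OF _ A(2)] exI[of _ 0] bexI[OF _ panel_facts(3)]
      bexI[OF _ alpha_real_root[of i]] conjI ballI allI)
    show "s = ideal_class (sector_face f 0 ?F)" by (simp add: s_def)
    show "alpha i v = 0" if "v \<in> ?F" for v using that by (simp add: panel_def Fv_def)
    show "l (alpha i v) = sector_germ (Q (f v) s)" for v
      unfolding s_def Q_panel[OF f panel_facts(1)] by (rule l)
  qed (use bd in \<open>auto simp: C_def\<close>)
  moreover have "strongly_transitive filtermap (stabilizer2 G s s') (panel_tree_lines s s')"
    using LST card pan opp unfolding LST_def by auto
  moreover have "- k \<in> C" using k alpha_real_root[of i] by (auto simp: C_def walls_def)
  ultimately obtain g where g: "g \<in> stabilizer2 G s s'" "\<And>t. filtermap g (l t) = l (2 * (- k) - t)"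
    using strongly_transitive_reflection by metis
  have gG: "g \<in> G" and gs: "(`) g ` s' = s'" using g(1) by (auto simp: stabilizer2_def)
  have bij: "bij g" using subgroup_facts(1)[OF G gG] .
  have germ: "filtermap g (sector_germ (sector_face f v ?F)) = sector_germ (sector_face f v' ?F)"
    if "alpha i v + alpha i v' = - 2 * k" for v v'
  proof -
    have "2 * (- k) - alpha i v = alpha i v'" using that by simp
    then show ?thesis unfolding l[symmetric] g(2) by simp
  qed
  have germ': "filtermap (inv g) (sector_germ (sector_face f v ?F)) = sector_germ (sector_face f v' ?F)"
    if "alpha i v + alpha i v' = - 2 * k" for v v'
  proof -
    have "sector_germ (sector_face f v ?F) = filtermap g (sector_germ (sector_face f v' ?F))"
      using germ[of v' v] that by (simp add: add.commute)
    then show ?thesis using bij by (simp add: filtermap_filtermap bij_is_inj)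
  qed
  have gs': "(`) (inv g) ` s' = s'"
  proof -
    have "(`) (inv g) ` (`) g ` s' = s'" using bij by (simp add: image_image bij_is_inj)
    then show ?thesis using gs by simp
  qed
  have "range f \<subseteq> g ` range f"
    by (rule germ_reflection_covers[OF G gG f _ germ, of 0]) (use gs in \<open>simp_all add: s'_def\<close>)
  moreover have "range f \<subseteq> inv g ` range f"
    by (rule germ_reflection_covers[OF G subgroup_facts(2)[OF G gG] f _ germ', of 0]) (use gs' in \<open>simp_all add: s'_def\<close>)
  then have "g ` range f \<subseteq> g ` inv g ` range f" by (rule image_mono)
  then have "g ` range f \<subseteq> range f" using bij by (simp add: image_image bij_is_surj surj_f_inv_f)
  ultimately have "g ` range f = range f" by blast
  then show ?thesis using reflection_from_germs[OF G gG f _ germ] gG by blast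
qed

text \<open>
  By (MA2) for a point, two apartments through a point have in common the translates of this point by the
  common kernel of the simple roots.
\<close>
lemma tree_class_chart:
  assumes f: "chart f"
  shows "tree_class (f v) = {f u | u. \<forall>j. alpha j u = alpha j v}"
proof
  show "{f u | u. \<forall>j. alpha j u = alpha j v} \<subseteq> tree_class (f v)"
    unfolding tree_class_def using chart_facts(2,3)[OF f] by force
  show "tree_class (f v) \<subseteq> {f u | u. \<forall>j. alpha j u = alpha j v}"
  proof
    fix q assume "q \<in> tree_class (f v)"
    then obtain A f1 u1 v1 where A: "A \<in> Apts" "f1 \<in> Isom A"
      and q: "f v = f1 u1" "q = f1 v1" "\<forall>j. alpha j u1 = alpha j v1" unfolding tree_class_def by blast
    have f1: "chart f1" using chartI A .
    have "principal {u1} \<in> MA2_filters" by (auto simp: MA2_filters_def)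
    moreover have "eventually (\<lambda>x. f1 x \<in> range f) (principal {u1})"
      using q(1) by (simp add: eventually_principal flip: q(1))
    ultimately obtain f' where f': "chart f'" "range f' = range f"
      "eventually (\<lambda>x. f' x = f1 x) (encl (principal {u1}))"
      using MA2_chart(2)[OF f1 chart_facts(2)[OF f]] by blast
    have "f' (u1 + d) = f1 (u1 + d)" if "d \<in> Fv UNIV" for d
      by (rule eventually_encl_point[OF f'(3)])
         (auto intro!: enclosed_common_kernel[OF _ _ that] simp: in_filter_def)
    moreover have "0 \<in> Fv UNIV" "v1 - u1 \<in> Fv UNIV" using q(3) by (auto simp: Fv_def)
    ultimately have eq: "f' u1 = f1 u1" "f' v1 = f1 v1" by force+
    obtain a where a: "a \<in> Wa" "f' = f \<circ> a" using chart_same_range[OF f f'(1)] f'(2) by metis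
    obtain w t where w: "w \<in> W" "\<And>v. a v = w v + t" using Wa_affine[OF a(1)] by metis
    have "f (a u1) = f v" using eq(1) q(1) a(2) by simp
    then have "a u1 = v" using chart_facts(1)[OF f] by (simp add: inj_eq)
    have "w (v1 - u1) = v1 - u1" by (rule W_fixes_common_kernel[OF w(1)]) (use q(3) in simp)
    then have "a v1 = a u1 + (v1 - u1)" using W_linear[OF w(1)] by (simp add: w(2) linear_diff algebra_simps)
    then have "a v1 = v + (v1 - u1)" using \<open>a u1 = v\<close> by simp
    moreover have "q = f (a v1)" using eq(2) q(2) a(2) by simp
    ultimately show "q \<in> {f u | u. \<forall>j. alpha j u = alpha j v}" using q(3) by force
  qed
qed

text \<open>
  For \<open>|I| = 1\<close> the fibres of the quotient map partition each apartment, so an element preserving the line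
  of an apartment stabilizes the apartment.
\<close>
lemma reflection_of_quotient_tree:
  assumes G: "vectorially_Weyl_subgroup G" and LST: "LST G" and card: "\<not> CARD('i) \<ge> 2"
    and f: "chart f" and k: "k \<in> Lam (alpha i)"
  shows "\<exists>g\<in>G. \<exists>t. (\<forall>v. g (f v) = f (refl i v + t)) \<and> alpha i t = - 2 * k"
proof -
  have "card {i, j} \<le> CARD('i)" for j by (rule card_mono) auto
  then have one: "j = i" for j using card by (metis card_2_iff le_trans not_less_eq_eq numeral_2_eq_2 order_refl)
  have all: "(\<forall>j. Y j) \<longleftrightarrow> Y i" for Y using one by metis
  define l where "l t = tree_class (f (t *\<^sub>R half_coroot i))" for t
  define C where "C = {c. wall (alpha i) (- c) \<in> walls}"
  have lv: "l (alpha i v) = {f u | u. alpha i u = alpha i v}" for v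
    unfolding l_def tree_class_chart[OF f] all by simp
  have l: "l (alpha i v) = tree_class (f v)" for v
    unfolding lv tree_class_chart[OF f] all ..
  have "(l, C) \<in> quotient_tree_lines"
    unfolding quotient_tree_lines_def using l chart_facts(2,3)[OF f] by (auto simp: C_def)
  moreover have "strongly_transitive (`) G quotient_tree_lines"
    using LST card unfolding LST_def by auto
  moreover have "- k \<in> C" using k alpha_real_root[of i] by (auto simp: C_def walls_def)
  ultimately obtain g where g: "g \<in> G" "\<And>t. g ` l t = l (2 * (- k) - t)"
    using strongly_transitive_reflection[of "(`)" G quotient_tree_lines l C "- k"] by metis
  have img: "g ` {f u | u. alpha i u = alpha i v} = {f u | u. alpha i u = - 2 * k - alpha i v}" for v
  proof -
    have "g ` l (alpha i v) = l (alpha i ((2 * (- k) - alpha i v) *\<^sub>R half_coroot i))" using g(2) by simp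
    then show ?thesis unfolding lv by simp
  qed
  have "g ` range f = range f"
  proof
    show "g ` range f \<subseteq> range f"
    proof clarify
      fix v
      have "g (f v) \<in> g ` {f u | u. alpha i u = alpha i v}" by blast
      then show "g (f v) \<in> range f" unfolding img by blast
    qed
    show "range f \<subseteq> g ` range f"
    proof clarify
      fix v
      have "f v \<in> {f u | u. alpha i u = - 2 * k - alpha i ((- 2 * k - alpha i v) *\<^sub>R half_coroot i)}" by auto
      then show "f v \<in> g ` range f" unfolding img[symmetric] by blast
    qed
  qed
  then obtain w t where w: "w \<in> W" "\<And>v. g (f v) = f (w v + t)"
    using automorphism_in_charts[OF G g(1) f f] by metis
  have a: "alpha i (w v + t) = - 2 * k - alpha i v" for v
  proof -
    have "g (f v) \<in> g ` {f u | u. alpha i u = alpha i v}" by blast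
    then obtain u where "f (w v + t) = f u" "alpha i u = - 2 * k - alpha i v" unfolding img w(2) by blast
    then show ?thesis using chart_facts(1)[OF f] by (simp add: inj_eq)
  qed
  have t: "alpha i t = - 2 * k" using a[of 0] W_linear[OF w(1)] by (simp add: linear_0)
  have "w = refl i"
    by (rule W_eq_refl_if_panel[OF w(1)]) (use a t one in \<open>force, blast\<close>)
  then show ?thesis using g(1) w(2) t by blast
qed

lemma affine_reflection_in_group:
  assumes "vectorially_Weyl_subgroup G" "LST G" "chart f" "k \<in> Lam (alpha i)"
  shows "\<exists>g\<in>G. \<exists>t. (\<forall>v. g (f v) = f (refl i v + t)) \<and> alpha i t = - 2 * k"
  using reflection_of_panel_tree[OF assms(1,2) _ assms(3,4)]
    reflection_of_quotient_tree[OF assms(1,2) _ assms(3,4)] by blast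

section \<open>Translations\<close>

definition transl :: "('p \<Rightarrow> 'p) set \<Rightarrow> ('v \<Rightarrow> 'p) \<Rightarrow> 'v set" where
  "transl G f = {d. \<exists>g\<in>G. \<forall>v. g (f v) = f (v + d)}"

lemma translations_group:
  assumes G: "vectorially_Weyl_subgroup G"
  shows "0 \<in> transl G f"
    and "a \<in> transl G f \<Longrightarrow> b \<in> transl G f \<Longrightarrow> a + b \<in> transl G f"
    and "a \<in> transl G f \<Longrightarrow> - a \<in> transl G f"
proof -
  have G': "id \<in> G" "\<And>g h. g \<in> G \<Longrightarrow> h \<in> G \<Longrightarrow> g \<circ> h \<in> G"
    using G unfolding vectorially_Weyl_subgroup_def bij_subgroup_def by auto
  show "0 \<in> transl G f" unfolding transl_def using G'(1) by (auto intro!: bexI[of _ id])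
  show "a + b \<in> transl G f" if "a \<in> transl G f" "b \<in> transl G f"
  proof -
    obtain g h where g: "g \<in> G" "\<forall>v. g (f v) = f (v + a)" "h \<in> G" "\<forall>v. h (f v) = f (v + b)"
      using \<open>a \<in> _\<close> \<open>b \<in> _\<close> unfolding transl_def by blast
    have "\<forall>v. (h \<circ> g) (f v) = f (v + (a + b))" using g by (simp add: add.assoc)
    then show ?thesis unfolding transl_def using G'(2) g by blast
  qed
  show "- a \<in> transl G f" if "a \<in> transl G f"
  proof -
    obtain g where g: "g \<in> G" "\<And>v. g (f v) = f (v + a)" using \<open>a \<in> _\<close> unfolding transl_def by blast
    have "inv g (f v) = f (v + - a)" for v
      using g(2)[of "v - a"] bij_is_inj[OF subgroup_facts(1)[OF G g(1)]] by (simp add: inv_f_eq)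
    then show ?thesis unfolding transl_def using subgroup_facts(2)[OF G g(1)] by blast
  qed
qed

lemma translations_int_scale:
  assumes G: "vectorially_Weyl_subgroup G" and a: "a \<in> transl G f"
  shows "of_int n *\<^sub>R a \<in> transl G f"
proof -
  have nat: "of_nat m *\<^sub>R a \<in> transl G f" for m
    by (induction m) (use translations_group[OF G] a in \<open>auto simp: scaleR_left_distrib\<close>)
  show ?thesis
  proof (cases "n \<ge> 0")
    case True then show ?thesis using nat[of "nat n"] by simp
  next
    case False then show ?thesis using translations_group(3)[OF G nat[of "nat (- n)"]] by simp
  qed
qed

lemma translations_sum:
  assumes G: "vectorially_Weyl_subgroup G" and "\<And>i. i \<in> I \<Longrightarrow> a i \<in> transl G f" "finite I"
  shows "(\<Sum>i\<in>I. a i) \<in> transl G f"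
  using assms(3,2) by (induction I rule: finite_induct) (auto intro: translations_group[OF G])

text \<open>
  Two of the affine maps with linear part \<open>refl i\<close>, for different walls, have as product a translation
  not in the kernel of \<open>alpha i\<close>; its difference with its conjugate is a multiple of the coroot.
\<close>
lemma coroot_translation:
  assumes G: "vectorially_Weyl_subgroup G" and LST: "LST G" and f: "chart f"
  shows "\<exists>c. c \<noteq> 0 \<and> c *\<^sub>R coalpha i \<in> transl G f"
proof -
  have many: "infinite (Lam (alpha i))" using Lam_infinite alpha_real_root by blast
  then obtain k1 where k1: "k1 \<in> Lam (alpha i)" by (metis finite.emptyI ex_in_conv)
  have "infinite (Lam (alpha i) - {k1})" using many by simp
  then obtain k2 where k2: "k2 \<in> Lam (alpha i)" "k2 \<noteq> k1" by (metis Diff_iff ex_in_conv finite.emptyI singletonI)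
  obtain g1 t1 where g1: "g1 \<in> G" "\<And>v. g1 (f v) = f (refl i v + t1)" "alpha i t1 = - 2 * k1"
    using affine_reflection_in_group[OF G LST f k1] by blast
  obtain g2 t2 where g2: "g2 \<in> G" "\<And>v. g2 (f v) = f (refl i v + t2)" "alpha i t2 = - 2 * k2"
    using affine_reflection_in_group[OF G LST f k2(1)] by blast
  have prod: "\<And>g h. g \<in> G \<Longrightarrow> h \<in> G \<Longrightarrow> g \<circ> h \<in> G"
    using G unfolding vectorially_Weyl_subgroup_def bij_subgroup_def by auto
  have lin: "linear (refl i)" by (rule linear_refl)
  define d where "d = refl i t1 + t2"
  have gd: "(g2 \<circ> g1) (f v) = f (v + d)" for v
    using g1(2) g2(2) lin by (simp add: d_def linear_add add.assoc)
  then have d: "d \<in> transl G f" unfolding transl_def using prod g1(1) g2(1) by blast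
  have "(g1 \<circ> (g2 \<circ> g1) \<circ> inv g1) (f v) = f (v + refl i d)" for v
  proof -
    have "g1 (f (refl i (v - t1))) = f v" using g1(2) by simp
    then have "inv g1 (f v) = f (refl i (v - t1))"
      using bij_is_inj[OF subgroup_facts(1)[OF G g1(1)]] by (metis inv_f_f)
    then have "(g1 \<circ> (g2 \<circ> g1) \<circ> inv g1) (f v) = g1 ((g2 \<circ> g1) (f (refl i (v - t1))))"
      by (simp only: comp_apply)
    also have "\<dots> = f (refl i (refl i (v - t1) + d) + t1)" by (simp only: gd g1(2))
    also have "refl i (refl i (v - t1) + d) + t1 = v + refl i d" using lin by (simp add: linear_add)
    finally show ?thesis .
  qed
  then have rd: "refl i d \<in> transl G f"
    unfolding transl_def using prod g1(1) g2(1) subgroup_facts(2)[OF G g1(1)] by blast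
  have "d + - refl i d \<in> transl G f" using translations_group[OF G] d rd by blast
  moreover have "d + - refl i d = alpha i d *\<^sub>R coalpha i" by (simp add: refl_def)
  moreover have "alpha i d = 2 * k1 - 2 * k2" using g1(3) g2(3) by (simp add: d_def)
  ultimately show ?thesis using k2(2) by (intro exI[of _ "alpha i d"]) auto
qed

lemma strongly_regular_element:
  assumes na: no_affine_component and G: "vectorially_Weyl_subgroup G" and LST: "LST G"
  shows "\<exists>\<gamma>\<in>G. strongly_regular_hyperbolic \<gamma>"
proof -
  have "\<exists>A. A \<in> Apts" using apts_cover by auto
  then obtain f where f: "chart f" using Apts_chart by metis
  obtain c where c: "\<And>i. c i \<noteq> 0" "\<And>i. c i *\<^sub>R coalpha i \<in> transl G f"
    using coroot_translation[OF G LST f] by metis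
  obtain n :: "'i \<Rightarrow> int" where n: "(\<Sum>i\<in>UNIV. (of_int (n i) * c i) *\<^sub>R coalpha i) \<in> Fv {}"
    using lattice_meets_chamber[OF na, of c] c(1) by blast
  define d where "d = (\<Sum>i\<in>UNIV. of_int (n i) *\<^sub>R (c i *\<^sub>R coalpha i))"
  have "d \<in> transl G f" unfolding d_def
    by (intro translations_sum[OF G] translations_int_scale[OF G] c(2)) auto
  then obtain g where g: "g \<in> G" "\<And>v. g (f v) = f (v + d)" unfolding transl_def by blast
  have d: "d \<in> Fv {}" using n by (simp add: d_def)
  have "d \<noteq> 0" using d by (auto simp: Fv_def)
  have tr: "translation_axis g f 0 d" unfolding translation_axis_def
    using \<open>d \<noteq> 0\<close> g(2) by (auto intro!: exI[of _ 1] simp: scaleR_left_distrib)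
  have "d \<in> vec_face 1 id {}" using d by (simp add: vec_face_def)
  moreover have "finite (W_par {})" by (simp add: W_par_empty)
  ultimately have "d \<in> tits_cone_sph" unfolding tits_cone_sph_def using W_id by blast
  moreover have "\<forall>b\<in>real_roots. b d \<noteq> 0" using real_root_on_chamber d by blast
  moreover have "g \<in> Aut" using subgroup_facts(4)[OF G g(1)] .
  ultimately have "strongly_regular_hyperbolic g"
    unfolding strongly_regular_hyperbolic_def hyperbolic_def
    using tr chart_facts(2,3)[OF f] by blast
  then show ?thesis using g(1) by blast
qed

end

theorem theorem5p2:
  fixes alpha :: "'i::finite \<Rightarrow> 'v::euclidean_space \<Rightarrow> real"
    and coalpha :: "'i \<Rightarrow> 'v"
    and Lam :: "('v \<Rightarrow> real) \<Rightarrow> real set"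
    and Apts :: "'p set set"
    and Isom :: "'p set \<Rightarrow> ('v \<Rightarrow> 'p) set"
    and G :: "('p \<Rightarrow> 'p) set"
  assumes "masure alpha coalpha Lam Apts Isom"
    and "pre_masure.thick alpha coalpha Apts Isom"
    and "root_datum.no_affine_component alpha coalpha"
    and "pre_masure.vectorially_Weyl_subgroup alpha coalpha Lam Apts Isom G"
    and "pre_masure.transitive_on_apartments Apts G"
    and "pre_masure.LST alpha coalpha Lam Apts Isom G"
  shows "\<exists>\<gamma>\<in>G. pre_masure.strongly_regular_hyperbolic alpha coalpha Lam Apts Isom \<gamma>"
  using masure.strongly_regular_element[OF assms(1,3,4,6)] .

end
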